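(* Assume the small data condition $$\eta^{-2}M\left(2(Ri\,C_P^2\kappa^{-1}\|\gamma\|_{-1}+\|f\|_{-1})+\kappa^{-2}M\|\gamma\|_{-1}^2\right)<1,\qquad \eta^{-1}Ri\,C_P^2<1,$$ and assume the problem data is such that $G$ is contractive, i.e. $C_G<1$, where $C_G=\nu^{-1/2}\eta^{-1/2}M\sqrt{2K_1^2+3K_2^2}$. Let $F(u,\theta):=G(u,\theta)-(u,\theta)$. Then there exists a constant $\sigma>0$ such that $$\|F(u,\theta)-F(w,z)\|_B\ge\sigma\|(u,\theta)-(w,z)\|_B$$ for any $(u,\theta),(w,z)\in V_h\times W_h$ with $\|\nabla u\|\le K_1$ and $\|\nabla w\|\le K_1$.
   Context: Setting. $\Omega\subset\mathbb{R}^d$ ($d=2$ or $3$) is a bounded simply connected domain that is either a convex polytope or has smooth boundary. $(\cdot,\cdot)$ and $\|\cdot\|$ are the $L^2(\Omega)$ inner product (also used for duality pairings) and norm. $X=H_0^1(\Omega)^d$, $Q=L_0^2(\Omega)$ (mean-zero $L^2$ functions), $W=H_0^1(\Omega)$. $\|\cdot\|_{-1}$ is the norm dual to $v\mapsto\|\nabla v\|$. $C_P>0$ is a Poincaré constant: $\|v\|\le C_P\|\nabla v\|$ for $v\in X$ or $v\in W$. Define $b(u,v,w)=\frac12((u\cdot\nabla v,w)-(u\cdot\nabla w,v))$ on $X\times X\times X$ and $b^*(v,\phi,\psi)=\frac12((v\cdot\nabla\phi,\psi)-(v\cdot\nabla\psi,\phi))$ on $X\times W\times W$. $M>0$ is a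 constant depending only on $\Omega$ with $b(u,v,w)\le M\|\nabla u\|\|\nabla v\|\|\nabla w\|$ and $b^*(v,\phi,\psi)\le M\|\nabla v\|\|\nabla\phi\|\|\nabla\psi\|$. $X_h\subset X$, $Q_h\subset Q$, $W_h\subset W$ are finite-dimensional (finite element) subspaces with $(X_h,Q_h)$ satisfying the discrete inf-sup condition, and $V_h=\{v\in X_h:(\nabla\cdot v,q)=0\ \forall q\in Q_h\}$. The parameters $\nu,\kappa,Ri$ are positive, $\eta=\min\{\nu,\kappa\}$, $f\in H^{-1}(\Omega)^d$, $\gamma\in H^{-1}(\Omega)$. $\langle 0,\theta\rangle^T$ is the vector field whose last component is $\theta$ and whose other components are zero. Constants: $K_1=Ri\,C_P^2\nu^{-1}\kappa^{-1}\|\gamma\|_{-1}+\nu^{-1}\|f\|_{-1}$, $K_2=\kappa^{-1}\|\gamma\|_{-1}$. Norm: $\|(v,w)\|_B=\sqrt{\nu\|\nabla v\|^2+\kappa\|\nabla w\|^2}$ on $V_h\times W_h$. Operator $G$. For $(u,\theta)\in V_h\times W_h$, $G(u,\theta):=(\tilde u,\tilde\theta)\in V_h\times W_h$ is the (unique) solution of $$b(u,\tilde u,v)+\nu(\nabla\tilde u,\nabla v)=Ri(\langle 0,\tilde\theta\rangle^T,v)+(f,v),\qquad b^*(u,\tilde\theta,\chi)+\kappa(\nabla\tilde\theta,\nabla\chi)=(\gamma,\chi)$$ for all $(v,\chi)\in V_h\times W_h$. *)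

theory Defs
  imports "HOL-Analysis.Analysis" "HOL-Library.Function_Algebras"
begin

text \<open>
  Functions on \<open>\<Omega>\<close> are represented by total functions on \<open>real ^ 'd\<close> whose values outside
  \<open>\<Omega>\<close> are irrelevant; almost everywhere equal functions are not identified. The pointwise
  vector space structure below makes the library's \<open>span\<close> and \<open>subspace\<close>, and \<open>+\<close>, \<open>-\<close> on
  pairs, available for them.
\<close>

instantiation "fun" :: (type, real_vector) real_vector
begin

definition "scaleR r f = (\<lambda>x. r *\<^sub>R f x)"

instance
  by standard
    (simp_all add: scaleR_fun_def fun_eq_iff scaleR_add_right scaleR_add_left)

end

type_synonym 'd scalar_field = "real ^ 'd \<Rightarrow> real"
type_synonym 'd vector_field = "real ^ 'd \<Rightarrow> real ^ 'd"

primrec C_k :: "nat \<Rightarrow> (real ^ 'd \<Rightarrow> real) \<Rightarrow> bool" where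
  "C_k 0 f \<longleftrightarrow> continuous_on UNIV f"
| "C_k (Suc k) f \<longleftrightarrow> (\<exists>g. (\<forall>x. GDERIV f x :> g x) \<and> (\<forall>i. C_k k (\<lambda>x. g x $ i)))"

definition smooth :: "(real ^ 'd \<Rightarrow> real) \<Rightarrow> bool" where
  "smooth f \<longleftrightarrow> (\<forall>k. C_k k f)"

text \<open>
  Near each boundary point the domain lies strictly on one side of the graph of a smooth function,
  in suitably rotated coordinates \<open>T x\<close>. The function of the
  remaining \<open>d - 1\<close> coordinates is encoded as a function on \<open>real ^ 'd\<close> that does not depend on
  coordinate \<open>i\<close>.
\<close>

definition smooth_boundary :: "(real ^ 'd) set \<Rightarrow> bool" where
  "smooth_boundary \<Omega> \<longleftrightarrow>
    (\<forall>p \<in> frontier \<Omega>. \<exists>r > 0. \<exists>(T :: real ^ 'd \<Rightarrow> real ^ 'd) i g.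
       orthogonal_transformation T \<and> smooth g \<and> (\<forall>x t. g (x + t *\<^sub>R axis i 1) = g x) \<and>
       \<Omega> \<inter> ball p r = {x \<in> ball p r. T x $ i > g (T x)})"

text \<open>Polytopes of the library are closed, hence the interior.\<close>

definition convex_polytope_domain :: "(real ^ 'd) set \<Rightarrow> bool" where
  "convex_polytope_domain \<Omega> \<longleftrightarrow> (\<exists>P. polytope P \<and> \<Omega> = interior P)"

definition admissible_domain :: "(real ^ 'd) set \<Rightarrow> bool" where
  "admissible_domain \<Omega> \<longleftrightarrow>
     open \<Omega> \<and> connected \<Omega> \<and> \<Omega> \<noteq> {} \<and> bounded \<Omega> \<and> simply_connected \<Omega> \<and>
     (convex_polytope_domain \<Omega> \<or> smooth_boundary \<Omega>)"

definition L2 :: "(real ^ 'd) set \<Rightarrow> (real ^ 'd \<Rightarrow> 'b :: euclidean_space) set" where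
  "L2 \<Omega> = {f. f \<in> borel_measurable (lebesgue_on \<Omega>) \<and>
              integrable (lebesgue_on \<Omega>) (\<lambda>x. (norm (f x))\<^sup>2)}"

definition L2_inner ::
  "(real ^ 'd) set \<Rightarrow> (real ^ 'd \<Rightarrow> 'b :: euclidean_space) \<Rightarrow> (real ^ 'd \<Rightarrow> 'b) \<Rightarrow> real" where
  "L2_inner \<Omega> f g = (LINT x|lebesgue_on \<Omega>. f x \<bullet> g x)"

definition L2_norm :: "(real ^ 'd) set \<Rightarrow> (real ^ 'd \<Rightarrow> 'b :: euclidean_space) \<Rightarrow> real" where
  "L2_norm \<Omega> f = sqrt (L2_inner \<Omega> f f)"

definition test_functions :: "(real ^ 'd) set \<Rightarrow> 'd scalar_field set" where
  "test_functions \<Omega> = {\<phi>. smooth \<phi> \<and> (\<exists>K. compact K \<and> K \<subseteq> \<Omega> \<and> (\<forall>x. x \<notin> K \<longrightarrow> \<phi> x = 0))}"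

definition has_weak_grad ::
  "(real ^ 'd) set \<Rightarrow> 'd scalar_field \<Rightarrow> 'd vector_field \<Rightarrow> bool" where
  "has_weak_grad \<Omega> u g \<longleftrightarrow> u \<in> L2 \<Omega> \<and> g \<in> L2 \<Omega> \<and>
    (\<forall>\<phi> \<in> test_functions \<Omega>. \<forall>i.
       L2_inner \<Omega> u (\<lambda>x. frechet_derivative \<phi> (at x) (axis i 1)) =
       - L2_inner \<Omega> (\<lambda>x. g x $ i) \<phi>)"

text \<open>The weak gradient is determined only up to a null set; some representative is chosen.\<close>

definition weak_grad ::
  "(real ^ 'd) set \<Rightarrow> 'd scalar_field \<Rightarrow> 'd vector_field" where
  "weak_grad \<Omega> u = (SOME g. has_weak_grad \<Omega> u g)"

definition H1 :: "(real ^ 'd) set \<Rightarrow> 'd scalar_field set" where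
  "H1 \<Omega> = {u. \<exists>g. has_weak_grad \<Omega> u g}"

definition H1_norm :: "(real ^ 'd) set \<Rightarrow> 'd scalar_field \<Rightarrow> real" where
  "H1_norm \<Omega> u = sqrt ((L2_norm \<Omega> u)\<^sup>2 + (L2_norm \<Omega> (weak_grad \<Omega> u))\<^sup>2)"

definition H10 :: "(real ^ 'd) set \<Rightarrow> 'd scalar_field set" where
  "H10 \<Omega> = {u \<in> H1 \<Omega>. \<exists>\<phi> :: nat \<Rightarrow> 'd scalar_field.
      (\<forall>n. \<phi> n \<in> test_functions \<Omega>) \<and> (\<lambda>n. H1_norm \<Omega> (\<phi> n - u)) \<longlonglongrightarrow> 0}"

definition H10_vec :: "(real ^ 'd) set \<Rightarrow> 'd vector_field set" where
  "H10_vec \<Omega> = {u. \<forall>i. (\<lambda>x. u x $ i) \<in> H10 \<Omega>}"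

definition L20 :: "(real ^ 'd) set \<Rightarrow> 'd scalar_field set" where
  "L20 \<Omega> = {q \<in> L2 \<Omega>. (LINT x|lebesgue_on \<Omega>. q x) = 0}"

text \<open>
  Row \<open>i\<close> of the matrix \<open>weak_grad_vec \<Omega> u x\<close> is the gradient of the \<open>i\<close>-th component. The inner
  product of \<open>real ^ 'd ^ 'd\<close> is the Frobenius one, and \<open>weak_grad_vec \<Omega> v x *v u x\<close> is the
  value of \<open>u \<cdot> \<nabla>v\<close> at \<open>x\<close>.
\<close>

definition weak_grad_vec ::
  "(real ^ 'd) set \<Rightarrow> 'd vector_field \<Rightarrow> real ^ 'd \<Rightarrow> real ^ 'd ^ 'd" where
  "weak_grad_vec \<Omega> u x = (\<chi> i. weak_grad \<Omega> (\<lambda>y. u y $ i) x)"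

definition weak_div ::
  "(real ^ 'd) set \<Rightarrow> 'd vector_field \<Rightarrow> 'd scalar_field" where
  "weak_div \<Omega> u x = (\<Sum>i\<in>UNIV. weak_grad_vec \<Omega> u x $ i $ i)"

definition grad_norm :: "(real ^ 'd) set \<Rightarrow> 'd scalar_field \<Rightarrow> real" where
  "grad_norm \<Omega> u = L2_norm \<Omega> (weak_grad \<Omega> u)"

definition grad_norm_vec :: "(real ^ 'd) set \<Rightarrow> 'd vector_field \<Rightarrow> real" where
  "grad_norm_vec \<Omega> u = L2_norm \<Omega> (weak_grad_vec \<Omega> u)"

text \<open>
  With \<open>S = H10 \<Omega>\<close>, \<open>N = grad_norm \<Omega>\<close> (or the vector versions), \<open>dual_space S N\<close> is \<open>H\<^sup>-\<^sup>1\<close> and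
  \<open>dual_norm S N\<close> its norm; the duality pairing \<open>(f, v)\<close> is the application \<open>f v\<close>.
\<close>

definition dual_space :: "'v :: real_vector set \<Rightarrow> ('v \<Rightarrow> real) \<Rightarrow> ('v \<Rightarrow> real) set" where
  "dual_space S N = {f. (\<forall>u \<in> S. \<forall>v \<in> S. f (u + v) = f u + f v) \<and>
                        (\<forall>a. \<forall>v \<in> S. f (a *\<^sub>R v) = a * f v) \<and>
                        (\<exists>C. \<forall>v \<in> S. \<bar>f v\<bar> \<le> C * N v)}"

definition dual_norm :: "'v :: real_vector set \<Rightarrow> ('v \<Rightarrow> real) \<Rightarrow> ('v \<Rightarrow> real) \<Rightarrow> real" where
  "dual_norm S N f = (SUP v \<in> {v \<in> S. N v \<le> 1}. \<bar>f v\<bar>)"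

definition b_form ::
  "(real ^ 'd) set \<Rightarrow> 'd vector_field \<Rightarrow> 'd vector_field \<Rightarrow>
   'd vector_field \<Rightarrow> real" where
  "b_form \<Omega> u v w =
    1/2 * (L2_inner \<Omega> (\<lambda>x. weak_grad_vec \<Omega> v x *v u x) w -
           L2_inner \<Omega> (\<lambda>x. weak_grad_vec \<Omega> w x *v u x) v)"

definition b_star ::
  "(real ^ 'd) set \<Rightarrow> 'd vector_field \<Rightarrow> 'd scalar_field \<Rightarrow>
   'd scalar_field \<Rightarrow> real" where
  "b_star \<Omega> v \<phi> \<psi> =
    1/2 * (L2_inner \<Omega> (\<lambda>x. v x \<bullet> weak_grad \<Omega> \<phi> x) \<psi> -
           L2_inner \<Omega> (\<lambda>x. v x \<bullet> weak_grad \<Omega> \<psi> x) \<phi>)"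

definition finite_dim_subspace :: "'v :: real_vector set \<Rightarrow> 'v set \<Rightarrow> bool" where
  "finite_dim_subspace S T \<longleftrightarrow> S \<subseteq> T \<and> (\<exists>B. finite B \<and> S = span B)"

text \<open>A field \<open>v\<close> with \<open>\<nabla>v = 0\<close> contributes \<open>0\<close> to the supremum, since \<open>x / 0 = 0\<close>.\<close>

definition discrete_inf_sup ::
  "(real ^ 'd) set \<Rightarrow> 'd vector_field set \<Rightarrow> 'd scalar_field set \<Rightarrow> bool" where
  "discrete_inf_sup \<Omega> Xh Qh \<longleftrightarrow>
    (\<exists>\<beta> > 0. \<forall>q \<in> Qh.
       \<beta> * L2_norm \<Omega> q \<le> (SUP v \<in> Xh. L2_inner \<Omega> (weak_div \<Omega> v) q / grad_norm_vec \<Omega> v))"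

definition discretely_div_free ::
  "(real ^ 'd) set \<Rightarrow> 'd vector_field set \<Rightarrow> 'd scalar_field set \<Rightarrow>
   'd vector_field set" where
  "discretely_div_free \<Omega> Xh Qh = {v \<in> Xh. \<forall>q \<in> Qh. L2_inner \<Omega> (weak_div \<Omega> v) q = 0}"

text \<open>The coordinate index type is linearly ordered so that there is a last component.\<close>

definition last_component ::
  "'d :: {finite, linorder} scalar_field \<Rightarrow> 'd vector_field" where
  "last_component \<theta> x = axis (Max UNIV) (\<theta> x)"

definition B_norm ::
  "(real ^ 'd) set \<Rightarrow> real \<Rightarrow> real \<Rightarrow>
   'd vector_field \<times> 'd scalar_field \<Rightarrow> real" where
  "B_norm \<Omega> \<nu> \<kappa> = (\<lambda>(v, w). sqrt (\<nu> * (grad_norm_vec \<Omega> v)\<^sup>2 + \<kappa> * (grad_norm \<Omega> w)\<^sup>2))"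

definition solves_Picard ::
  "(real ^ 'd :: {finite, linorder}) set \<Rightarrow> real \<Rightarrow> real \<Rightarrow> real \<Rightarrow>
   ('d vector_field \<Rightarrow> real) \<Rightarrow> ('d scalar_field \<Rightarrow> real) \<Rightarrow>
   'd vector_field set \<Rightarrow> 'd scalar_field set \<Rightarrow>
   'd vector_field \<Rightarrow> 'd vector_field \<Rightarrow> 'd scalar_field \<Rightarrow> bool" where
  "solves_Picard \<Omega> \<nu> \<kappa> Ri f \<gamma> Vh Wh u ut \<theta>t \<longleftrightarrow>
     ut \<in> Vh \<and> \<theta>t \<in> Wh \<and>
     (\<forall>v \<in> Vh. b_form \<Omega> u ut v + \<nu> * L2_inner \<Omega> (weak_grad_vec \<Omega> ut) (weak_grad_vec \<Omega> v) =
               Ri * L2_inner \<Omega> (last_component \<theta>t) v + f v) \<and>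
     (\<forall>\<psi> \<in> Wh. b_star \<Omega> u \<theta>t \<psi> + \<kappa> * L2_inner \<Omega> (weak_grad \<Omega> \<theta>t) (weak_grad \<Omega> \<psi>) = \<gamma> \<psi>)"

text \<open>
  The solution is unique up to almost everywhere equality, so \<open>SOME\<close> only selects a representative
  of the solution in \<open>Vh \<times> Wh\<close>.
\<close>

definition G_op ::
  "(real ^ 'd :: {finite, linorder}) set \<Rightarrow> real \<Rightarrow> real \<Rightarrow> real \<Rightarrow>
   ('d vector_field \<Rightarrow> real) \<Rightarrow> ('d scalar_field \<Rightarrow> real) \<Rightarrow>
   'd vector_field set \<Rightarrow> 'd scalar_field set \<Rightarrow>
   'd vector_field \<times> 'd scalar_field \<Rightarrow>
   'd vector_field \<times> 'd scalar_field" where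
  "G_op \<Omega> \<nu> \<kappa> Ri f \<gamma> Vh Wh =
     (\<lambda>(u, \<theta>). SOME (ut, \<theta>t). solves_Picard \<Omega> \<nu> \<kappa> Ri f \<gamma> Vh Wh u ut \<theta>t)"

definition F_op ::
  "(real ^ 'd :: {finite, linorder}) set \<Rightarrow> real \<Rightarrow> real \<Rightarrow> real \<Rightarrow>
   ('d vector_field \<Rightarrow> real) \<Rightarrow> ('d scalar_field \<Rightarrow> real) \<Rightarrow>
   'd vector_field set \<Rightarrow> 'd scalar_field set \<Rightarrow>
   'd vector_field \<times> 'd scalar_field \<Rightarrow>
   'd vector_field \<times> 'd scalar_field" where
  "F_op \<Omega> \<nu> \<kappa> Ri f \<gamma> Vh Wh p = G_op \<Omega> \<nu> \<kappa> Ri f \<gamma> Vh Wh p - p"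

end

theory Submission
  imports Defs
begin

text \<open>
  If \<open>G\<close> is a contraction with constant \<open>C\<^sub>G < 1\<close> in the \<open>B\<close>-norm, then the triangle inequality for
  \<open>p - q = (G p - G q) - (F p - F q)\<close> gives the claim with \<open>\<sigma> = 1 - C\<^sub>G\<close>. For the contraction one
  subtracts the equations of two solutions and tests with their difference: the convection terms are
  skew-symmetric, so only the difference of the convecting velocities contributes, and this is
  controlled by the a priori bounds \<open>K\<^sub>1\<close> and \<open>K\<^sub>2\<close> on the gradients of the solutions.

  Testing presupposes that the forms are additive. Weak gradients are additive only up to null sets,
  by the fundamental lemma of the calculus of variations, which needs smooth bump functions; and the
  integral of the product \<open>(u \<cdot> \<nabla>v) \<cdot> w\<close>, by convention \<open>0\<close> when the product is not integrable, is
  additive because \<open>u\<close> and \<open>w\<close> lie in \<open>L\<^sup>4\<close>, by Ladyzhenskaya's inequality. This is where the dimension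
  enters.
\<close>

subsection \<open>Smooth bump functions\<close>

text \<open>\<open>G_op\<close> is a \<open>SOME\<close>, so nothing can be said about its values
  before the Picard equations are shown to be solvable in \<open>Vh \<times> Wh\<close>. The energy
  is only a seminorm on total functions, hence existence is proved for forms that may have null
  vectors. The estimates are made for arbitrary solutions and so apply to whichever one is chosen.

  The constant \<open>C\<^sub>G\<close> comes from two tested equations. Let d, e and \<epsilon> be
  the gradient norms of the differences of the convecting velocities, the new velocities and the new
  temperatures. Then \<open>\<kappa> * \<epsilon> \<le> M * d * K\<^sub>2\<close> and \<open>\<nu> *
  e \<le> Ri * C\<^sub>P\<^sup>2 * \<epsilon> + M * d * K\<^sub>1\<close>. The condition
  \<open>inverse \<eta> * Ri * C\<^sub>P\<^sup>2 < 1\<close> bounds the buoyancy term by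
  \<open>\<kappa> * \<epsilon>\<close>, whence
  \<open>\<nu> * e \<le> M * d * (K\<^sub>1 + K\<^sub>2)\<close>. Squaring and adding the two bounds
  produces the root in \<open>C\<^sub>G\<close>.\<close>

lemma GDERIV_unique:
  assumes "GDERIV f x :> a" "GDERIV f x :> b"
  shows "a = b"
proof -
  have "(\<lambda>h. h \<bullet> a) = (\<lambda>h. h \<bullet> b)"
    using assms has_derivative_unique unfolding gderiv_def by blast
  then have "(a - b) \<bullet> (a - b) = 0"
    by (metis inner_diff_right right_minus_eq)
  then show ?thesis by simp
qed

lemma GDERIV_isCont: "GDERIV f x :> a \<Longrightarrow> isCont f x"
  unfolding gderiv_def by (rule has_derivative_continuous)

lemma C_k_SucI:
  assumes "\<And>x. GDERIV f x :> g x" "\<And>i. C_k k (\<lambda>x. g x $ i)"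
  shows "C_k (Suc k) f"
  using assms by auto

text \<open>In the product rule each factor also appears undifferentiated; the induction for
  products needs it at one order less.\<close>

lemma C_k_SucD: "C_k (Suc k) f \<Longrightarrow> C_k k f"
proof (induction k arbitrary: f)
  case 0
  then show ?case
    by (auto simp: continuous_on_eq_continuous_at intro: GDERIV_isCont)
next
  case (Suc k)
  then obtain g where g: "\<And>x. GDERIV f x :> g x" "\<And>i. C_k (Suc k) (\<lambda>x. g x $ i)"
    by (auto simp del: C_k.simps(1) simp: C_k.simps(2)[of "Suc k"])
  show ?case
    using g Suc.IH by (intro C_k_SucI) blast+
qed

lemma C_k_const [simp]: "C_k k (\<lambda>x. c)"
proof (induction k arbitrary: c)
  case (Suc k)
  then show ?case
    by (intro C_k_SucI[where g = "\<lambda>x. 0"]) (auto simp: GDERIV_const)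
qed auto

lemma C_k_add: "C_k k f \<Longrightarrow> C_k k g \<Longrightarrow> C_k k (\<lambda>x. f x + g x)"
proof (induction k arbitrary: f g)
  case 0
  then show ?case by (simp add: continuous_on_add)
next
  case (Suc k)
  obtain f' where f: "\<And>x. GDERIV f x :> f' x" "\<And>i. C_k k (\<lambda>x. f' x $ i)"
    using Suc.prems(1) by auto
  obtain g' where g: "\<And>x. GDERIV g x :> g' x" "\<And>i. C_k k (\<lambda>x. g' x $ i)"
    using Suc.prems(2) by auto
  show ?case
    using f g by (intro C_k_SucI[OF GDERIV_add]) (auto intro: Suc.IH)
qed

lemma C_k_mult: "C_k k f \<Longrightarrow> C_k k g \<Longrightarrow> C_k k (\<lambda>x. f x * g x)"
proof (induction k arbitrary: f g)
  case 0
  then show ?case by (simp add: continuous_on_mult)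
next
  case (Suc k)
  obtain f' where f: "\<And>x. GDERIV f x :> f' x" "\<And>i. C_k k (\<lambda>x. f' x $ i)"
    using Suc.prems(1) by auto
  obtain g' where g: "\<And>x. GDERIV g x :> g' x" "\<And>i. C_k k (\<lambda>x. g' x $ i)"
    using Suc.prems(2) by auto
  have fg: "C_k k f" "C_k k g"
    using Suc.prems C_k_SucD by blast+
  show ?case
    using f g fg by (intro C_k_SucI[OF GDERIV_mult]) (auto intro!: Suc.IH C_k_add)
qed

lemma C_k_prod:
  assumes "finite I" "\<And>i. i \<in> I \<Longrightarrow> C_k k (f i)"
  shows "C_k k (\<lambda>x. \<Prod>i\<in>I. f i x)"
  using assms by (induction I rule: finite_induct) (auto intro: C_k_mult)

text \<open>The polynomial factor in \<open>1/t\<close> makes this class closed under differentiation.\<close>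

definition flat :: "real poly \<Rightarrow> real \<Rightarrow> real" where
  "flat p t = (if t \<le> 0 then 0 else poly p (1 / t) * exp (- (1 / t)))"

lemma poly_times_exp_minus_tendsto_0: "((\<lambda>s. poly p s * exp (- s :: real)) \<longlongrightarrow> 0) at_top"
proof -
  have "((\<lambda>s::real. \<Sum>i\<le>degree p. coeff p i * (s ^ i / exp s)) \<longlongrightarrow>
         (\<Sum>i\<le>degree p. coeff p i * 0)) at_top"
    by (intro tendsto_sum tendsto_mult tendsto_const tendsto_power_div_exp_0)
  then show ?thesis
    by (simp add: poly_altdef exp_minus divide_inverse sum_distrib_right mult.assoc)
qed

text \<open>With s = 1/t one has d/dt = -s^2 d/ds, and p(s) exp(-s) has the s-derivative (p' - p)(s)
  exp(-s); hence the new polynomial s^2 (p - p').\<close>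

lemma flat_DERIV: "(flat p has_real_derivative flat (monom 1 2 * (p - pderiv p)) t) (at t)"
proof -
  consider "t < 0" | "t = 0" | "t > 0" by linarith
  then show ?thesis
  proof cases
    case 1
    have "((\<lambda>_. 0) has_real_derivative 0) (at t)" by simp
    then have "(flat p has_real_derivative 0) (at t)"
      by (rule DERIV_cong_ev[THEN iffD1, rotated -1])
         (use 1 in \<open>auto simp: flat_def intro!: eventually_mono[OF eventually_nhds_in_open[of "{..<0}" t]]\<close>)
    then show ?thesis using 1 by (simp add: flat_def)
  next
    case 2
    have "((\<lambda>h. (flat p h - flat p 0) / h) \<longlongrightarrow> 0) (at 0)"
    proof (rule filterlim_split_at)
      have "((\<lambda>h::real. 0) \<longlongrightarrow> 0) (at_left 0)" by simp
      then show "((\<lambda>h. (flat p h - flat p 0) / h) \<longlongrightarrow> 0) (at_left 0)"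
        by (rule tendsto_cong[THEN iffD1, rotated])
           (auto simp: flat_def eventually_at_filter)
      \<comment> \<open>In terms of s = 1/h the difference quotient at 0 is s p(s) exp(-s), and
        \<open>pCons 0 p\<close> is the polynomial s p(s).\<close>
      have "((\<lambda>h. poly (pCons 0 p) (inverse h) * exp (- inverse h)) \<longlongrightarrow> 0) (at_right 0)"
        by (rule filterlim_compose[OF poly_times_exp_minus_tendsto_0 filterlim_inverse_at_top_right])
      then show "((\<lambda>h. (flat p h - flat p 0) / h) \<longlongrightarrow> 0) (at_right 0)"
        by (rule tendsto_cong[THEN iffD1, rotated])
           (auto simp: flat_def eventually_at_filter field_simps)
    qed
    then show ?thesis using 2 by (simp add: DERIV_def flat_def)
  next
    case 3
    have "((\<lambda>t. poly p (1 / t) * exp (- (1 / t))) has_real_derivative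
            poly (monom 1 2 * (p - pderiv p)) (1 / t) * exp (- (1 / t))) (at t)"
      using 3 by (auto intro!: derivative_eq_intros
          simp: poly_monom field_simps power2_eq_square)
    then have "(flat p has_real_derivative
            poly (monom 1 2 * (p - pderiv p)) (1 / t) * exp (- (1 / t))) (at t)"
      by (rule DERIV_cong_ev[THEN iffD1, rotated -1])
         (use 3 in \<open>auto simp: flat_def intro!: eventually_mono[OF eventually_nhds_in_open[of "{0<..}" t]]\<close>)
    then show ?thesis using 3 by (simp add: flat_def)
  qed
qed

lemma C_k_flat: "C_k k (\<lambda>x. flat p (c * x $ i + d))"
proof (induction k arbitrary: p)
  case 0
  have "continuous_on UNIV (flat p)"
    using flat_DERIV by (auto simp: continuous_on_eq_continuous_at intro: DERIV_isCont)
  then have "continuous_on UNIV (\<lambda>x. flat p (c * x $ i + d))"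
    by (rule continuous_on_compose2) (auto intro!: continuous_intros)
  then show ?case by simp
next
  case (Suc k)
  have "GDERIV (\<lambda>x. c * x $ i + d) x :> c *\<^sub>R axis i 1" for x
    unfolding gderiv_def
    by (auto intro!: derivative_eq_intros bounded_linear.has_derivative[OF bounded_linear_vec_nth]
        simp: inner_axis)
  from GDERIV_DERIV_compose[OF this flat_DERIV] show ?case
    by (rule C_k_SucI) (auto intro!: C_k_mult Suc.IH)
qed

text \<open>For t > 0, \<open>flat 1 t\<close> is exp(-1/t), which tends to 1 at infinity.
  Stretching the distance to each face by \<open>n\<close> therefore makes the product converge to
  the indicator of the open box, without enlarging the support.\<close>

definition box_bump :: "nat \<Rightarrow> (real ^ 'd::finite) \<Rightarrow> real ^ 'd \<Rightarrow> 'd scalar_field" where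
  "box_bump n a b x =
    (\<Prod>i\<in>UNIV. flat 1 (real n * x $ i - real n * a $ i) * flat 1 (real n * b $ i - real n * x $ i))"

lemma smooth_box_bump:
  fixes a b :: "real ^ 'd"
  shows "smooth (box_bump n a b)"
proof -
  have "C_k k (\<lambda>x. flat 1 (real n * x $ i - real n * a $ i) * flat 1 (real n * b $ i - real n * x $ i))"
    for k and i :: 'd
    using C_k_mult[OF C_k_flat[of k 1 n i "- (real n * a $ i)"] C_k_flat[of k 1 "- real n" i "n * b $ i"]]
    by (simp add: algebra_simps)
  then show ?thesis
    unfolding smooth_def box_bump_def[abs_def] by (auto intro: C_k_prod)
qed

lemma box_bump_outside: "x \<notin> box a b \<Longrightarrow> box_bump n a b x = 0"
  unfolding box_bump_def mem_box_cart
  by (auto simp: not_less flat_def intro!: prod_zero mult_left_mono)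

lemma box_bump_test: "cbox a b \<subseteq> \<Omega> \<Longrightarrow> box_bump n a b \<in> test_functions \<Omega>"
  unfolding test_functions_def
  using smooth_box_bump box_subset_cbox[of a b]
  by (intro CollectI conjI exI[of _ "cbox a b"]) (auto intro: box_bump_outside)

lemma box_bump_bound: "\<bar>box_bump n a b x\<bar> \<le> 1"
proof -
  have "0 \<le> flat 1 t \<and> flat 1 t \<le> 1" for t by (simp add: flat_def)
  then have "\<bar>box_bump n a b x\<bar> \<le> (\<Prod>i\<in>(UNIV::'a set). 1)"
    unfolding box_bump_def abs_prod
    by (intro prod_mono) (auto simp: abs_mult intro!: mult_le_one)
  then show ?thesis by simp
qed

lemma box_bump_tendsto: "(\<lambda>n. box_bump n a b x) \<longlonglongrightarrow> indicator (box a b) x"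
proof (cases "x \<in> box a b")
  case True
  have 1: "(\<lambda>n. flat 1 (real n * u - real n * v)) \<longlonglongrightarrow> 1" if "v < u" for u v :: real
  proof -
    have "(\<lambda>n. exp (- (1 / (u - v)) * inverse (real n))) \<longlonglongrightarrow> exp (- (1 / (u - v)) * 0)"
      by (intro tendsto_intros lim_inverse_n)
    then have "(\<lambda>n. exp (- (1 / (u - v)) * inverse (real n))) \<longlonglongrightarrow> 1" by simp
    then show ?thesis
    proof (rule tendsto_cong[THEN iffD1, rotated])
      show "\<forall>\<^sub>F n in sequentially. exp (- (1 / (u - v)) * inverse (real n)) = flat 1 (real n * u - real n * v)"
        using eventually_gt_at_top[of 0]
      proof eventually_elim
        case (elim n)
        have "real n * u - real n * v = real n * (u - v)" by (simp add: algebra_simps)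
        then show ?case using elim that by (simp add: flat_def field_simps mult_le_0_iff)
      qed
    qed
  qed
  have "(\<lambda>n. box_bump n a b x) \<longlonglongrightarrow> (\<Prod>i\<in>(UNIV::'a set). 1 * 1)"
    unfolding box_bump_def using True
    by (intro tendsto_prod tendsto_mult 1) (auto simp: mem_box_cart)
  then show ?thesis using True by simp
next
  case False
  then show ?thesis by (simp add: box_bump_outside)
qed

section \<open>Test functions and their gradients\<close>

lemma smooth_continuous: "smooth f \<Longrightarrow> continuous_on UNIV f"
  unfolding smooth_def by (metis C_k.simps(1))

lemma test_function_borel: "\<phi> \<in> test_functions \<Omega> \<Longrightarrow> \<phi> \<in> borel_measurable borel"
  unfolding test_functions_def
  by (auto intro: borel_measurable_continuous_onI smooth_continuous)

text \<open>Bridges three encodings: \<open>C_k\<close> speaks of gradients componentwise, weak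
  gradients are tested with \<open>frechet_derivative\<close>, and integration needs the function
  and its gradient to vanish off one compact set.\<close>

lemma test_function_gradient:
  assumes "\<phi> \<in> test_functions \<Omega>"
  obtains g K where "\<And>x. GDERIV \<phi> x :> g x" "continuous_on UNIV g"
    "\<And>x i. frechet_derivative \<phi> (at x) (axis i 1) = g x $ i"
    "compact K" "K \<subseteq> \<Omega>" "\<And>x. x \<notin> K \<Longrightarrow> \<phi> x = 0" "\<And>x. x \<notin> K \<Longrightarrow> g x = 0"
proof -
  obtain K where K: "compact K" "K \<subseteq> \<Omega>" "\<And>x. x \<notin> K \<Longrightarrow> \<phi> x = 0" and "C_k (Suc 0) \<phi>"
    using assms unfolding test_functions_def smooth_def by blast
  then obtain g where g: "\<And>x. GDERIV \<phi> x :> g x" "\<And>i. continuous_on UNIV (\<lambda>x. g x $ i)"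
    by auto
  have cont: "continuous_on UNIV g"
    using continuous_on_vec_lambda[of UNIV "\<lambda>i x. g x $ i"] g(2) by simp
  have fd: "frechet_derivative \<phi> (at x) = (\<lambda>h. h \<bullet> g x)" for x
    using g(1)[of x] unfolding gderiv_def by (metis frechet_derivative_at)
  have out: "g x = 0" if "x \<notin> K" for x
  proof -
    have "GDERIV (\<lambda>x. 0) x :> 0" by (rule GDERIV_const)
    then have "((\<lambda>x. 0) has_derivative (\<lambda>h. h \<bullet> 0)) (at x)" by (simp add: gderiv_def)
    then have "(\<phi> has_derivative (\<lambda>h. h \<bullet> 0)) (at x)"
      by (rule has_derivative_transform_within_open[of _ _ _ _ "- K"])
         (use K that in \<open>auto intro: compact_imp_closed\<close>)
    then show ?thesis using g(1) GDERIV_unique unfolding gderiv_def by blast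
  qed
  have "frechet_derivative \<phi> (at x) (axis i 1) = g x $ i" for x i
    by (simp add: fd inner_axis')
  then show ?thesis
    using g(1) cont K out that by blast
qed

subsection \<open>The fundamental lemma of the calculus of variations\<close>

text \<open>The intersection with \<open>space lebesgue\<close> is the form in which the rules for
  restricted measures ask for measurability.\<close>

lemma open_in_sets_lebesgue: "open \<Omega> \<Longrightarrow> \<Omega> \<inter> space lebesgue \<in> sets lebesgue"
  using lmeasurable_open by (auto intro: borel_open)

text \<open>Dynkin's argument: open boxes are stable under intersection and generate the Borel sets,
  and the sets over which f integrates to zero form a Dynkin class, where \<open>total\<close>
  serves for complements. A density whose integral over every Borel set vanishes is null.\<close>

lemma lborel_boxes_null_AE_0:
  fixes f :: "'a::euclidean_space \<Rightarrow> real"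
  assumes f: "integrable lborel f"
    and box: "\<And>c d. (LINT x|lborel. indicator (box c d) x * f x) = 0"
    and total: "integral\<^sup>L lborel f = 0"
  shows "AE x in lborel. f x = 0"
proof (rule sigma_finite_measure.density_zero[OF sigma_finite_lborel f])
  fix A :: "'a set" assume "A \<in> sets lborel"
  then have A: "A \<in> sigma_sets UNIV (range (\<lambda>(a, b). box a b :: 'a set))"
    by (simp add: borel_eq_box)
  have "Int_stable (range (\<lambda>(a, b). box a b :: 'a set))"
    by (auto simp: Int_stable_def box_Int_box)
  moreover have "range (\<lambda>(a, b). box a b :: 'a set) \<subseteq> Pow UNIV" by simp
  ultimately show "set_lebesgue_integral lborel A f = 0"
    using A
  proof (induction rule: sigma_sets_induct_disjoint)
    case (compl A)
    then have A: "A \<in> sets lborel" by (simp add: borel_eq_box)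
    have "set_lebesgue_integral lborel (UNIV - A) f =
        (LINT x|lborel. f x - indicator A x *\<^sub>R f x)"
      unfolding set_lebesgue_integral_def
      by (intro Bochner_Integration.integral_cong) (auto simp: indicator_def)
    also have "\<dots> = integral\<^sup>L lborel f - set_lebesgue_integral lborel A f"
      unfolding set_lebesgue_integral_def
      using f A by (intro Bochner_Integration.integral_diff integrable_mult_indicator) auto
    finally show ?case using compl total by simp
  next
    case (union A)
    have A: "A i \<in> sets lborel" for i using union(2) by (auto simp: borel_eq_box)
    have "set_lebesgue_integral lborel (\<Union>i. A i) f = (\<Sum>i. set_lebesgue_integral lborel (A i) f)"
    proof (rule lebesgue_integral_countable_add)
      show "set_integrable lborel (\<Union>i. A i) f"
        unfolding set_integrable_def using f A by (intro integrable_mult_indicator) auto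
    qed (use A union(1) in \<open>auto simp: disjoint_family_on_def\<close>)
    then show ?case using union by simp
  qed (use box in \<open>auto simp: set_lebesgue_integral_def\<close>)
qed

text \<open>Bump functions turn orthogonality to test functions into vanishing integrals over the
  boxes whose closed box lies in \<Omega>. On each such box the previous lemma applies to h cut off
  to it, and countably many rational boxes cover \<Omega>.\<close>

lemma integral_over_open_0_imp_AE_0:
  fixes h :: "real ^ 'd \<Rightarrow> real"
  assumes h: "h \<in> borel_measurable borel" "integrable lborel (\<lambda>x. (h x)\<^sup>2)"
    and \<Omega>: "open \<Omega>"
    and orth: "\<And>\<phi>. \<phi> \<in> test_functions \<Omega> \<Longrightarrow> (LINT x|lborel. \<phi> x * h x) = 0"
  shows "AE x in lborel. x \<in> \<Omega> \<longrightarrow> h x = 0"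
proof -
  note [measurable] = h(1)
  \<comment> \<open>Square integrability gives integrability over a box, which has finite
    measure.\<close>
  have int: "integrable lborel (\<lambda>x. indicator (box c d) x * h x)" for c d :: "real ^ 'd"
  proof (rule Bochner_Integration.integrable_bound)
    show "integrable lborel (\<lambda>x. indicator (box c d) x + (h x)\<^sup>2)"
      using h(2) by (intro Bochner_Integration.integrable_add integrable_real_indicator)
        (auto simp: emeasure_lborel_box_eq)
    have "\<bar>t\<bar> \<le> 1 + t\<^sup>2" for t :: real
      using sum_power2_ge_zero[of "\<bar>t\<bar> - 1" 0] zero_le_power2[of t]
      by (simp add: power2_eq_square algebra_simps)
    then show "AE x in lborel. norm (indicator (box c d) x * h x) \<le> norm (indicator (box c d) x + (h x)\<^sup>2)"
      by (auto simp: indicator_def)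
  qed simp
  have zero: "(LINT x|lborel. indicator (box c d) x * h x) = 0" if "cbox c d \<subseteq> \<Omega>" for c d
  proof -
    have "(\<lambda>n. LINT x|lborel. box_bump n c d x * h x) \<longlonglongrightarrow> (LINT x|lborel. indicator (box c d) x * h x)"
    proof (rule integral_dominated_convergence)
      show "integrable lborel (\<lambda>x. \<bar>indicator (box c d) x * h x\<bar>)"
        using int by (rule integrable_abs)
      show "(\<lambda>x. box_bump n c d x * h x) \<in> borel_measurable lborel" for n
        using test_function_borel[OF box_bump_test[OF subset_refl, of n c d]] by auto
      show "AE x in lborel. (\<lambda>n. box_bump n c d x * h x) \<longlonglongrightarrow> indicator (box c d) x * h x"
        by (auto intro!: tendsto_mult box_bump_tendsto)
      show "AE x in lborel. norm (box_bump n c d x * h x) \<le> \<bar>indicator (box c d) x * h x\<bar>" for n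
      proof (rule AE_I2)
        fix x
        show "norm (box_bump n c d x * h x) \<le> \<bar>indicator (box c d) x * h x\<bar>"
          using box_bump_bound[of n c d x] box_bump_outside[of x c d n]
          by (cases "x \<in> box c d") (auto simp: abs_mult mult_left_le_one_le simp del: mem_box)
      qed
    qed simp
    moreover have "(LINT x|lborel. box_bump n c d x * h x) = 0" for n
      using orth box_bump_test[OF that] by blast
    ultimately show ?thesis by (simp add: LIMSEQ_const_iff)
  qed
  have loc: "AE x in lborel. x \<in> box a b \<longrightarrow> h x = 0" if "cbox a b \<subseteq> \<Omega>" for a b
  proof -
    have "AE x in lborel. indicator (box a b) x * h x = 0"
    proof (rule lborel_boxes_null_AE_0[OF int])
      fix c d :: "real ^ 'd"
      \<comment> \<open>Corners of the intersection of the two boxes. Its closed box lies in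
        \<open>cbox a b\<close> and hence in \<Omega>, whatever c and d are.\<close>
      define c' d' where "c' = (\<Sum>i\<in>Basis. max (a \<bullet> i) (c \<bullet> i) *\<^sub>R i)"
        and "d' = (\<Sum>i\<in>Basis. min (b \<bullet> i) (d \<bullet> i) *\<^sub>R i)"
      have eq: "box a b \<inter> box c d = box c' d'"
        by (simp add: box_Int_box c'_def d'_def)
      have "cbox c' d' \<subseteq> \<Omega>"
        using that by (auto simp: mem_box c'_def d'_def)
      moreover have "indicator (box c d) x * (indicator (box a b) x * h x) =
          indicator (box c' d') x * h x" for x
        by (simp add: eq[symmetric] indicator_inter_arith)
      ultimately show "(LINT x|lborel. indicator (box c d) x * (indicator (box a b) x * h x)) = 0"
        using zero by (simp only:)
    qed (use zero that in blast)
    then show ?thesis by eventually_elim (auto simp: indicator_def)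
  qed
  define \<D> where "\<D> = {(a :: real ^ 'd, b :: real ^ 'd). cbox a b \<subseteq> \<Omega> \<and> (\<forall>i\<in>Basis. a \<bullet> i \<in> \<rat> \<and> b \<bullet> i \<in> \<rat>)}"
  have rat: "countable {a :: real ^ 'd. \<forall>i\<in>Basis. a \<bullet> i \<in> \<rat>}"
  proof -
    have "countable (vec_nth ` {a :: real ^ 'd. \<forall>i\<in>Basis. a \<bullet> i \<in> \<rat>})"
      by (rule countable_subset[OF _ countable_PiE[of UNIV "\<lambda>_ :: 'd. \<rat>"]])
         (auto simp: Basis_vec_def inner_axis countable_rat)
    then show ?thesis
      by (rule countable_image_inj_on) (auto simp: inj_on_def vec_nth_inject)
  qed
  have "countable \<D>"
    by (rule countable_subset[OF _ countable_SIGMA[OF rat rat]]) (auto simp: \<D>_def)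
  have "AE x in lborel. \<forall>p\<in>\<D>. x \<in> box (fst p) (snd p) \<longrightarrow> h x = 0"
    using \<open>countable \<D>\<close> loc by (subst AE_ball_countable) (auto simp: \<D>_def)
  moreover have "\<exists>p\<in>\<D>. x \<in> box (fst p) (snd p)" if x: "x \<in> \<Omega>" for x
  proof -
    obtain e where e: "e > 0" "cball x e \<subseteq> \<Omega>"
      using \<Omega> x open_contains_cball by blast
    obtain a b where ab: "\<forall>i\<in>Basis. a \<bullet> i \<in> \<rat> \<and> b \<bullet> i \<in> \<rat>" "x \<in> box a b" "box a b \<subseteq> ball x e"
      using rational_boxes[OF e(1)] by blast
    have "cbox a b = closure (box a b)" using ab(2) by (metis closure_box empty_iff)
    also have "\<dots> \<subseteq> cball x e"
      using ab(3) by (meson ball_subset_cball closed_cball closure_minimal order_trans)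
    finally show ?thesis using ab e by (intro bexI[of _ "(a, b)"]) (auto simp: \<D>_def)
  qed
  ultimately show ?thesis by (auto elim!: eventually_mono)
qed

text \<open>The box argument lives on Borel functions, whereas g is only Lebesgue measurable on
  \<Omega>. Its extension by zero is therefore replaced by an almost everywhere equal Borel function
  h.\<close>

lemma test_orthogonal_imp_AE_0:
  fixes g :: "'d::finite scalar_field"
  assumes \<Omega>: "open \<Omega>" and g: "g \<in> L2 \<Omega>"
    and orth: "\<And>\<phi>. \<phi> \<in> test_functions \<Omega> \<Longrightarrow> L2_inner \<Omega> g \<phi> = 0"
  shows "AE x in lebesgue_on \<Omega>. g x = 0"
proof -
  note m = open_in_sets_lebesgue[OF \<Omega>]
  have "(\<lambda>x. indicator \<Omega> x *\<^sub>R g x) \<in> borel_measurable lebesgue"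
    using g m by (simp add: L2_def borel_measurable_restrict_space_iff)
  then obtain h where h: "h \<in> borel_measurable lborel" "AE x in lborel. indicator \<Omega> x *\<^sub>R g x = h x"
    using completion_ex_borel_measurable_real by blast
  have h': "AE x in lebesgue. indicator \<Omega> x *\<^sub>R g x = h x"
    using h(2) by (rule AE_completion)
  have gi: "integrable lebesgue (\<lambda>x. indicator \<Omega> x *\<^sub>R (norm (g x))\<^sup>2)"
    using g m by (auto simp: L2_def integrable_restrict_space)
  have hm: "h \<in> borel_measurable lebesgue"
    using h(1) by (rule measurable_completion)
  have "AE x in lebesgue. indicator \<Omega> x *\<^sub>R (norm (g x))\<^sup>2 = (h x)\<^sup>2"
    using h' by eventually_elim (auto simp: indicator_def split: if_splits)
  then have "integrable lebesgue (\<lambda>x. (h x)\<^sup>2)"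
    using gi hm by (intro integrable_cong_AE_imp[OF gi]) auto
  then have h2: "integrable lborel (\<lambda>x. (h x)\<^sup>2)"
    using h(1) by (subst (asm) integrable_completion) auto
  have "(LINT x|lborel. \<phi> x * h x) = 0" if \<phi>: "\<phi> \<in> test_functions \<Omega>" for \<phi>
  proof -
    have [measurable]: "\<phi> \<in> borel_measurable borel" using \<phi> by (rule test_function_borel)
    have "0 = (LINT x|lebesgue. indicator \<Omega> x *\<^sub>R (g x * \<phi> x))"
      using orth[OF \<phi>] m by (simp add: L2_inner_def integral_restrict_space)
    also have "\<dots> = (LINT x|lebesgue. \<phi> x * h x)"
    proof (rule integral_cong_AE)
      have "(\<lambda>x. (indicator \<Omega> x *\<^sub>R g x) * \<phi> x) \<in> borel_measurable lebesgue"
        using \<open>(\<lambda>x. indicator \<Omega> x *\<^sub>R g x) \<in> borel_measurable lebesgue\<close>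
          measurable_completion[of \<phi> lborel borel]
        by (intro borel_measurable_times) auto
      then show "(\<lambda>x. indicator \<Omega> x *\<^sub>R (g x * \<phi> x)) \<in> borel_measurable lebesgue"
        by (simp add: mult.assoc)
      show "(\<lambda>x. \<phi> x * h x) \<in> borel_measurable lebesgue"
        using hm measurable_completion[of \<phi> lborel borel]
        by (intro borel_measurable_times) auto
      show "AE x in lebesgue. indicator \<Omega> x *\<^sub>R (g x * \<phi> x) = \<phi> x * h x"
        using h' by eventually_elim (auto simp: algebra_simps)
    qed
    also have "\<dots> = (LINT x|lborel. \<phi> x * h x)"
      using h(1) by (intro integral_completion) auto
    finally show ?thesis by simp
  qed
  then have "AE x in lborel. x \<in> \<Omega> \<longrightarrow> h x = 0"
    using h(1) h2 \<Omega> by (intro integral_over_open_0_imp_AE_0) auto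
  then have "AE x in lebesgue. x \<in> \<Omega> \<longrightarrow> h x = 0"
    by (rule AE_completion)
  with h' have "AE x in lebesgue. x \<in> \<Omega> \<longrightarrow> g x = 0"
    by eventually_elim (auto simp: indicator_def)
  then show ?thesis using m by (simp add: AE_restrict_space_iff)
qed

subsection \<open>The space \<open>L\<^sup>2\<close> and weak gradients\<close>

lemma borel_lebesgue_on:
  fixes f :: "real ^ 'd \<Rightarrow> 'b::topological_space"
  assumes "f \<in> borel_measurable borel"
  shows "f \<in> borel_measurable (lebesgue_on \<Omega>)"
  using assms by (intro measurable_restrict_space1 measurable_completion) auto

lemma L2_measurable: "f \<in> L2 \<Omega> \<Longrightarrow> f \<in> borel_measurable (lebesgue_on \<Omega>)"
  by (simp add: L2_def)

lemma L2_integrable_inner: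
  assumes "f \<in> L2 \<Omega>" "g \<in> L2 \<Omega>"
  shows "integrable (lebesgue_on \<Omega>) (\<lambda>x. f x \<bullet> g x)"
proof (rule Bochner_Integration.integrable_bound)
  show "integrable (lebesgue_on \<Omega>) (\<lambda>x. (norm (f x))\<^sup>2 + (norm (g x))\<^sup>2)"
    using assms by (intro Bochner_Integration.integrable_add) (auto simp: L2_def)
  show "(\<lambda>x. f x \<bullet> g x) \<in> borel_measurable (lebesgue_on \<Omega>)"
    using assms by (intro borel_measurable_inner L2_measurable)
  have "\<bar>f x \<bullet> g x\<bar> \<le> (norm (f x))\<^sup>2 + (norm (g x))\<^sup>2" for x
    using Cauchy_Schwarz_ineq2[of "f x" "g x"] sum_squares_bound[of "norm (f x)" "norm (g x)"]
      mult_nonneg_nonneg[OF norm_ge_zero[of "f x"] norm_ge_zero[of "g x"]] by linarith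
  then show "AE x in lebesgue_on \<Omega>. norm (f x \<bullet> g x) \<le> norm ((norm (f x))\<^sup>2 + (norm (g x))\<^sup>2)"
    by simp
qed

lemma L2_add [intro]:
  assumes "f \<in> L2 \<Omega>" "g \<in> L2 \<Omega>"
  shows "f + g \<in> L2 \<Omega>"
proof -
  have "integrable (lebesgue_on \<Omega>) (\<lambda>x. (norm (f x))\<^sup>2 + 2 * (f x \<bullet> g x) + (norm (g x))\<^sup>2)"
    using assms L2_integrable_inner[OF assms]
    by (intro Bochner_Integration.integrable_add integrable_mult_right) (auto simp: L2_def)
  moreover have "(norm ((f + g) x))\<^sup>2 = (norm (f x))\<^sup>2 + 2 * (f x \<bullet> g x) + (norm (g x))\<^sup>2" for x
    by (simp add: power2_norm_eq_inner inner_add_left inner_add_right inner_commute[of "g x" "f x"])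
  ultimately have "integrable (lebesgue_on \<Omega>) (\<lambda>x. (norm ((f + g) x))\<^sup>2)"
    by (simp only:)
  moreover have "f + g \<in> borel_measurable (lebesgue_on \<Omega>)"
    unfolding plus_fun_def using assms by (intro borel_measurable_add L2_measurable)
  ultimately show ?thesis by (simp add: L2_def)
qed

lemma L2_scaleR [intro]: "f \<in> L2 \<Omega> \<Longrightarrow> a *\<^sub>R f \<in> L2 \<Omega>"
  by (auto simp: L2_def scaleR_fun_def power_mult_distrib)

lemma L2_nth:
  fixes f :: "real ^ 'd \<Rightarrow> 'b::euclidean_space ^ 'n"
  assumes "f \<in> L2 \<Omega>"
  shows "(\<lambda>x. f x $ i) \<in> L2 \<Omega>"
proof -
  have m: "(\<lambda>x. f x $ i) \<in> borel_measurable (lebesgue_on \<Omega>)"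
    by (rule measurable_compose[OF L2_measurable[OF assms]])
       (intro borel_measurable_continuous_onI continuous_intros)
  have "integrable (lebesgue_on \<Omega>) (\<lambda>x. (norm (f x $ i))\<^sup>2)"
    by (rule Bochner_Integration.integrable_bound[of _ "\<lambda>x. (norm (f x))\<^sup>2"])
       (use assms m in \<open>auto simp: L2_def Finite_Cartesian_Product.norm_nth_le power_mono\<close>)
  with m show ?thesis by (simp add: L2_def)
qed

lemma L2_vec:
  fixes f :: "real ^ 'd \<Rightarrow> 'b::euclidean_space ^ 'n"
  assumes "\<And>i. (\<lambda>x. f x $ i) \<in> L2 \<Omega>"
  shows "f \<in> L2 \<Omega>"
proof -
  have "f \<in> borel_measurable (lebesgue_on \<Omega>)"
    using assms[THEN L2_measurable]
    by (subst borel_measurable_euclidean_space) (auto simp: Basis_vec_def inner_axis)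
  moreover have "integrable (lebesgue_on \<Omega>) (\<lambda>x. \<Sum>i\<in>UNIV. (norm (f x $ i))\<^sup>2)"
    using assms by (intro Bochner_Integration.integrable_sum) (auto simp: L2_def)
  moreover have "(norm (f x))\<^sup>2 = (\<Sum>i\<in>UNIV. (norm (f x $ i))\<^sup>2)" for x
    unfolding norm_vec_def L2_set_def by (simp add: sum_nonneg)
  ultimately show ?thesis by (simp add: L2_def)
qed

lemma L2_inner_commute: "L2_inner \<Omega> f g = L2_inner \<Omega> g f"
  by (simp add: L2_inner_def inner_commute)

lemma L2_inner_add_left:
  "f \<in> L2 \<Omega> \<Longrightarrow> g \<in> L2 \<Omega> \<Longrightarrow> h \<in> L2 \<Omega> \<Longrightarrow> L2_inner \<Omega> (f + g) h = L2_inner \<Omega> f h + L2_inner \<Omega> g h"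
  by (simp add: L2_inner_def inner_add_left L2_integrable_inner)

lemma L2_inner_scaleR_left: "L2_inner \<Omega> (a *\<^sub>R f) h = a * L2_inner \<Omega> f h"
  by (simp add: L2_inner_def scaleR_fun_def)

lemma L2_inner_add_right:
  "f \<in> L2 \<Omega> \<Longrightarrow> g \<in> L2 \<Omega> \<Longrightarrow> h \<in> L2 \<Omega> \<Longrightarrow> L2_inner \<Omega> h (f + g) = L2_inner \<Omega> h f + L2_inner \<Omega> h g"
  by (simp add: L2_inner_add_left L2_inner_commute[of _ h])

lemma L2_inner_scaleR_right: "L2_inner \<Omega> h (a *\<^sub>R f) = a * L2_inner \<Omega> h f"
  by (simp add: L2_inner_scaleR_left L2_inner_commute[of _ h])

lemma L2_inner_cong_AE:
  assumes "f \<in> borel_measurable (lebesgue_on \<Omega>)" "g \<in> borel_measurable (lebesgue_on \<Omega>)"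
    "h \<in> borel_measurable (lebesgue_on \<Omega>)" "AE x in lebesgue_on \<Omega>. f x = g x"
  shows "L2_inner \<Omega> f h = L2_inner \<Omega> g h"
  unfolding L2_inner_def using assms by (intro integral_cong_AE) auto

lemma L2_inner_nonneg: "0 \<le> L2_inner \<Omega> f f"
  unfolding L2_inner_def by simp

lemma L2_norm_nonneg: "0 \<le> L2_norm \<Omega> f"
  by (simp add: L2_norm_def L2_inner_nonneg)

lemma L2_norm_square: "(L2_norm \<Omega> f)\<^sup>2 = L2_inner \<Omega> f f"
  by (simp add: L2_norm_def L2_inner_nonneg)

text \<open>Nonnegativity of the quadratic form s^2 a + 2 s t b + t^2 c. On total functions the
  inner product is only semidefinite, so c = 0 does not mean that g is zero and is treated
  separately.\<close>

lemma L2_Cauchy_Schwarz: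
  assumes "f \<in> L2 \<Omega>" "g \<in> L2 \<Omega>"
  shows "\<bar>L2_inner \<Omega> f g\<bar> \<le> L2_norm \<Omega> f * L2_norm \<Omega> g"
proof -
  define a b c where "a = L2_inner \<Omega> f f" and "b = L2_inner \<Omega> f g" and "c = L2_inner \<Omega> g g"
  have q: "0 \<le> s\<^sup>2 * a + 2 * s * t * b + t\<^sup>2 * c" for s t
  proof -
    have sf: "s *\<^sub>R f \<in> L2 \<Omega>" "t *\<^sub>R g \<in> L2 \<Omega>" using assms by auto
    then have "L2_inner \<Omega> (s *\<^sub>R f + t *\<^sub>R g) (s *\<^sub>R f + t *\<^sub>R g) = s\<^sup>2 * a + 2 * s * t * b + t\<^sup>2 * c"
      using L2_add[OF sf]
      by (simp add: L2_inner_add_left[OF sf] L2_inner_add_right[OF sf] assms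
          L2_inner_add_right L2_inner_scaleR_left L2_inner_scaleR_right L2_inner_commute[of _ g f] a_def b_def c_def power2_eq_square algebra_simps)
    then show ?thesis by (metis L2_inner_nonneg)
  qed
  have "b\<^sup>2 \<le> a * c"
  proof (cases "c = 0")
    case True
    \<comment> \<open>For c = 0 and b nonzero, this choice of t gives the form the value -1.\<close>
    have "0 \<le> a + 2 * (- (a + 1) / (2 * b)) * b" if "b \<noteq> 0"
      using q[of 1 "- (a + 1) / (2 * b)"] True by simp
    then have "b = 0" by (auto simp: field_simps)
    then show ?thesis using True by simp
  next
    case False
    then have "c > 0" using L2_inner_nonneg[of \<Omega> g] by (simp add: c_def)
    have "0 \<le> c * (a * c - b\<^sup>2)"
      using q[of c "- b"] by (simp add: algebra_simps power2_eq_square)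
    then show ?thesis using \<open>c > 0\<close> by (simp add: zero_le_mult_iff)
  qed
  then have "sqrt (b\<^sup>2) \<le> sqrt (a * c)" by (rule real_sqrt_le_mono)
  then show ?thesis by (simp add: L2_norm_def real_sqrt_mult a_def b_def c_def)
qed

lemma L2_norm_cong_AE:
  assumes "f \<in> L2 \<Omega>" "g \<in> L2 \<Omega>" "AE x in lebesgue_on \<Omega>. f x = g x"
  shows "L2_norm \<Omega> f = L2_norm \<Omega> g"
proof -
  note m = assms(1,2)[THEN L2_measurable]
  have "L2_inner \<Omega> f f = L2_inner \<Omega> g f"
    using m assms(3) by (intro L2_inner_cong_AE)
  also have "\<dots> = L2_inner \<Omega> f g" by (rule L2_inner_commute)
  also have "\<dots> = L2_inner \<Omega> g g"
    using m assms(3) by (intro L2_inner_cong_AE)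
  finally show ?thesis by (simp add: L2_norm_def)
qed

lemma L2_sum: "finite I \<Longrightarrow> (\<And>i. i \<in> I \<Longrightarrow> f i \<in> L2 \<Omega>) \<Longrightarrow> sum f I \<in> L2 \<Omega>"
proof (induction I rule: finite_induct)
  case empty
  show ?case by (simp add: L2_def zero_fun_def)
next
  case (insert i I)
  then show ?case
    unfolding sum.insert[OF insert(1,2)] by (intro L2_add) auto
qed

lemma L2_norm_add_le:
  assumes "f \<in> L2 \<Omega>" "g \<in> L2 \<Omega>"
  shows "L2_norm \<Omega> (f + g) \<le> L2_norm \<Omega> f + L2_norm \<Omega> g"
proof (rule power2_le_imp_le)
  have "(L2_norm \<Omega> (f + g))\<^sup>2 = (L2_norm \<Omega> f)\<^sup>2 + 2 * L2_inner \<Omega> f g + (L2_norm \<Omega> g)\<^sup>2"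
    using assms L2_add[OF assms] unfolding L2_norm_square
    by (simp add: L2_inner_add_left[OF assms] L2_inner_add_right[OF assms] L2_inner_commute[of _ g f])
  then show "(L2_norm \<Omega> (f + g))\<^sup>2 \<le> (L2_norm \<Omega> f + L2_norm \<Omega> g)\<^sup>2"
    using L2_Cauchy_Schwarz[OF assms] by (simp add: power2_sum algebra_simps)
qed (simp add: L2_norm_nonneg)

lemma continuous_compact_support_L2:
  fixes f :: "real ^ 'd \<Rightarrow> 'b::euclidean_space"
  assumes f: "continuous_on UNIV f" and K: "compact K" "\<And>x. x \<notin> K \<Longrightarrow> f x = 0" and \<Omega>: "open \<Omega>"
  shows "f \<in> L2 \<Omega>"
proof -
  have m: "f \<in> borel_measurable (lebesgue_on \<Omega>)"
    using f by (intro borel_lebesgue_on borel_measurable_continuous_onI)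
  have "integrable lborel (\<lambda>x. indicator K x *\<^sub>R (norm (f x))\<^sup>2)"
    using K f by (intro borel_integrable_compact continuous_intros) (auto intro: continuous_on_subset)
  moreover have "indicator K x *\<^sub>R (norm (f x))\<^sup>2 = (norm (f x))\<^sup>2" for x
    using K(2) by (auto simp: indicator_def)
  ultimately have "integrable lborel (\<lambda>x. (norm (f x))\<^sup>2)" by (simp only:)
  then have "integrable lebesgue (\<lambda>x. (norm (f x))\<^sup>2)"
    using f by (subst integrable_completion) (auto intro!: borel_measurable_continuous_onI continuous_intros)
  then have "integrable lebesgue (\<lambda>x. indicator \<Omega> x *\<^sub>R (norm (f x))\<^sup>2)"
    using open_in_sets_lebesgue[OF \<Omega>] by (intro integrable_mult_indicator) auto
  then show ?thesis
    using m open_in_sets_lebesgue[OF \<Omega>] by (simp add: L2_def integrable_restrict_space)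
qed

lemma test_function_L2:
  assumes "open \<Omega>" "\<phi> \<in> test_functions \<Omega>"
  shows "\<phi> \<in> L2 \<Omega>"
proof -
  obtain K where "compact K" "\<And>x. x \<notin> K \<Longrightarrow> \<phi> x = 0" "smooth \<phi>"
    using assms(2) unfolding test_functions_def by blast
  then show ?thesis
    using smooth_continuous assms(1) continuous_compact_support_L2 by blast
qed

lemma test_function_partial_L2:
  assumes "open \<Omega>" "\<phi> \<in> test_functions \<Omega>"
  shows "(\<lambda>x. frechet_derivative \<phi> (at x) (axis i 1)) \<in> L2 \<Omega>"
proof -
  obtain g K where "continuous_on UNIV g" "compact K" "\<And>x. x \<notin> K \<Longrightarrow> g x = 0"
    and eq: "\<And>x i. frechet_derivative \<phi> (at x) (axis i 1) = g x $ i"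
    using test_function_gradient[OF assms(2)] by metis
  then have "g \<in> L2 \<Omega>" using assms(1) continuous_compact_support_L2 by blast
  then show ?thesis unfolding eq by (rule L2_nth)
qed

section \<open>Linearity and uniqueness of weak gradients\<close>

lemma has_weak_grad_add:
  assumes \<Omega>: "open \<Omega>" and u: "has_weak_grad \<Omega> u g" and v: "has_weak_grad \<Omega> v h"
  shows "has_weak_grad \<Omega> (u + v) (g + h)"
proof -
  have *: "(\<lambda>x. (g + h) x $ i) = (\<lambda>x. g x $ i) + (\<lambda>x. h x $ i)" for i
    by (auto simp: plus_fun_def)
  show ?thesis
    unfolding has_weak_grad_def *
    using u v test_function_L2[OF \<Omega>] test_function_partial_L2[OF \<Omega>]
    by (auto simp: has_weak_grad_def L2_inner_add_left L2_nth)
qed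

lemma has_weak_grad_scaleR:
  assumes u: "has_weak_grad \<Omega> u g"
  shows "has_weak_grad \<Omega> (a *\<^sub>R u) (a *\<^sub>R g)"
proof -
  have *: "(\<lambda>x. (a *\<^sub>R g) x $ i) = a *\<^sub>R (\<lambda>x. g x $ i)" for i
    by (auto simp: scaleR_fun_def)
  show ?thesis
    unfolding has_weak_grad_def *
    using u by (auto simp: has_weak_grad_def L2_inner_scaleR_left)
qed

text \<open>The difference of two weak gradients of u is a weak gradient of u - u, so its components
  are orthogonal to all test functions.\<close>

lemma has_weak_grad_unique:
  assumes \<Omega>: "open \<Omega>" and g: "has_weak_grad \<Omega> u g" and h: "has_weak_grad \<Omega> u h"
  shows "AE x in lebesgue_on \<Omega>. g x = h x"
proof -
  have "AE x in lebesgue_on \<Omega>. (g + (-1) *\<^sub>R h) x $ i = 0" for i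
  proof (rule test_orthogonal_imp_AE_0[OF \<Omega>])
    have gh: "has_weak_grad \<Omega> (u + (-1) *\<^sub>R u) (g + (-1) *\<^sub>R h)"
      by (intro has_weak_grad_add has_weak_grad_scaleR \<Omega> g h)
    then have "g + (-1) *\<^sub>R h \<in> L2 \<Omega>" by (simp only: has_weak_grad_def)
    then show "(\<lambda>x. (g + (-1) *\<^sub>R h) x $ i) \<in> L2 \<Omega>" by (rule L2_nth)
    show "L2_inner \<Omega> (\<lambda>x. (g + (-1) *\<^sub>R h) x $ i) \<phi> = 0" if "\<phi> \<in> test_functions \<Omega>" for \<phi>
      using gh that by (auto simp: has_weak_grad_def L2_inner_def[of _ "u + _"] scaleR_fun_def)
  qed
  then have "AE x in lebesgue_on \<Omega>. \<forall>i. (g + (-1) *\<^sub>R h) x $ i = 0"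
    by (simp add: AE_all_countable)
  then show ?thesis
    by eventually_elim (auto simp: scaleR_fun_def vec_eq_iff)
qed

lemma weak_grad_has_weak_grad: "u \<in> H1 \<Omega> \<Longrightarrow> has_weak_grad \<Omega> u (weak_grad \<Omega> u)"
  unfolding H1_def weak_grad_def by (auto intro: someI_ex[of "has_weak_grad \<Omega> u"])

lemma weak_grad_AE_eq:
  assumes "open \<Omega>" "has_weak_grad \<Omega> u g"
  shows "AE x in lebesgue_on \<Omega>. weak_grad \<Omega> u x = g x"
  using assms weak_grad_has_weak_grad by (intro has_weak_grad_unique) (auto simp: H1_def)

lemma H1_L2: "u \<in> H1 \<Omega> \<Longrightarrow> u \<in> L2 \<Omega>"
  by (auto simp: H1_def has_weak_grad_def)

lemma weak_grad_L2: "u \<in> H1 \<Omega> \<Longrightarrow> weak_grad \<Omega> u \<in> L2 \<Omega>"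
  using weak_grad_has_weak_grad by (auto simp: has_weak_grad_def)

text \<open>
  The weak gradients are additive and homogeneous only up to null sets. The predicate collects what
  is needed of an operator into \<open>L\<^sup>2\<close> in order to treat the scalar and the vector case alike.
\<close>

definition AE_linear_on ::
  "(real ^ 'd) set \<Rightarrow> 'v::real_vector set \<Rightarrow> ('v \<Rightarrow> real ^ 'd \<Rightarrow> 'b::euclidean_space) \<Rightarrow> bool" where
  "AE_linear_on \<Omega> S D \<longleftrightarrow>
    (\<forall>u\<in>S. D u \<in> L2 \<Omega>) \<and>
    (\<forall>u\<in>S. \<forall>v\<in>S. AE x in lebesgue_on \<Omega>. D (u + v) x = D u x + D v x) \<and>
    (\<forall>u\<in>S. \<forall>a. AE x in lebesgue_on \<Omega>. D (a *\<^sub>R u) x = a *\<^sub>R D u x)"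

lemma AE_linear_on_inner_add:
  assumes D: "AE_linear_on \<Omega> S D" and u: "u \<in> S" "v \<in> S" "u + v \<in> S" and h: "h \<in> L2 \<Omega>"
  shows "L2_inner \<Omega> (D (u + v)) h = L2_inner \<Omega> (D u) h + L2_inner \<Omega> (D v) h"
proof -
  have "L2_inner \<Omega> (D (u + v)) h = L2_inner \<Omega> (D u + D v) h"
    using assms by (intro L2_inner_cong_AE L2_measurable L2_add) (auto simp: AE_linear_on_def)
  also have "\<dots> = L2_inner \<Omega> (D u) h + L2_inner \<Omega> (D v) h"
    using assms by (intro L2_inner_add_left) (auto simp: AE_linear_on_def)
  finally show ?thesis .
qed

lemma AE_linear_on_inner_scaleR:
  assumes D: "AE_linear_on \<Omega> S D" and u: "u \<in> S" "a *\<^sub>R u \<in> S" and h: "h \<in> L2 \<Omega>"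
  shows "L2_inner \<Omega> (D (a *\<^sub>R u)) h = a * L2_inner \<Omega> (D u) h"
proof -
  have "L2_inner \<Omega> (D (a *\<^sub>R u)) h = L2_inner \<Omega> (a *\<^sub>R D u) h"
    using assms by (intro L2_inner_cong_AE L2_measurable L2_scaleR) (auto simp: AE_linear_on_def scaleR_fun_def)
  then show ?thesis by (simp add: L2_inner_scaleR_left)
qed

lemma AE_linear_on_weak_grad:
  assumes "open \<Omega>"
  shows "AE_linear_on \<Omega> (H1 \<Omega>) (weak_grad \<Omega>)"
  unfolding AE_linear_on_def
proof (intro conjI ballI allI)
  fix u v a assume u: "u \<in> H1 \<Omega>" and v: "v \<in> H1 \<Omega>"
  show "AE x in lebesgue_on \<Omega>. weak_grad \<Omega> (u + v) x = weak_grad \<Omega> u x + weak_grad \<Omega> v x"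
    using weak_grad_AE_eq[OF assms has_weak_grad_add[OF assms u[THEN weak_grad_has_weak_grad]
        v[THEN weak_grad_has_weak_grad]]] by simp
qed (use weak_grad_L2 weak_grad_AE_eq[OF assms has_weak_grad_scaleR[OF weak_grad_has_weak_grad]]
    in \<open>auto simp: scaleR_fun_def\<close>)

definition H1_vec :: "(real ^ 'd) set \<Rightarrow> 'd vector_field set" where
  "H1_vec \<Omega> = {u. \<forall>i. (\<lambda>x. u x $ i) \<in> H1 \<Omega>}"

lemma H1_vec_L2: "u \<in> H1_vec \<Omega> \<Longrightarrow> u \<in> L2 \<Omega>"
  by (intro L2_vec) (auto simp: H1_vec_def intro: H1_L2)

lemma AE_linear_on_weak_grad_vec:
  fixes \<Omega> :: "(real ^ 'd) set"
  assumes "open \<Omega>"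
  shows "AE_linear_on \<Omega> (H1_vec \<Omega>) (weak_grad_vec \<Omega>)"
  unfolding AE_linear_on_def
proof (intro conjI ballI allI)
  note lin = AE_linear_on_weak_grad[OF assms, unfolded AE_linear_on_def]
  fix u v :: "'d vector_field" and a assume u: "u \<in> H1_vec \<Omega>" and v: "v \<in> H1_vec \<Omega>"
  have comp: "(\<lambda>y. (u + v) y $ i) = (\<lambda>y. u y $ i) + (\<lambda>y. v y $ i)"
    "(\<lambda>y. (a *\<^sub>R u) y $ i) = a *\<^sub>R (\<lambda>y. u y $ i)" for i
    by (auto simp: scaleR_fun_def plus_fun_def)
  have "AE x in lebesgue_on \<Omega>. \<forall>i. weak_grad \<Omega> (\<lambda>y. (u + v) y $ i) x =
      weak_grad \<Omega> (\<lambda>y. u y $ i) x + weak_grad \<Omega> (\<lambda>y. v y $ i) x"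
    unfolding AE_all_countable comp using lin u v by (auto simp: H1_vec_def)
  then show "AE x in lebesgue_on \<Omega>. weak_grad_vec \<Omega> (u + v) x = weak_grad_vec \<Omega> u x + weak_grad_vec \<Omega> v x"
    by eventually_elim (auto simp: weak_grad_vec_def vec_eq_iff)
  have "AE x in lebesgue_on \<Omega>. \<forall>i. weak_grad \<Omega> (\<lambda>y. (a *\<^sub>R u) y $ i) x =
      a *\<^sub>R weak_grad \<Omega> (\<lambda>y. u y $ i) x"
    unfolding AE_all_countable comp using lin u by (auto simp: H1_vec_def)
  then show "AE x in lebesgue_on \<Omega>. weak_grad_vec \<Omega> (a *\<^sub>R u) x = a *\<^sub>R weak_grad_vec \<Omega> u x"
    by eventually_elim (auto simp: weak_grad_vec_def vec_eq_iff)
  show "weak_grad_vec \<Omega> u \<in> L2 \<Omega>"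
    using u by (intro L2_vec[of "weak_grad_vec \<Omega> u"])
      (simp add: weak_grad_vec_def H1_vec_def weak_grad_L2)
qed

subsection \<open>Ladyzhenskaya's inequality\<close>

lemma GDERIV_along_line:
  assumes "\<And>x. GDERIV h x :> g x"
  shows "((\<lambda>s. h (x + s *\<^sub>R e)) has_real_derivative e \<bullet> g (x + s *\<^sub>R e)) (at s)"
proof -
  have "((\<lambda>s. x + s *\<^sub>R e) has_derivative (\<lambda>s. s *\<^sub>R e)) (at s)"
    by (auto intro!: derivative_eq_intros)
  from has_derivative_compose[OF this, of h "\<lambda>k. k \<bullet> g (x + s *\<^sub>R e)"] assms
  have "((\<lambda>s. h (x + s *\<^sub>R e)) has_derivative (\<lambda>t. (t *\<^sub>R e) \<bullet> g (x + s *\<^sub>R e))) (at s)"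
    by (simp add: gderiv_def)
  then show ?thesis
    by (simp add: has_field_derivative_def mult.commute[of _ "e \<bullet> _"])
qed

text \<open>By translation invariance every difference quotient of h in direction e has integral
  zero; dominated convergence passes this on to the derivative.\<close>

lemma integral_gradient_compact_support:
  fixes h :: "real ^ 'd \<Rightarrow> real"
  assumes h: "\<And>x. GDERIV h x :> g x" and g: "continuous_on UNIV g"
    and K: "compact K" "\<And>x. x \<notin> K \<Longrightarrow> h x = 0" "\<And>x. x \<notin> K \<Longrightarrow> g x = 0"
    and e: "norm e = 1"
  shows "(LINT x|lborel. e \<bullet> g x) = 0"
proof -
  have hc: "continuous_on UNIV h"
    using h by (auto simp: continuous_on_eq_continuous_at intro: GDERIV_isCont)
  have [measurable]: "h \<in> borel_measurable borel" "g \<in> borel_measurable borel"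
    using hc g by (auto intro: borel_measurable_continuous_onI)
  have hi: "integrable lborel h"
  proof -
    have "integrable lborel (\<lambda>x. indicator K x *\<^sub>R h x)"
      using K(1) hc by (intro borel_integrable_compact) (auto intro: continuous_on_subset)
    moreover have "(\<lambda>x. indicator K x *\<^sub>R h x) = h"
      using K(2) by (force simp: indicator_def)
    ultimately show ?thesis by simp
  qed
  \<comment> \<open>Step sizes of at most 1 keep the supports of all difference quotients inside one
    ball.\<close>
  define t :: "nat \<Rightarrow> real" where "t n = inverse (real (Suc n))" for n
  have t: "0 < t n" "t n \<le> 1" for n
    by (auto simp: t_def field_simps)
  have t0: "t \<longlonglongrightarrow> 0"
    unfolding t_def by (rule LIMSEQ_inverse_real_of_nat)
  define s where "s n x = (h (x + t n *\<^sub>R e) - h x) / t n" for n x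
  have s0: "integral\<^sup>L lborel (s n) = 0" for n
  proof -
    have shift: "distr lborel borel ((+) (t n *\<^sub>R e)) = (lborel :: (real ^ 'd) measure)"
      by (rule lborel_distr_plus)
    have i: "integrable lborel (\<lambda>x. h (t n *\<^sub>R e + x))"
      using hi by (subst (asm) shift[symmetric], subst (asm) integrable_distr_eq) auto
    have "integral\<^sup>L lborel h = (LINT x|lborel. h (t n *\<^sub>R e + x))"
      by (subst shift[symmetric], subst integral_distr) auto
    then show ?thesis
      unfolding s_def using i hi by (simp add: add.commute)
  qed
  obtain R where R: "\<And>x. x \<in> K \<Longrightarrow> norm x \<le> R"
    using compact_imp_bounded[OF K(1)] by (auto simp: bounded_iff)
  obtain B where B: "\<And>x. norm (g x) \<le> B" "B \<ge> 0"
  proof -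
    have "bounded (g ` K)"
      using K(1) g by (intro compact_imp_bounded compact_continuous_image) (auto intro: continuous_on_subset)
    then obtain B where "\<And>x. x \<in> K \<Longrightarrow> norm (g x) \<le> B" by (auto simp: bounded_iff)
    then have "norm (g x) \<le> max B 0" for x
      using K(3)[of x] by (cases "x \<in> K") (auto simp: le_max_iff_disj)
    then show thesis by (intro that[of "max B 0"]) auto
  qed
  have "(\<lambda>n. integral\<^sup>L lborel (s n)) \<longlonglongrightarrow> (LINT x|lborel. e \<bullet> g x)"
  proof (rule integral_dominated_convergence)
    show "integrable lborel (\<lambda>x. indicator (cball (0 :: real ^ 'd) (R + 1)) x * B)"
      by (intro integrable_mult_left integrable_real_indicator)
         (use emeasure_bounded_finite[OF bounded_cball, of "0 :: real ^ 'd" "R + 1"] in auto)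
    show "s n \<in> borel_measurable lborel" for n
      unfolding s_def[abs_def] by measurable
    show "AE x in lborel. (\<lambda>n. s n x) \<longlonglongrightarrow> e \<bullet> g x"
    proof (rule AE_I2)
      fix x
      have "(\<lambda>d. (h (x + (0 + d) *\<^sub>R e) - h (x + 0 *\<^sub>R e)) / d) \<midarrow>0\<rightarrow> e \<bullet> g (x + 0 *\<^sub>R e)"
        using GDERIV_along_line[OF h, of x e 0] unfolding DERIV_def by simp
      moreover have "filterlim t (at 0) sequentially"
        using t0 t(1) by (auto simp: filterlim_at intro!: always_eventually less_imp_neq[THEN not_sym])
      ultimately show "(\<lambda>n. s n x) \<longlonglongrightarrow> e \<bullet> g x"
        unfolding s_def by (auto dest: filterlim_compose)
    qed
    show "AE x in lborel. norm (s n x) \<le> indicator (cball 0 (R + 1)) x * B" for n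
    proof (rule AE_I2)
      fix x
      \<comment> \<open>The mean value theorem turns the quotient into a value of the directional
        derivative, which is bounded uniformly in n.\<close>
      obtain z where z: "0 < z" "z < t n"
        and eq: "h (x + t n *\<^sub>R e) - h (x + 0 *\<^sub>R e) = (t n - 0) * (e \<bullet> g (x + z *\<^sub>R e))"
        using MVT2[of 0 "t n" "\<lambda>s. h (x + s *\<^sub>R e)" "\<lambda>s. e \<bullet> g (x + s *\<^sub>R e)", OF t(1)]
          GDERIV_along_line[OF h] by blast
      then have sz: "s n x = e \<bullet> g (x + z *\<^sub>R e)"
        using t(1)[of n] by (simp add: s_def)
      have "\<bar>e \<bullet> g (x + z *\<^sub>R e)\<bar> \<le> B"
        using Cauchy_Schwarz_ineq2[of e "g (x + z *\<^sub>R e)"] B(1)[of "x + z *\<^sub>R e"] e by simp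
      moreover have "g (x + z *\<^sub>R e) = 0" if "x \<notin> cball 0 (R + 1)"
      proof (rule K(3))
        have "norm x \<le> norm (x + z *\<^sub>R e) + norm (z *\<^sub>R e)"
          using norm_triangle_ineq4[of "x + z *\<^sub>R e" "z *\<^sub>R e"] by simp
        moreover have "norm (z *\<^sub>R e) \<le> 1" using z t(2)[of n] e by simp
        ultimately have "norm (x + z *\<^sub>R e) > R" using that by simp
        then show "x + z *\<^sub>R e \<notin> K" using R by force
      qed
      ultimately show "norm (s n x) \<le> indicator (cball 0 (R + 1)) x * B"
        unfolding sz by (auto simp: indicator_def)
    qed
  qed simp
  then show ?thesis by (simp add: s0 LIMSEQ_const_iff)
qed

text \<open>Integration by parts: the partial derivatives of the product of two test functions have
  integral zero. This lets classical gradients be compared with the representatives chosen by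
  \<open>weak_grad\<close>.\<close>

lemma test_function_has_weak_grad:
  fixes \<phi> :: "'d::finite scalar_field"
  assumes \<Omega>: "open \<Omega>" and \<phi>: "\<phi> \<in> test_functions \<Omega>"
    and d\<phi>: "\<And>x. GDERIV \<phi> x :> d\<phi> x" "continuous_on UNIV d\<phi>"
      "compact K" "K \<subseteq> \<Omega>" "\<And>x. x \<notin> K \<Longrightarrow> \<phi> x = 0" "\<And>x. x \<notin> K \<Longrightarrow> d\<phi> x = 0"
  shows "has_weak_grad \<Omega> \<phi> d\<phi>"
  unfolding has_weak_grad_def
proof (intro conjI ballI allI)
  show L: "\<phi> \<in> L2 \<Omega>" "d\<phi> \<in> L2 \<Omega>"
    using test_function_L2[OF \<Omega> \<phi>] continuous_compact_support_L2[OF d\<phi>(2,3,6) \<Omega>] by auto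
  fix \<psi> :: "'d scalar_field" and i
  assume \<psi>: "\<psi> \<in> test_functions \<Omega>"
  obtain d\<psi> where d\<psi>: "\<And>x. GDERIV \<psi> x :> d\<psi> x" "continuous_on UNIV d\<psi>"
      "\<And>x i. frechet_derivative \<psi> (at x) (axis i 1) = d\<psi> x $ i"
    using test_function_gradient[OF \<psi>] by metis
  define e :: "real ^ 'd" where "e = axis i 1"
  have cont: "continuous_on UNIV \<phi>" "continuous_on UNIV \<psi>"
    using \<phi> \<psi> smooth_continuous by (auto simp: test_functions_def)
  have "(LINT x|lborel. e \<bullet> (\<phi> x *\<^sub>R d\<psi> x + \<psi> x *\<^sub>R d\<phi> x)) = 0"
  proof (rule integral_gradient_compact_support)
    show "GDERIV (\<lambda>x. \<phi> x * \<psi> x) x :> \<phi> x *\<^sub>R d\<psi> x + \<psi> x *\<^sub>R d\<phi> x" for x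
      using d\<phi>(1) d\<psi>(1) by (rule GDERIV_mult)
    show "continuous_on UNIV (\<lambda>x. \<phi> x *\<^sub>R d\<psi> x + \<psi> x *\<^sub>R d\<phi> x)"
      using cont d\<phi>(2) d\<psi>(2) by (intro continuous_intros)
  qed (use d\<phi> in \<open>auto simp: e_def\<close>)
  \<comment> \<open>Off K both summands vanish with \<phi> and its gradient, and K lies in \<Omega>;
    so the integral over the whole space is one over \<Omega>.\<close>
  moreover have "e \<bullet> (\<phi> x *\<^sub>R d\<psi> x + \<psi> x *\<^sub>R d\<phi> x) = indicator \<Omega> x *\<^sub>R (\<phi> x * d\<psi> x $ i + d\<phi> x $ i * \<psi> x)" for x
  proof (cases "x \<in> K")
    case True
    then show ?thesis using d\<phi>(4) by (auto simp: e_def inner_axis' algebra_simps)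
  qed (simp add: d\<phi>(5,6))
  ultimately have "(LINT x|lborel. indicator \<Omega> x *\<^sub>R (\<phi> x * d\<psi> x $ i + d\<phi> x $ i * \<psi> x)) = 0"
    by simp
  moreover have "(\<lambda>x. indicator \<Omega> x *\<^sub>R (\<phi> x * d\<psi> x $ i + d\<phi> x $ i * \<psi> x)) \<in> borel_measurable lborel"
    using \<Omega> cont d\<phi>(2) d\<psi>(2)
    by (intro borel_measurable_scaleR borel_measurable_indicator)
       (auto intro!: borel_measurable_continuous_onI continuous_intros)
  ultimately have "(LINT x|lebesgue_on \<Omega>. \<phi> x * d\<psi> x $ i + d\<phi> x $ i * \<psi> x) = 0"
    using open_in_sets_lebesgue[OF \<Omega>] by (simp add: integral_restrict_space integral_completion)
  moreover have "(\<lambda>x. d\<psi> x $ i) \<in> L2 \<Omega>"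
    using test_function_partial_L2[OF \<Omega> \<psi>, of i] by (simp add: d\<psi>(3))
  ultimately show "L2_inner \<Omega> \<phi> (\<lambda>x. frechet_derivative \<psi> (at x) (axis i 1)) = - L2_inner \<Omega> (\<lambda>x. d\<phi> x $ i) \<psi>"
    using L2_integrable_inner[OF L(1), of "\<lambda>x. d\<psi> x $ i"]
      L2_integrable_inner[OF L2_nth[OF L(2), of i] test_function_L2[OF \<Omega> \<psi>]]
    by (simp add: L2_inner_def d\<psi>(3))
qed

section \<open>Fourth-power estimates in two and three coordinates\<close>

lemma ennreal_two_mult_le: "2 * (a * b) \<le> a\<^sup>2 + (b :: ennreal)\<^sup>2"
proof (cases "a = top \<or> b = top")
  case False
  then obtain x y where "a = ennreal x" "x \<ge> 0" "b = ennreal y" "y \<ge> 0"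
    by (metis ennreal_cases)
  moreover have "ennreal (2 * (x * y)) \<le> ennreal (x\<^sup>2 + y\<^sup>2)"
    using sum_squares_bound[of x y] by (intro ennreal_leI) simp
  ultimately show ?thesis by (simp add: ennreal_mult ennreal_power)
qed (auto simp: power2_eq_square)

text \<open>
  Ladyzhenskaya's argument: the bound by the line integrals in one variable and by those in the other
  are multiplied before integrating.
\<close>

lemma Ladyzhenskaya_plane:
  fixes f g :: "real \<times> real \<Rightarrow> ennreal"
  assumes [measurable]: "f \<in> borel_measurable (lborel \<Otimes>\<^sub>M lborel)" "g \<in> borel_measurable (lborel \<Otimes>\<^sub>M lborel)"
    and 1: "\<And>x y. (f (x, y))\<^sup>2 \<le> (\<integral>\<^sup>+t. 2 * (f (t, y) * g (t, y)) \<partial>lborel)"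
    and 2: "\<And>x y. (f (x, y))\<^sup>2 \<le> (\<integral>\<^sup>+t. 2 * (f (x, t) * g (x, t)) \<partial>lborel)"
  shows "(\<integral>\<^sup>+p. (f p) ^ 4 \<partial>(lborel \<Otimes>\<^sub>M lborel)) \<le>
    4 * ((\<integral>\<^sup>+p. (f p)\<^sup>2 \<partial>(lborel \<Otimes>\<^sub>M lborel)) * (\<integral>\<^sup>+p. (g p)\<^sup>2 \<partial>(lborel \<Otimes>\<^sub>M lborel)))"
proof -
  define s where "s p = 2 * (f p * g p)" for p
  have [measurable]: "s \<in> borel_measurable (lborel \<Otimes>\<^sub>M lborel)"
    unfolding s_def by measurable
  define F1 F2 where "F1 y = (\<integral>\<^sup>+t. s (t, y) \<partial>lborel)" and "F2 x = (\<integral>\<^sup>+t. s (x, t) \<partial>lborel)" for x y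
  have [measurable]: "F1 \<in> borel_measurable lborel" "F2 \<in> borel_measurable lborel"
    unfolding F1_def F2_def by measurable
  have "(\<integral>\<^sup>+p. (f p) ^ 4 \<partial>(lborel \<Otimes>\<^sub>M lborel)) = (\<integral>\<^sup>+x. \<integral>\<^sup>+y. (f (x, y)) ^ 4 \<partial>lborel \<partial>lborel)"
    by (subst lborel.nn_integral_fst[symmetric]) auto
  also have "\<dots> \<le> (\<integral>\<^sup>+x. \<integral>\<^sup>+y. F2 x * F1 y \<partial>lborel \<partial>lborel)"
  proof (intro nn_integral_mono)
    fix x y
    have "(f (x, y))\<^sup>2 * (f (x, y))\<^sup>2 \<le> F2 x * F1 y"
      unfolding F1_def F2_def s_def using 1 2 by (intro mult_mono) auto
    then show "(f (x, y)) ^ 4 \<le> F2 x * F1 y"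
      by (simp flip: power_add)
  qed
  also have "\<dots> = (\<integral>\<^sup>+x. F2 x \<partial>lborel) * (\<integral>\<^sup>+y. F1 y \<partial>lborel)"
    by (simp add: nn_integral_cmult nn_integral_multc)
  also have "(\<integral>\<^sup>+x. F2 x \<partial>lborel) = integral\<^sup>N (lborel \<Otimes>\<^sub>M lborel) s"
    unfolding F2_def by (rule lborel.nn_integral_fst) simp
  also have "(\<integral>\<^sup>+y. F1 y \<partial>lborel) = integral\<^sup>N (lborel \<Otimes>\<^sub>M lborel) s"
    unfolding F1_def by (rule lborel_pair.nn_integral_snd) simp
  also have "integral\<^sup>N (lborel \<Otimes>\<^sub>M lborel) s = 2 * (\<integral>\<^sup>+p. f p * g p \<partial>(lborel \<Otimes>\<^sub>M lborel))"
    unfolding s_def by (rule nn_integral_cmult) simp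
  also have "2 * (\<integral>\<^sup>+p. f p * g p \<partial>(lborel \<Otimes>\<^sub>M lborel)) * (2 * (\<integral>\<^sup>+p. f p * g p \<partial>(lborel \<Otimes>\<^sub>M lborel))) =
      4 * (\<integral>\<^sup>+p. f p * g p \<partial>(lborel \<Otimes>\<^sub>M lborel))\<^sup>2"
  proof -
    have "2 * a * (2 * a) = (2 * 2) * (a * a)" for a :: ennreal
      by (simp only: mult.assoc mult.left_commute)
    then show ?thesis by (simp add: power2_eq_square)
  qed
  also have "\<dots> \<le> 4 * ((\<integral>\<^sup>+p. (f p)\<^sup>2 \<partial>(lborel \<Otimes>\<^sub>M lborel)) * (\<integral>\<^sup>+p. (g p)\<^sup>2 \<partial>(lborel \<Otimes>\<^sub>M lborel)))"
    by (intro mult_left_mono Cauchy_Schwarz_nn_integral) auto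
  finally show ?thesis .
qed

text \<open>The planar estimate is applied on each slice with x fixed. By the bound along the first
  coordinate and Tonelli, the integral of f^2 over a slice is at most S, independently of x; only
  the factor with g^2 is left to be integrated over x.\<close>

lemma Ladyzhenskaya_space:
  fixes f g :: "real \<times> real \<times> real \<Rightarrow> ennreal"
  assumes [measurable]: "f \<in> borel_measurable (lborel \<Otimes>\<^sub>M (lborel \<Otimes>\<^sub>M lborel))"
      "g \<in> borel_measurable (lborel \<Otimes>\<^sub>M (lborel \<Otimes>\<^sub>M lborel))"
    and 1: "\<And>x y z. (f (x, y, z))\<^sup>2 \<le> (\<integral>\<^sup>+t. 2 * (f (t, y, z) * g (t, y, z)) \<partial>lborel)"
    and 2: "\<And>x y z. (f (x, y, z))\<^sup>2 \<le> (\<integral>\<^sup>+t. 2 * (f (x, t, z) * g (x, t, z)) \<partial>lborel)"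
    and 3: "\<And>x y z. (f (x, y, z))\<^sup>2 \<le> (\<integral>\<^sup>+t. 2 * (f (x, y, t) * g (x, y, t)) \<partial>lborel)"
  shows "(\<integral>\<^sup>+p. (f p) ^ 4 \<partial>(lborel \<Otimes>\<^sub>M (lborel \<Otimes>\<^sub>M lborel))) \<le>
    4 * ((\<integral>\<^sup>+p. 2 * (f p * g p) \<partial>(lborel \<Otimes>\<^sub>M (lborel \<Otimes>\<^sub>M lborel))) *
         (\<integral>\<^sup>+p. (g p)\<^sup>2 \<partial>(lborel \<Otimes>\<^sub>M (lborel \<Otimes>\<^sub>M lborel))))"
proof -
  let ?P = "lborel \<Otimes>\<^sub>M lborel :: (real \<times> real) measure"
  have P: "sigma_finite_measure ?P"
    by (simp add: lborel_prod lborel.sigma_finite_measure_axioms)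
  have LP: "pair_sigma_finite (lborel :: real measure) ?P"
    using P lborel.sigma_finite_measure_axioms by (simp add: pair_sigma_finite_def)
  define S where "S = (\<integral>\<^sup>+p. 2 * (f p * g p) \<partial>(lborel \<Otimes>\<^sub>M ?P))"
  have "(\<integral>\<^sup>+p. (f p) ^ 4 \<partial>(lborel \<Otimes>\<^sub>M ?P)) = (\<integral>\<^sup>+x. \<integral>\<^sup>+q. (f (x, q)) ^ 4 \<partial>?P \<partial>lborel)"
    by (subst sigma_finite_measure.nn_integral_fst[OF P, symmetric]) auto
  also have "\<dots> \<le> (\<integral>\<^sup>+x. 4 * (S * (\<integral>\<^sup>+q. (g (x, q))\<^sup>2 \<partial>?P)) \<partial>lborel)"
  proof (intro nn_integral_mono)
    fix x :: real
    have "(\<integral>\<^sup>+q. (f (x, q)) ^ 4 \<partial>?P) \<le> 4 * ((\<integral>\<^sup>+q. (f (x, q))\<^sup>2 \<partial>?P) * (\<integral>\<^sup>+q. (g (x, q))\<^sup>2 \<partial>?P))"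
      using 2 3 by (intro Ladyzhenskaya_plane) auto
    also have "(\<integral>\<^sup>+q. (f (x, q))\<^sup>2 \<partial>?P) \<le> (\<integral>\<^sup>+q. \<integral>\<^sup>+t. 2 * (f (t, q) * g (t, q)) \<partial>lborel \<partial>?P)"
      using 1 by (intro nn_integral_mono) (auto simp: split_paired_all)
    also have "\<dots> = S"
      unfolding S_def by (rule pair_sigma_finite.nn_integral_snd[OF LP]) simp
    finally show "(\<integral>\<^sup>+q. (f (x, q)) ^ 4 \<partial>?P) \<le> 4 * (S * (\<integral>\<^sup>+q. (g (x, q))\<^sup>2 \<partial>?P))"
      by (simp add: mult_left_mono mult_right_mono)
  qed
  also have "\<dots> = 4 * (S * (\<integral>\<^sup>+x. \<integral>\<^sup>+q. (g (x, q))\<^sup>2 \<partial>?P \<partial>lborel))"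
    by (simp add: nn_integral_cmult)
  also have "(\<integral>\<^sup>+x. \<integral>\<^sup>+q. (g (x, q))\<^sup>2 \<partial>?P \<partial>lborel) = (\<integral>\<^sup>+p. (g p)\<^sup>2 \<partial>(lborel \<Otimes>\<^sub>M ?P))"
    by (rule sigma_finite_measure.nn_integral_fst[OF P]) simp
  finally show ?thesis unfolding S_def .
qed

text \<open>Makes Tonelli in coordinates available for an abstract index type with two elements. It
  suffices to compare the measures on boxes, whose preimages are products of intervals.\<close>

lemma lborel_eq_distr_plane:
  fixes i j :: "'d::finite"
  assumes ij: "UNIV = {i, j}" "i \<noteq> j"
  shows "(lborel :: (real ^ 'd) measure) =
    distr (lborel \<Otimes>\<^sub>M lborel) borel (\<lambda>(a, b). a *\<^sub>R axis i 1 + b *\<^sub>R axis j 1)"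
proof (rule lborel_eqI)
  define T :: "real \<times> real \<Rightarrow> real ^ 'd" where "T = (\<lambda>(a, b). a *\<^sub>R axis i 1 + b *\<^sub>R axis j 1)"
  have T [measurable]: "T \<in> borel_measurable (lborel \<Otimes>\<^sub>M lborel)"
    unfolding T_def by measurable
  fix l u :: "real ^ 'd"
  assume le: "\<And>b. b \<in> Basis \<Longrightarrow> l \<bullet> b \<le> u \<bullet> b"
  have nth: "T (a, b) $ i = a" "T (a, b) $ j = b" for a b
    using ij(2) by (auto simp: T_def axis_def)
  have "T -` box l u = {l $ i <..< u $ i} \<times> {l $ j <..< u $ j}"
  proof (rule set_eqI)
    fix p :: "real \<times> real"
    have "(\<forall>k. Q k) \<longleftrightarrow> Q i \<and> Q j" for Q
      using ij(1) by (metis UNIV_I insertE singletonD)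
    then show "p \<in> T -` box l u \<longleftrightarrow> p \<in> {l $ i <..< u $ i} \<times> {l $ j <..< u $ j}"
      by (cases p) (auto simp: mem_box_cart nth)
  qed
  moreover have "l $ k \<le> u $ k" for k
    using le[of "axis k 1"] by (simp add: inner_axis)
  moreover have "(\<Prod>b\<in>Basis. (u - l) \<bullet> b) = (\<Prod>k\<in>UNIV. u $ k - l $ k)"
    by (simp add: Basis_vec_def inner_axis prod.UNION_disjoint axis_eq_axis)
  moreover have "(\<Prod>k\<in>UNIV. u $ k - l $ k) = (u $ i - l $ i) * (u $ j - l $ j)"
    using ij(2) by (subst ij(1)) simp
  ultimately show "emeasure (distr (lborel \<Otimes>\<^sub>M lborel) borel (\<lambda>(a, b). a *\<^sub>R axis i 1 + b *\<^sub>R axis j 1)) (box l u) =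
      ennreal (\<Prod>b\<in>Basis. (u - l) \<bullet> b)"
    using ij T unfolding T_def[symmetric]
    by (simp add: emeasure_distr space_pair_measure lborel.emeasure_pair_measure_Times ennreal_mult)
qed simp

lemma lborel_eq_distr_space:
  fixes i j k :: "'d::finite"
  assumes ijk: "UNIV = {i, j, k}" "i \<noteq> j" "i \<noteq> k" "j \<noteq> k"
  shows "(lborel :: (real ^ 'd) measure) =
    distr (lborel \<Otimes>\<^sub>M (lborel \<Otimes>\<^sub>M lborel)) borel
      (\<lambda>(a, b, c). a *\<^sub>R axis i 1 + b *\<^sub>R axis j 1 + c *\<^sub>R axis k 1)"
proof (rule lborel_eqI)
  define T :: "real \<times> real \<times> real \<Rightarrow> real ^ 'd"
    where "T = (\<lambda>(a, b, c). a *\<^sub>R axis i 1 + b *\<^sub>R axis j 1 + c *\<^sub>R axis k 1)"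
  have T [measurable]: "T \<in> borel_measurable (lborel \<Otimes>\<^sub>M (lborel \<Otimes>\<^sub>M lborel))"
    unfolding T_def by measurable
  have P: "sigma_finite_measure (lborel \<Otimes>\<^sub>M lborel :: (real \<times> real) measure)"
    by (simp add: lborel_prod lborel.sigma_finite_measure_axioms)
  fix l u :: "real ^ 'd"
  assume le: "\<And>b. b \<in> Basis \<Longrightarrow> l \<bullet> b \<le> u \<bullet> b"
  have nth: "T (a, b, c) $ i = a" "T (a, b, c) $ j = b" "T (a, b, c) $ k = c" for a b c
    using ijk by (auto simp: T_def axis_def)
  have "T -` box l u = {l $ i <..< u $ i} \<times> {l $ j <..< u $ j} \<times> {l $ k <..< u $ k}"
  proof (rule set_eqI)
    fix p :: "real \<times> real \<times> real"
    have "(\<forall>k. Q k) \<longleftrightarrow> Q i \<and> Q j \<and> Q k" for Q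
      using ijk(1) by (metis UNIV_I insertE singletonD)
    then show "p \<in> T -` box l u \<longleftrightarrow> p \<in> {l $ i <..< u $ i} \<times> {l $ j <..< u $ j} \<times> {l $ k <..< u $ k}"
      by (cases p) (auto simp: mem_box_cart nth)
  qed
  moreover have "l $ k \<le> u $ k" for k
    using le[of "axis k 1"] by (simp add: inner_axis)
  moreover have "(\<Prod>b\<in>Basis. (u - l) \<bullet> b) = (\<Prod>k\<in>UNIV. u $ k - l $ k)"
    by (simp add: Basis_vec_def inner_axis prod.UNION_disjoint axis_eq_axis)
  moreover have "(\<Prod>k\<in>UNIV. u $ k - l $ k) = (u $ i - l $ i) * ((u $ j - l $ j) * (u $ k - l $ k))"
    using ijk(2-) by (subst ijk(1)) simp
  ultimately show "emeasure (distr (lborel \<Otimes>\<^sub>M (lborel \<Otimes>\<^sub>M lborel)) borel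
      (\<lambda>(a, b, c). a *\<^sub>R axis i 1 + b *\<^sub>R axis j 1 + c *\<^sub>R axis k 1)) (box l u) =
      ennreal (\<Prod>b\<in>Basis. (u - l) \<bullet> b)"
    using ijk T unfolding T_def[symmetric]
    by (simp add: emeasure_distr space_pair_measure sigma_finite_measure.emeasure_pair_measure_Times[OF P]
        lborel.emeasure_pair_measure_Times ennreal_mult mult.assoc)
qed simp

text \<open>The fundamental theorem of calculus for h^2, on an interval that starts where h
  vanishes; the integral of 2 h h' is then enlarged to the whole line.\<close>

lemma square_le_line_integral:
  fixes h :: "real \<Rightarrow> real"
  assumes h: "\<And>s. (h has_real_derivative h' s) (at s)" and h': "continuous_on UNIV h'"
    and R: "\<And>s. \<bar>s\<bar> > R \<Longrightarrow> h s = 0" and m: "\<And>s. \<bar>h' s\<bar> \<le> m s"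
  shows "(ennreal \<bar>h t\<bar>)\<^sup>2 \<le> (\<integral>\<^sup>+s. 2 * (ennreal \<bar>h s\<bar> * ennreal (m s)) \<partial>lborel)"
proof -
  \<comment> \<open>A point to the left of t where h vanishes; the absolute values cover all signs
    of R and t.\<close>
  define a where "a = - \<bar>R\<bar> - \<bar>t\<bar> - 1"
  have a: "a \<le> t" "\<bar>a\<bar> > R" unfolding a_def by linarith+
  have hc: "isCont h s" "isCont h' s" for s
    using h h' by (auto intro: DERIV_isCont simp: continuous_on_eq_continuous_at)
  have "has_bochner_integral lborel (\<lambda>s. (2 * (h s * h' s)) * indicator {a..t} s) ((h t)\<^sup>2 - (h a)\<^sup>2)"
    using a(1) hc by (intro has_bochner_integral_FTC_Icc_real)
      (auto intro!: derivative_eq_intros h continuous_intros)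
  then have i: "integrable lborel (\<lambda>s. (2 * (h s * h' s)) * indicator {a..t} s)"
    and eq: "(h t)\<^sup>2 = (LINT s|lborel. (2 * (h s * h' s)) * indicator {a..t} s)"
    using R[OF a(2)] by (auto simp: has_bochner_integral_iff)
  have "(ennreal \<bar>h t\<bar>)\<^sup>2 = ennreal (norm (LINT s|lborel. (2 * (h s * h' s)) * indicator {a..t} s))"
    by (simp add: ennreal_power flip: eq)
  also have "\<dots> \<le> (\<integral>\<^sup>+s. norm ((2 * (h s * h' s)) * indicator {a..t} s) \<partial>lborel)"
    by (rule integral_norm_bound_ennreal[OF i])
  also have "\<dots> \<le> (\<integral>\<^sup>+s. 2 * (ennreal \<bar>h s\<bar> * ennreal (m s)) \<partial>lborel)"
  proof (rule nn_integral_mono)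
    fix s
    have "0 \<le> m s" using m[of s] by linarith
    moreover have "norm ((2 * (h s * h' s)) * indicator {a..t} s) \<le> 2 * (\<bar>h s\<bar> * m s)"
      using m[of s] \<open>0 \<le> m s\<close> by (auto simp: indicator_def abs_mult intro!: mult_left_mono)
    then have "ennreal (norm ((2 * (h s * h' s)) * indicator {a..t} s)) \<le> ennreal (2 * (\<bar>h s\<bar> * m s))"
      by (rule ennreal_leI)
    ultimately show "ennreal (norm ((2 * (h s * h' s)) * indicator {a..t} s)) \<le> 2 * (ennreal \<bar>h s\<bar> * ennreal (m s))"
      by (simp add: ennreal_mult)
  qed
  finally show ?thesis .
qed

text \<open>The plane gives 4 I J, and space gives 4 S J with S the integral of 2 f h, at most I +
  J. Both are weakened to one bound in terms of the squared H1 norm I + J, which serves for the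
  passage to the limit in \<open>H10_L4\<close>.\<close>

lemma Ladyzhenskaya_inequality:
  fixes \<phi> :: "real ^ 'd \<Rightarrow> real"
  assumes dim: "CARD('d) = 2 \<or> CARD('d) = 3"
    and \<phi>: "\<And>x. GDERIV \<phi> x :> g x" "continuous_on UNIV g" "compact K" "\<And>x. x \<notin> K \<Longrightarrow> \<phi> x = 0"
  shows "(\<integral>\<^sup>+x. (ennreal \<bar>\<phi> x\<bar>) ^ 4 \<partial>lborel) \<le>
    4 * ((\<integral>\<^sup>+x. (ennreal \<bar>\<phi> x\<bar>)\<^sup>2 \<partial>lborel) + (\<integral>\<^sup>+x. (ennreal (norm (g x)))\<^sup>2 \<partial>lborel))\<^sup>2"
proof -
  define f h where "f x = ennreal \<bar>\<phi> x\<bar>" and "h x = ennreal (norm (g x))" for x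
  define I J where "I = (\<integral>\<^sup>+x. (f x)\<^sup>2 \<partial>lborel)" and "J = (\<integral>\<^sup>+x. (h x)\<^sup>2 \<partial>lborel)"
  have cont: "continuous_on UNIV \<phi>"
    using \<phi>(1) by (auto simp: continuous_on_eq_continuous_at intro: GDERIV_isCont)
  have [measurable]: "\<phi> \<in> borel_measurable borel" "g \<in> borel_measurable borel"
    using cont \<phi>(2) by (auto intro: borel_measurable_continuous_onI)
  have [measurable]: "f \<in> borel_measurable borel" "h \<in> borel_measurable borel"
    unfolding f_def h_def by measurable
  obtain R where R: "\<And>x. x \<in> K \<Longrightarrow> norm x \<le> R"
    using compact_imp_bounded[OF \<phi>(3)] by (auto simp: bounded_iff)
  have line: "(f (x + t *\<^sub>R axis i 1))\<^sup>2 \<le> (\<integral>\<^sup>+s. 2 * (f (x + s *\<^sub>R axis i 1) * h (x + s *\<^sub>R axis i 1)) \<partial>lborel)"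
    for x t i
    unfolding f_def h_def
  proof (rule square_le_line_integral)
    show "((\<lambda>s. \<phi> (x + s *\<^sub>R axis i 1)) has_real_derivative axis i 1 \<bullet> g (x + s *\<^sub>R axis i 1)) (at s)" for s
      using \<phi>(1) by (rule GDERIV_along_line)
    show "continuous_on UNIV (\<lambda>s. axis i 1 \<bullet> g (x + s *\<^sub>R axis i 1))"
      by (intro continuous_intros continuous_on_compose2[OF \<phi>(2)]) auto
    show "\<phi> (x + s *\<^sub>R axis i 1) = 0" if "\<bar>s\<bar> > R + norm x" for s
    proof (rule \<phi>(4))
      have "norm (s *\<^sub>R axis i 1 :: real ^ 'd) \<le> norm (x + s *\<^sub>R axis i 1) + norm x"
        using norm_triangle_ineq4[of "x + s *\<^sub>R axis i 1" x] by simp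
      then show "x + s *\<^sub>R axis i 1 \<notin> K" using that R by force
    qed
    show "\<bar>axis i 1 \<bullet> g (x + s *\<^sub>R axis i 1)\<bar> \<le> norm (g (x + s *\<^sub>R axis i 1))" for s
      by (simp add: inner_axis' component_le_norm_cart)
  qed
  have "(\<integral>\<^sup>+x. (f x) ^ 4 \<partial>lborel) \<le> 4 * (I + J)\<^sup>2"
    using dim
  proof
    assume "CARD('d) = 2"
    then obtain i j :: 'd where ij: "UNIV = {i, j}" "i \<noteq> j"
      by (auto simp: card_2_iff)
    define T :: "real \<times> real \<Rightarrow> real ^ 'd" where "T = (\<lambda>(a, b). a *\<^sub>R axis i 1 + b *\<^sub>R axis j 1)"
    have T [measurable]: "T \<in> borel_measurable (lborel \<Otimes>\<^sub>M lborel)"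
      unfolding T_def by measurable
    have eq: "(\<integral>\<^sup>+x. F x \<partial>lborel) = (\<integral>\<^sup>+p. F (T p) \<partial>(lborel \<Otimes>\<^sub>M lborel))"
      if "F \<in> borel_measurable borel" for F
      using that T unfolding lborel_eq_distr_plane[OF ij] T_def[symmetric]
      by (subst nn_integral_distr) auto
    have "(\<integral>\<^sup>+p. (f (T p)) ^ 4 \<partial>(lborel \<Otimes>\<^sub>M lborel)) \<le>
        4 * ((\<integral>\<^sup>+p. (f (T p))\<^sup>2 \<partial>(lborel \<Otimes>\<^sub>M lborel)) * (\<integral>\<^sup>+p. (h (T p))\<^sup>2 \<partial>(lborel \<Otimes>\<^sub>M lborel)))"
    proof (rule Ladyzhenskaya_plane)
      show "(f (T (x, y)))\<^sup>2 \<le> (\<integral>\<^sup>+t. 2 * (f (T (t, y)) * h (T (t, y))) \<partial>lborel)" for x y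
        using line[of "y *\<^sub>R axis j 1" x i] by (simp add: T_def add_ac)
      show "(f (T (x, y)))\<^sup>2 \<le> (\<integral>\<^sup>+t. 2 * (f (T (x, t)) * h (T (x, t))) \<partial>lborel)" for x y
        using line[of "x *\<^sub>R axis i 1" y j] by (simp add: T_def add_ac)
    qed simp_all
    also have "\<dots> = 4 * (I * J)" unfolding I_def J_def by (simp add: eq)
    also have "\<dots> \<le> 4 * ((I + J) * (I + J))"
      by (intro mult_left_mono mult_mono) auto
    finally show ?thesis by (simp add: eq power2_eq_square)
  next
    assume "CARD('d) = 3"
    then obtain i j k :: 'd where ijk: "UNIV = {i, j, k}" "i \<noteq> j" "i \<noteq> k" "j \<noteq> k"
      by (auto simp: card_3_iff)
    define T :: "real \<times> real \<times> real \<Rightarrow> real ^ 'd"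
      where "T = (\<lambda>(a, b, c). a *\<^sub>R axis i 1 + b *\<^sub>R axis j 1 + c *\<^sub>R axis k 1)"
    have T [measurable]: "T \<in> borel_measurable (lborel \<Otimes>\<^sub>M (lborel \<Otimes>\<^sub>M lborel))"
      unfolding T_def by measurable
    have eq: "(\<integral>\<^sup>+x. F x \<partial>lborel) = (\<integral>\<^sup>+p. F (T p) \<partial>(lborel \<Otimes>\<^sub>M (lborel \<Otimes>\<^sub>M lborel)))"
      if "F \<in> borel_measurable borel" for F
      using that T unfolding lborel_eq_distr_space[OF ijk] T_def[symmetric]
      by (subst nn_integral_distr) auto
    have "(\<integral>\<^sup>+x. 2 * (f x * h x) \<partial>lborel) \<le> (\<integral>\<^sup>+x. (f x)\<^sup>2 + (h x)\<^sup>2 \<partial>lborel)"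
      by (intro nn_integral_mono ennreal_two_mult_le)
    also have "\<dots> = I + J"
      unfolding I_def J_def by (intro nn_integral_add) auto
    finally have S: "(\<integral>\<^sup>+x. 2 * (f x * h x) \<partial>lborel) \<le> I + J" .
    have "(\<integral>\<^sup>+p. (f (T p)) ^ 4 \<partial>(lborel \<Otimes>\<^sub>M (lborel \<Otimes>\<^sub>M lborel))) \<le>
        4 * ((\<integral>\<^sup>+p. 2 * (f (T p) * h (T p)) \<partial>(lborel \<Otimes>\<^sub>M (lborel \<Otimes>\<^sub>M lborel))) *
             (\<integral>\<^sup>+p. (h (T p))\<^sup>2 \<partial>(lborel \<Otimes>\<^sub>M (lborel \<Otimes>\<^sub>M lborel))))"
    proof (rule Ladyzhenskaya_space)
      show "(f (T (x, y, z)))\<^sup>2 \<le> (\<integral>\<^sup>+t. 2 * (f (T (t, y, z)) * h (T (t, y, z))) \<partial>lborel)" for x y z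
        using line[of "y *\<^sub>R axis j 1 + z *\<^sub>R axis k 1" x i] by (simp add: T_def add_ac)
      show "(f (T (x, y, z)))\<^sup>2 \<le> (\<integral>\<^sup>+t. 2 * (f (T (x, t, z)) * h (T (x, t, z))) \<partial>lborel)" for x y z
        using line[of "x *\<^sub>R axis i 1 + z *\<^sub>R axis k 1" y j] by (simp add: T_def add_ac)
      show "(f (T (x, y, z)))\<^sup>2 \<le> (\<integral>\<^sup>+t. 2 * (f (T (x, y, t)) * h (T (x, y, t))) \<partial>lborel)" for x y z
        using line[of "x *\<^sub>R axis i 1 + y *\<^sub>R axis j 1" z k] by (simp add: T_def add_ac)
    qed simp_all
    also have "\<dots> = 4 * ((\<integral>\<^sup>+x. 2 * (f x * h x) \<partial>lborel) * J)"
      unfolding J_def by (simp add: eq)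
    also have "\<dots> \<le> 4 * ((I + J) * (I + J))"
      using S by (intro mult_left_mono mult_mono) auto
    finally show ?thesis by (simp add: eq power2_eq_square)
  qed
  then show ?thesis unfolding f_def h_def I_def J_def .
qed

section \<open>From test functions to \<open>H10\<close> by density\<close>

lemma nn_integral_L2_norm:
  assumes "f \<in> L2 \<Omega>"
  shows "(\<integral>\<^sup>+x. (ennreal (norm (f x)))\<^sup>2 \<partial>lebesgue_on \<Omega>) = ennreal ((L2_norm \<Omega> f)\<^sup>2)"
proof -
  have "(\<integral>\<^sup>+x. ennreal ((norm (f x))\<^sup>2) \<partial>lebesgue_on \<Omega>) = ennreal (LINT x|lebesgue_on \<Omega>. (norm (f x))\<^sup>2)"
    using assms by (intro nn_integral_eq_integral) (auto simp: L2_def)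
  then show ?thesis
    by (simp add: ennreal_power L2_norm_square L2_inner_def power2_norm_eq_inner)
qed

text \<open>Stated for an arbitrary weak gradient h, because the approximation in \<open>H10\<close>
  controls norms of chosen representatives rather than of classical gradients.\<close>

lemma test_function_L4_bound:
  fixes \<phi> :: "'d::finite scalar_field"
  assumes dim: "CARD('d) = 2 \<or> CARD('d) = 3" and \<Omega>: "open \<Omega>"
    and \<phi>: "\<phi> \<in> test_functions \<Omega>" "has_weak_grad \<Omega> \<phi> h"
  shows "(\<integral>\<^sup>+x. ennreal (\<bar>\<phi> x\<bar> ^ 4) \<partial>lebesgue_on \<Omega>) \<le>
    ennreal (4 * ((L2_norm \<Omega> \<phi>)\<^sup>2 + (L2_norm \<Omega> h)\<^sup>2)\<^sup>2)"
proof -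
  obtain g K where g: "\<And>x. GDERIV \<phi> x :> g x" "continuous_on UNIV g"
      "compact K" "K \<subseteq> \<Omega>" "\<And>x. x \<notin> K \<Longrightarrow> \<phi> x = 0" "\<And>x. x \<notin> K \<Longrightarrow> g x = 0"
    using test_function_gradient[OF \<phi>(1)] by metis
  have wg: "has_weak_grad \<Omega> \<phi> g"
    using test_function_has_weak_grad[OF \<Omega> \<phi>(1) g] .
  have L: "\<phi> \<in> L2 \<Omega>" "g \<in> L2 \<Omega>" "h \<in> L2 \<Omega>"
    using wg \<phi>(2) by (auto simp: has_weak_grad_def)
  have gh: "AE x in lebesgue_on \<Omega>. g x = h x"
    by (rule has_weak_grad_unique[OF \<Omega> wg \<phi>(2)])
  have norm_eq: "L2_norm \<Omega> g = L2_norm \<Omega> h"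
    using L(2,3) gh by (rule L2_norm_cong_AE)
  have cont: "continuous_on UNIV \<phi>"
    using \<phi>(1) smooth_continuous by (auto simp: test_functions_def)
  have eq: "(\<integral>\<^sup>+x. F x \<partial>lborel) = (\<integral>\<^sup>+x. F x \<partial>lebesgue_on \<Omega>)"
    if "F \<in> borel_measurable borel" "\<And>x. x \<notin> K \<Longrightarrow> F x = 0" for F
  proof -
    have "F x * indicator \<Omega> x = F x" for x
      using that(2)[of x] g(4) by (cases "x \<in> K") (auto simp: indicator_def)
    then show ?thesis
      using that(1) open_in_sets_lebesgue[OF \<Omega>] by (simp add: nn_integral_restrict_space nn_integral_completion)
  qed
  have m: "\<phi> \<in> borel_measurable borel" "g \<in> borel_measurable borel"
    using cont g(2) by (auto intro: borel_measurable_continuous_onI)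
  have "(\<integral>\<^sup>+x. (ennreal \<bar>\<phi> x\<bar>) ^ 4 \<partial>lebesgue_on \<Omega>) \<le>
      4 * ((\<integral>\<^sup>+x. (ennreal (norm (\<phi> x)))\<^sup>2 \<partial>lebesgue_on \<Omega>) + (\<integral>\<^sup>+x. (ennreal (norm (g x)))\<^sup>2 \<partial>lebesgue_on \<Omega>))\<^sup>2"
    using Ladyzhenskaya_inequality[OF dim g(1,2,3,5)] m g(5,6) by (simp add: eq)
  also have "\<dots> = ennreal (4 * ((L2_norm \<Omega> \<phi>)\<^sup>2 + (L2_norm \<Omega> h)\<^sup>2)\<^sup>2)"
    unfolding nn_integral_L2_norm[OF L(1)] nn_integral_L2_norm[OF L(2)] norm_eq
    by (simp add: ennreal_mult ennreal_power flip: ennreal_plus)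
  finally show ?thesis by (simp add: ennreal_power)
qed

lemma L2_norm_add_square_le:
  assumes "f \<in> L2 \<Omega>" "g \<in> L2 \<Omega>"
  shows "(L2_norm \<Omega> (f + g))\<^sup>2 \<le> 2 * (L2_norm \<Omega> f)\<^sup>2 + 2 * (L2_norm \<Omega> g)\<^sup>2"
proof -
  have "(L2_norm \<Omega> (f + g))\<^sup>2 \<le> (L2_norm \<Omega> f + L2_norm \<Omega> g)\<^sup>2"
    using L2_norm_add_le[OF assms] by (intro power_mono L2_norm_nonneg)
  then show ?thesis
    using sum_squares_bound[of "L2_norm \<Omega> f" "L2_norm \<Omega> g"] by (simp add: power2_sum)
qed

text \<open>Test functions approximating u are bounded in H1 and hence have bounded fourth-power
  integrals. A subsequence converges almost everywhere, and Fatou's lemma carries the bound over to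
  u.\<close>

lemma H10_L4:
  fixes u :: "'d::finite scalar_field"
  assumes dim: "CARD('d) = 2 \<or> CARD('d) = 3" and \<Omega>: "open \<Omega>" and u: "u \<in> H10 \<Omega>"
  shows "integrable (lebesgue_on \<Omega>) (\<lambda>x. \<bar>u x\<bar> ^ 4)"
proof -
  obtain \<phi> where \<phi>: "\<And>n. \<phi> n \<in> test_functions \<Omega>" "(\<lambda>n. H1_norm \<Omega> (\<phi> n - u)) \<longlonglongrightarrow> 0"
    using u by (auto simp: H10_def)
  define g where "g = weak_grad \<Omega> u"
  have ug: "has_weak_grad \<Omega> u g"
    using u weak_grad_has_weak_grad by (auto simp: H10_def g_def)
  then have uL: "u \<in> L2 \<Omega>" "g \<in> L2 \<Omega>" by (auto simp: has_weak_grad_def)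
  define v where "v n = \<phi> n - u" for n
  have \<phi>v: "\<phi> n = v n + u" for n by (simp add: v_def)
  have "\<exists>h. has_weak_grad \<Omega> (\<phi> n) h" for n
    using test_function_gradient[OF \<phi>(1)[of n]] test_function_has_weak_grad[OF \<Omega> \<phi>(1)[of n]] by metis
  then obtain h where h: "\<And>n. has_weak_grad \<Omega> (\<phi> n) (h n)" by metis
  have "has_weak_grad \<Omega> (\<phi> n + (-1) *\<^sub>R u) (h n + (-1) *\<^sub>R g)" for n
    by (intro has_weak_grad_add has_weak_grad_scaleR \<Omega> h ug)
  moreover have "\<phi> n + (-1) *\<^sub>R u = v n" for n
    by (auto simp: v_def scaleR_fun_def fun_eq_iff)
  ultimately have v: "v n \<in> H1 \<Omega>" for n by (auto simp: H1_def)
  define k where "k n = weak_grad \<Omega> (v n)" for n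
  have vk: "has_weak_grad \<Omega> (v n) (k n)" for n
    using v weak_grad_has_weak_grad by (auto simp: k_def)
  then have vL: "v n \<in> L2 \<Omega>" "k n \<in> L2 \<Omega>" for n by (auto simp: has_weak_grad_def)
  \<comment> \<open>This weak gradient of \<open>\<phi> n\<close> is used because the norm of
    \<open>k n\<close> is part of \<open>H1_norm \<Omega> (v n)\<close>.\<close>
  have \<phi>k: "has_weak_grad \<Omega> (\<phi> n) (k n + g)" for n
    unfolding \<phi>v using \<Omega> vk ug by (rule has_weak_grad_add)
  have Hv: "H1_norm \<Omega> (v n) = sqrt ((L2_norm \<Omega> (v n))\<^sup>2 + (L2_norm \<Omega> (k n))\<^sup>2)" for n
    by (simp add: H1_norm_def k_def)
  have lim: "(\<lambda>n. H1_norm \<Omega> (v n)) \<longlonglongrightarrow> 0" using \<phi>(2) by (simp add: v_def)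
  obtain B where B: "\<And>n. \<bar>H1_norm \<Omega> (v n)\<bar> \<le> B"
    using convergent_imp_Bseq[OF convergentI[OF lim]] by (auto simp: Bseq_def)
  \<comment> \<open>From (a + b)^2 \<le> 2 a^2 + 2 b^2 for the values and for the gradients, with B
    bounding the H1 norms of \<open>v n\<close>.\<close>
  define C where "C = 2 * B\<^sup>2 + 2 * (L2_norm \<Omega> u)\<^sup>2 + 2 * (L2_norm \<Omega> g)\<^sup>2"
  have bound: "(\<integral>\<^sup>+x. ennreal (\<bar>\<phi> n x\<bar> ^ 4) \<partial>lebesgue_on \<Omega>) \<le> ennreal (4 * C\<^sup>2)" for n
  proof -
    have "(L2_norm \<Omega> (v n))\<^sup>2 + (L2_norm \<Omega> (k n))\<^sup>2 = (H1_norm \<Omega> (v n))\<^sup>2"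
      by (simp add: Hv)
    also have "\<dots> \<le> B\<^sup>2"
      using B[of n] by (metis abs_ge_zero power2_abs power_mono)
    finally have "(L2_norm \<Omega> (\<phi> n))\<^sup>2 + (L2_norm \<Omega> (k n + g))\<^sup>2 \<le> C"
      using L2_norm_add_square_le[OF vL(1) uL(1), of n] L2_norm_add_square_le[OF vL(2) uL(2), of n]
      by (simp add: C_def flip: \<phi>v)
    then have "4 * ((L2_norm \<Omega> (\<phi> n))\<^sup>2 + (L2_norm \<Omega> (k n + g))\<^sup>2)\<^sup>2 \<le> 4 * C\<^sup>2"
      by (intro mult_left_mono power_mono) auto
    then show ?thesis
      using test_function_L4_bound[OF dim \<Omega> \<phi>(1) \<phi>k, of n] by (meson ennreal_leI order_trans)
  qed
  \<comment> \<open>Convergence in L2 is recast as L1 convergence of the squares, from which an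
    almost everywhere convergent subsequence is drawn.\<close>
  have sq: "(\<lambda>n. LINT x|lebesgue_on \<Omega>. norm ((v n x)\<^sup>2)) \<longlonglongrightarrow> 0"
  proof (rule tendsto_sandwich[where f = "\<lambda>n. 0" and h = "\<lambda>n. (H1_norm \<Omega> (v n))\<^sup>2"])
    show "(\<lambda>n. (H1_norm \<Omega> (v n))\<^sup>2) \<longlonglongrightarrow> 0" using tendsto_power[OF lim, of 2] by simp
    show "\<forall>\<^sub>F n in sequentially. (LINT x|lebesgue_on \<Omega>. norm ((v n x)\<^sup>2)) \<le> (H1_norm \<Omega> (v n))\<^sup>2"
    proof (intro always_eventually allI)
      fix n
      have "(LINT x|lebesgue_on \<Omega>. norm ((v n x)\<^sup>2)) = (L2_norm \<Omega> (v n))\<^sup>2"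
        unfolding L2_norm_square by (simp add: L2_inner_def power2_eq_square)
      then show "(LINT x|lebesgue_on \<Omega>. norm ((v n x)\<^sup>2)) \<le> (H1_norm \<Omega> (v n))\<^sup>2" by (simp add: Hv)
    qed
  qed auto
  have "integrable (lebesgue_on \<Omega>) (\<lambda>x. (v n x)\<^sup>2)" for n
    using vL(1)[of n] by (simp add: L2_def)
  from tendsto_L1_AE_subseq[OF this sq]
  obtain r where r: "strict_mono r" "AE x in lebesgue_on \<Omega>. (\<lambda>n. (v (r n) x)\<^sup>2) \<longlonglongrightarrow> 0"
    by blast
  have "AE x in lebesgue_on \<Omega>. (\<lambda>n. ennreal (\<bar>\<phi> (r n) x\<bar> ^ 4)) \<longlonglongrightarrow> ennreal (\<bar>u x\<bar> ^ 4)"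
    using r(2)
  proof eventually_elim
    case (elim x)
    then have "(\<lambda>n. sqrt ((v (r n) x)\<^sup>2)) \<longlonglongrightarrow> sqrt 0" by (rule tendsto_real_sqrt)
    then have "(\<lambda>n. v (r n) x) \<longlonglongrightarrow> 0" by (simp add: tendsto_rabs_zero_iff)
    then have "(\<lambda>n. v (r n) x + u x) \<longlonglongrightarrow> 0 + u x" by (intro tendsto_intros)
    then have "(\<lambda>n. \<phi> (r n) x) \<longlonglongrightarrow> u x" by (simp add: \<phi>v)
    then show ?case by (intro tendsto_intros)
  qed
  then have "(\<integral>\<^sup>+x. ennreal (\<bar>u x\<bar> ^ 4) \<partial>lebesgue_on \<Omega>) =
      (\<integral>\<^sup>+x. liminf (\<lambda>n. ennreal (\<bar>\<phi> (r n) x\<bar> ^ 4)) \<partial>lebesgue_on \<Omega>)"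
    by (intro nn_integral_cong_AE) (elim eventually_mono, rule lim_imp_Liminf[OF sequentially_bot, symmetric])
  also have "\<dots> \<le> liminf (\<lambda>n. \<integral>\<^sup>+x. ennreal (\<bar>\<phi> (r n) x\<bar> ^ 4) \<partial>lebesgue_on \<Omega>)"
  proof (rule nn_integral_liminf)
    fix n
    have "\<phi> (r n) \<in> borel_measurable (lebesgue_on \<Omega>)"
      using test_function_L2[OF \<Omega> \<phi>(1)] L2_measurable by blast
    then show "(\<lambda>x. ennreal (\<bar>\<phi> (r n) x\<bar> ^ 4)) \<in> borel_measurable (lebesgue_on \<Omega>)" by measurable
  qed
  also have "\<dots> \<le> ennreal (4 * C\<^sup>2)"
    using bound by (intro Liminf_le) (auto intro!: always_eventually)
  also have "\<dots> < \<infinity>" by simp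
  finally show ?thesis
    using L2_measurable[OF uL(1)] by (intro integrableI_bounded) auto
qed

subsection \<open>The convection forms\<close>

definition L4 :: "(real ^ 'd) set \<Rightarrow> (real ^ 'd \<Rightarrow> 'b :: euclidean_space) set" where
  "L4 \<Omega> = {f. f \<in> borel_measurable (lebesgue_on \<Omega>) \<and> integrable (lebesgue_on \<Omega>) (\<lambda>x. norm (f x) ^ 4)}"

lemma H10_subset_L4:
  fixes \<Omega> :: "(real ^ 'd) set"
  assumes "CARD('d) = 2 \<or> CARD('d) = 3" "open \<Omega>"
  shows "H10 \<Omega> \<subseteq> L4 \<Omega>"
  using H10_L4[OF assms] by (auto simp: L4_def H10_def intro: L2_measurable H1_L2)

lemma H10_vec_subset_H1_vec: "H10_vec \<Omega> \<subseteq> H1_vec \<Omega>"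
  by (auto simp: H10_vec_def H10_def H1_vec_def)

lemma H10_vec_subset_L4:
  fixes \<Omega> :: "(real ^ 'd) set"
  assumes "CARD('d) = 2 \<or> CARD('d) = 3" "open \<Omega>"
  shows "H10_vec \<Omega> \<subseteq> L4 \<Omega>"
proof
  fix u :: "'d vector_field" assume u: "u \<in> H10_vec \<Omega>"
  have m: "u \<in> borel_measurable (lebesgue_on \<Omega>)"
    using u H10_vec_subset_H1_vec H1_vec_L2 L2_measurable by blast
  have "integrable (lebesgue_on \<Omega>) (\<lambda>x. norm (u x) ^ 4)"
  proof (rule Bochner_Integration.integrable_bound)
    \<comment> \<open>The factor \<open>CARD('d)\<close> comes from Cauchy-Schwarz: the square of a
      sum of d terms is at most d times the sum of their squares.\<close>
    show "integrable (lebesgue_on \<Omega>) (\<lambda>x. (\<Sum>i\<in>UNIV. \<bar>u x $ i\<bar> ^ 4) * CARD('d))"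
      using u H10_L4[OF assms]
      by (intro integrable_mult_left Bochner_Integration.integrable_sum) (auto simp: H10_vec_def)
    show "(\<lambda>x. norm (u x) ^ 4) \<in> borel_measurable (lebesgue_on \<Omega>)" using m by measurable
    have "norm (norm (u x) ^ 4) \<le> norm ((\<Sum>i\<in>UNIV. \<bar>u x $ i\<bar> ^ 4) * CARD('d))" for x
    proof -
      have "norm (u x) ^ 4 = ((norm (u x))\<^sup>2)\<^sup>2" by (simp flip: power_mult)
      also have "\<dots> = (\<Sum>i\<in>UNIV. \<bar>u x $ i\<bar>\<^sup>2)\<^sup>2"
        by (simp add: norm_vec_def L2_set_def sum_nonneg)
      also have "\<dots> \<le> (\<Sum>i\<in>UNIV. (\<bar>u x $ i\<bar>\<^sup>2)\<^sup>2) * CARD('d)"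
        by (rule sum_squared_le_sum_of_squares)
      also have "\<dots> = (\<Sum>i\<in>UNIV. \<bar>u x $ i\<bar> ^ 4) * CARD('d)" by (simp flip: power_mult)
      finally have "norm (u x) ^ 4 \<le> (\<Sum>i\<in>UNIV. \<bar>u x $ i\<bar> ^ 4) * CARD('d)" .
      moreover have "0 \<le> norm (u x) ^ 4" by simp
      ultimately show ?thesis unfolding real_norm_def by linarith
    qed
    then show "AE x in lebesgue_on \<Omega>. norm (norm (u x) ^ 4) \<le> norm ((\<Sum>i\<in>UNIV. \<bar>u x $ i\<bar> ^ 4) * CARD('d))"
      by simp
  qed
  with m show "u \<in> L4 \<Omega>" by (simp add: L4_def)
qed

text \<open>
  Abstracts from the integrands \<open>(u \<cdot> \<nabla>v) \<cdot> w\<close> of the two convection forms; the arguments are the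
  values of \<open>\<nabla>v\<close>, \<open>u\<close> and \<open>w\<close>.
\<close>

locale trilinear_density =
  fixes T :: "'f::euclidean_space \<Rightarrow> 'p::euclidean_space \<Rightarrow> 'q::euclidean_space \<Rightarrow> real"
  assumes linear: "linear (\<lambda>f. T f p q)" "linear (\<lambda>p. T f p q)" "linear (\<lambda>q. T f p q)"
    and bound: "\<bar>T f p q\<bar> \<le> norm f * norm p * norm q"
    and cont: "continuous_on UNIV (\<lambda>(f, p, q). T f p q)"
begin

text \<open>Young's inequality twice: the density is at most |f| (|p| |q|) \<le> |f|^2 + |p|^4 +
  |q|^4. The exponents are those of Hoelder's inequality, 1/2 + 1/4 + 1/4 = 1.\<close>

lemma integrable:
  assumes "f \<in> L2 \<Omega>" "p \<in> L4 \<Omega>" "q \<in> L4 \<Omega>"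
  shows "integrable (lebesgue_on \<Omega>) (\<lambda>x. T (f x) (p x) (q x))"
proof (rule Bochner_Integration.integrable_bound)
  have m: "f \<in> borel_measurable (lebesgue_on \<Omega>)" "p \<in> borel_measurable (lebesgue_on \<Omega>)"
    "q \<in> borel_measurable (lebesgue_on \<Omega>)"
    using assms by (auto simp: L4_def L2_def)
  show "integrable (lebesgue_on \<Omega>) (\<lambda>x. (norm (f x))\<^sup>2 + (norm (p x) ^ 4 + norm (q x) ^ 4))"
    using assms by (intro Bochner_Integration.integrable_add) (auto simp: L4_def L2_def)
  have "(\<lambda>x. (\<lambda>(f, p, q). T f p q) (f x, p x, q x)) \<in> borel_measurable (lebesgue_on \<Omega>)"
    using borel_measurable_continuous_onI[OF cont]
    by (rule measurable_compose[rotated]) (intro borel_measurable_Pair m)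
  then show "(\<lambda>x. T (f x) (p x) (q x)) \<in> borel_measurable (lebesgue_on \<Omega>)" by simp
  have "norm (T (f x) (p x) (q x)) \<le> norm ((norm (f x))\<^sup>2 + (norm (p x) ^ 4 + norm (q x) ^ 4))" for x
  proof -
    define a b c where "a = norm (f x)" and "b = norm (p x)" and "c = norm (q x)"
    have amgm: "s * t \<le> s\<^sup>2 + t\<^sup>2" if "s \<ge> 0" "t \<ge> 0" for s t :: real
      using sum_squares_bound[of s t] mult_nonneg_nonneg[OF that] by linarith
    have nn: "a \<ge> 0" "b \<ge> 0" "c \<ge> 0" by (auto simp: a_def b_def c_def)
    have "\<bar>T (f x) (p x) (q x)\<bar> \<le> a * (b * c)"
      using bound by (simp add: a_def b_def c_def mult.assoc)
    also have "\<dots> \<le> a\<^sup>2 + (b * c)\<^sup>2" using nn by (intro amgm) auto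
    also have "(b * c)\<^sup>2 \<le> (b\<^sup>2)\<^sup>2 + (c\<^sup>2)\<^sup>2"
      unfolding power_mult_distrib by (rule amgm) auto
    finally show ?thesis by (simp add: a_def b_def c_def flip: power_mult)
  qed
  then show "AE x in lebesgue_on \<Omega>. norm (T (f x) (p x) (q x)) \<le>
      norm ((norm (f x))\<^sup>2 + (norm (p x) ^ 4 + norm (q x) ^ 4))" by simp
qed

definition skew_form ::
  "(real ^ 'd) set \<Rightarrow> ((real ^ 'd \<Rightarrow> 'q) \<Rightarrow> real ^ 'd \<Rightarrow> 'f) \<Rightarrow>
   (real ^ 'd \<Rightarrow> 'p) \<Rightarrow> (real ^ 'd \<Rightarrow> 'q) \<Rightarrow> (real ^ 'd \<Rightarrow> 'q) \<Rightarrow> real" where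
  "skew_form \<Omega> D u v w =
    1/2 * ((LINT x|lebesgue_on \<Omega>. T (D v x) (u x) (w x)) - (LINT x|lebesgue_on \<Omega>. T (D w x) (u x) (v x)))"

lemma skew: "skew_form \<Omega> D u v w = - skew_form \<Omega> D u w v"
  by (simp add: skew_form_def right_diff_distrib)

context
  fixes \<Omega> :: "(real ^ 'd) set" and S :: "(real ^ 'd \<Rightarrow> 'q) set" and D :: "(real ^ 'd \<Rightarrow> 'q) \<Rightarrow> real ^ 'd \<Rightarrow> 'f"
  assumes D: "AE_linear_on \<Omega> S D" and S: "S \<subseteq> L4 \<Omega>"
begin

lemma int: "u \<in> L4 \<Omega> \<Longrightarrow> v \<in> S \<Longrightarrow> w \<in> S \<Longrightarrow> Bochner_Integration.integrable (lebesgue_on \<Omega>) (\<lambda>x. T (D v x) (u x) (w x))"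
  using D S by (intro integrable) (auto simp: AE_linear_on_def)

lemma skew_form_add_first:
  assumes "u \<in> L4 \<Omega>" "u' \<in> L4 \<Omega>" "v \<in> S" "w \<in> S"
  shows "skew_form \<Omega> D (u + u') v w = skew_form \<Omega> D u v w + skew_form \<Omega> D u' v w"
  using assms by (simp add: skew_form_def linear_add[OF linear(2)] int field_simps)

text \<open>The two halves differ: in the first integral v stands under D, where additivity holds
  only almost everywhere; in the second it is a plain argument of T and additivity is
  pointwise.\<close>

lemma skew_form_add_middle:
  assumes u: "u \<in> L4 \<Omega>" and v: "v \<in> S" "v' \<in> S" "v + v' \<in> S" "w \<in> S"
  shows "skew_form \<Omega> D u (v + v') w = skew_form \<Omega> D u v w + skew_form \<Omega> D u v' w"
proof -
  have "AE x in lebesgue_on \<Omega>. D (v + v') x = D v x + D v' x"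
    using D v by (auto simp: AE_linear_on_def)
  then have "AE x in lebesgue_on \<Omega>. T (D (v + v') x) (u x) (w x) = T (D v x) (u x) (w x) + T (D v' x) (u x) (w x)"
    by eventually_elim (simp add: linear_add[OF linear(1)])
  then have "(LINT x|lebesgue_on \<Omega>. T (D (v + v') x) (u x) (w x)) =
      (LINT x|lebesgue_on \<Omega>. T (D v x) (u x) (w x) + T (D v' x) (u x) (w x))"
    using u v by (intro integral_cong_AE borel_measurable_add borel_measurable_integrable int)
  then show ?thesis
    using u v by (simp add: skew_form_def linear_add[OF linear(3)] int field_simps)
qed

lemma skew_form_scaleR_middle:
  assumes u: "u \<in> L4 \<Omega>" and v: "v \<in> S" "a *\<^sub>R v \<in> S" "w \<in> S"
  shows "skew_form \<Omega> D u (a *\<^sub>R v) w = a * skew_form \<Omega> D u v w"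
proof -
  have "AE x in lebesgue_on \<Omega>. D (a *\<^sub>R v) x = a *\<^sub>R D v x"
    using D v by (auto simp: AE_linear_on_def)
  then have "AE x in lebesgue_on \<Omega>. T (D (a *\<^sub>R v) x) (u x) (w x) = a * T (D v x) (u x) (w x)"
    by eventually_elim (simp add: linear_scale[OF linear(1)])
  then have "(LINT x|lebesgue_on \<Omega>. T (D (a *\<^sub>R v) x) (u x) (w x)) =
      (LINT x|lebesgue_on \<Omega>. a * T (D v x) (u x) (w x))"
    using u v by (intro integral_cong_AE borel_measurable_times borel_measurable_const borel_measurable_integrable int)
  then show ?thesis
    using u v by (simp add: skew_form_def scaleR_fun_def linear_scale[OF linear(3)] int field_simps)
qed

end

end

section \<open>The velocity and temperature forms as instances\<close>

lemma trilinear_density_vector: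
  "trilinear_density (\<lambda>(f :: real ^ 'd ^ 'd) (p :: real ^ 'd) (q :: real ^ 'd). (f *v p) \<bullet> q)"
proof (rule trilinear_density.intro)
  show "linear (\<lambda>f :: real ^ 'd ^ 'd. (f *v p) \<bullet> q)" for p q :: "real ^ 'd"
    by (rule linearI) (simp_all add: matrix_vector_mult_add_rdistrib inner_add_left scaleR_matrix_vector_assoc[symmetric])
  show "linear (\<lambda>p. (f *v p) \<bullet> q)" for f :: "real ^ 'd ^ 'd" and q
    by (rule linearI) (simp_all add: matrix_vector_right_distrib inner_add_left matrix_vector_mult_scaleR)
  show "linear (\<lambda>q. (f *v p) \<bullet> q)" for f :: "real ^ 'd ^ 'd" and p
    by (rule linearI) (simp_all add: inner_add_right)
  show "\<bar>(f *v p) \<bullet> q\<bar> \<le> norm f * norm p * norm q" for f :: "real ^ 'd ^ 'd" and p q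
  proof -
    \<comment> \<open>The Frobenius norm dominates the operator norm, by Cauchy-Schwarz in each
      row.\<close>
    have "norm (f *v p) \<le> norm f * norm p"
    proof -
      have "(norm (f *v p))\<^sup>2 = (\<Sum>i\<in>UNIV. (f $ i \<bullet> p)\<^sup>2)"
        by (simp add: norm_vec_def L2_set_def sum_nonneg matrix_vector_mul_component)
      also have "\<dots> \<le> (\<Sum>i\<in>UNIV. (norm (f $ i))\<^sup>2 * (norm p)\<^sup>2)"
        using Cauchy_Schwarz_ineq by (intro sum_mono) (simp add: power2_norm_eq_inner)
      also have "\<dots> = (\<Sum>i\<in>UNIV. (norm (f $ i))\<^sup>2) * (norm p)\<^sup>2"
        by (simp add: sum_distrib_right)
      also have "(\<Sum>i\<in>UNIV. (norm (f $ i))\<^sup>2) = (norm f)\<^sup>2"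
        unfolding norm_vec_def[of f] L2_set_def by (simp add: sum_nonneg)
      finally show ?thesis
        unfolding power_mult_distrib[symmetric] by (rule power2_le_imp_le) simp
    qed
    then show ?thesis
      using Cauchy_Schwarz_ineq2[of "f *v p" q] by (meson mult_right_mono norm_ge_zero order_trans)
  qed
  \<comment> \<open>In coordinates the density is a polynomial, so that its joint continuity is
    immediate.\<close>
  have "(\<lambda>(f :: real ^ 'd ^ 'd, p, q). (f *v p) \<bullet> q) =
      (\<lambda>x. \<Sum>i\<in>UNIV. (\<Sum>j\<in>UNIV. fst x $ i $ j * fst (snd x) $ j) * snd (snd x) $ i)"
    by (auto simp: fun_eq_iff inner_vec_def matrix_vector_mult_def)
  moreover have "continuous_on UNIV (\<lambda>x :: (real ^ 'd ^ 'd) \<times> (real ^ 'd) \<times> (real ^ 'd).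
      \<Sum>i\<in>UNIV. (\<Sum>j\<in>UNIV. fst x $ i $ j * fst (snd x) $ j) * snd (snd x) $ i)"
    by (intro continuous_intros)
  ultimately show "continuous_on UNIV (\<lambda>(f :: real ^ 'd ^ 'd, p, q). (f *v p) \<bullet> q)"
    by (simp only:)
qed

lemma trilinear_density_scalar:
  "trilinear_density (\<lambda>(f :: real ^ 'd) (p :: real ^ 'd) (q :: real). (p \<bullet> f) * q)"
proof (rule trilinear_density.intro)
  show "linear (\<lambda>f. (p \<bullet> f) * q)" for p :: "real ^ 'd" and q
    by (rule linearI) (simp_all add: inner_add_right algebra_simps)
  show "linear (\<lambda>p. (p \<bullet> f) * q)" for f :: "real ^ 'd" and q
    by (rule linearI) (simp_all add: inner_add_left algebra_simps)
  show "linear (\<lambda>q. (p \<bullet> f) * q)" for f p :: "real ^ 'd"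
    by (rule linearI) (simp_all add: algebra_simps)
  show "\<bar>(p \<bullet> f) * q\<bar> \<le> norm f * norm p * norm q" for f p :: "real ^ 'd" and q :: real
    using Cauchy_Schwarz_ineq2[of p f] by (simp add: abs_mult mult_right_mono mult.commute[of "norm f"])
  show "continuous_on UNIV (\<lambda>(f :: real ^ 'd, p, q). (p \<bullet> f) * q)"
    unfolding case_prod_beta by (intro continuous_intros)
qed

interpretation vector_density: trilinear_density "\<lambda>(f :: real ^ 'd ^ 'd) (p :: real ^ 'd) (q :: real ^ 'd). (f *v p) \<bullet> q"
  by (rule trilinear_density_vector)

interpretation scalar_density: trilinear_density "\<lambda>(f :: real ^ 'd) (p :: real ^ 'd) (q :: real). (p \<bullet> f) * q"
  by (rule trilinear_density_scalar)

lemma b_form_eq: "b_form \<Omega> u v w = vector_density.skew_form \<Omega> (weak_grad_vec \<Omega>) u v w"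
  by (simp add: b_form_def vector_density.skew_form_def L2_inner_def)

lemma b_star_eq: "b_star \<Omega> v \<phi> \<psi> = scalar_density.skew_form \<Omega> (weak_grad \<Omega>) v \<phi> \<psi>"
  by (simp add: b_star_def scalar_density.skew_form_def L2_inner_def)

subsection \<open>Finite-dimensional variational problems\<close>

definition linear_functional_on :: "'v::real_vector set \<Rightarrow> ('v \<Rightarrow> real) \<Rightarrow> bool" where
  "linear_functional_on V l \<longleftrightarrow>
    (\<forall>x\<in>V. \<forall>y\<in>V. l (x + y) = l x + l y) \<and> (\<forall>c. \<forall>x\<in>V. l (c *\<^sub>R x) = c * l x)"

lemma linear_functional_on_subset:
  "linear_functional_on V l \<Longrightarrow> U \<subseteq> V \<Longrightarrow> linear_functional_on U l"
  unfolding linear_functional_on_def by blast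

lemma linear_functional_on_add:
  "linear_functional_on V l \<Longrightarrow> linear_functional_on V l' \<Longrightarrow> linear_functional_on V (\<lambda>x. l x + l' x)"
  by (auto simp: linear_functional_on_def algebra_simps)

lemma linear_functional_on_cmult:
  "linear_functional_on V l \<Longrightarrow> linear_functional_on V (\<lambda>x. c * l x)"
  by (auto simp: linear_functional_on_def algebra_simps)

text \<open>
  The bilinear form may be degenerate, as functions that agree almost everywhere are distinct
  vectors; then the right-hand side has to vanish on the null vectors. The new basis vector is first made
  orthogonal to the old ones.
\<close>

lemma finite_dim_variational_solution:
  fixes a :: "'v::real_vector \<Rightarrow> 'v \<Rightarrow> real"
  assumes "finite B"
    and "\<And>x. x \<in> span B \<Longrightarrow> linear_functional_on (span B) (a x)"
    and "\<And>y. y \<in> span B \<Longrightarrow> linear_functional_on (span B) (\<lambda>x. a x y)"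
    and "\<And>x y. x \<in> span B \<Longrightarrow> y \<in> span B \<Longrightarrow> a x x = 0 \<Longrightarrow> a y x = 0"
    and "linear_functional_on (span B) l"
    and "\<And>x. x \<in> span B \<Longrightarrow> a x x = 0 \<Longrightarrow> l x = 0"
  shows "\<exists>x\<in>span B. \<forall>y\<in>span B. a x y = l y"
  using assms
proof (induction B arbitrary: l rule: finite_induct)
  case empty
  have "a 0 0 = 0"
    using empty(1)[of 0] by (auto simp: linear_functional_on_def dest: spec[of _ 0])
  then show ?case using empty(5)[of 0] by auto
next
  case (insert b B)
  let ?V = "span (insert b B)"
  have sub: "span B \<subseteq> ?V" by (rule span_mono) auto
  have b: "b \<in> ?V" by (simp add: span_base)
  have lin1: "linear_functional_on ?V (a x)" if "x \<in> ?V" for x using insert.prems(1) that .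
  have lin2: "linear_functional_on ?V (\<lambda>x. a x y)" if "y \<in> ?V" for y using insert.prems(2) that .
  have IH: "\<exists>x\<in>span B. \<forall>y\<in>span B. a x y = k y"
    if "linear_functional_on ?V k" "\<And>x. x \<in> ?V \<Longrightarrow> a x x = 0 \<Longrightarrow> k x = 0" for k
  proof (rule insert.IH)
    show "linear_functional_on (span B) (a x)" if "x \<in> span B" for x
      using lin1 that sub linear_functional_on_subset by blast
    show "linear_functional_on (span B) (\<lambda>x. a x y)" if "y \<in> span B" for y
      using lin2 that sub linear_functional_on_subset by blast
    show "linear_functional_on (span B) k"
      using that(1) sub by (rule linear_functional_on_subset)
  qed (use insert.prems(3) that(2) sub in blast)+
  obtain w where w: "w \<in> span B" "\<And>y. y \<in> span B \<Longrightarrow> a w y = l y"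
    using IH[OF insert.prems(4,5)] by blast
  obtain c where c: "c \<in> span B" "\<And>y. y \<in> span B \<Longrightarrow> a c y = a b y"
    using IH[OF lin1[OF b]] insert.prems(3) b by blast
  \<comment> \<open>As \<open>a\<close> need not be symmetric, orthogonality is meant with
    \<open>e\<close> in the first argument: adding a multiple of \<open>e\<close> to
    \<open>w\<close> then preserves the equations for all y in \<open>span B\<close>.\<close>
  define e where "e = b + (-1) *\<^sub>R c"
  have wV: "w \<in> ?V" and cV: "c \<in> ?V" using w c sub by auto
  then have eV: "e \<in> ?V" unfolding e_def using b by (intro span_add span_scale)
  have e0: "a e y = 0" if "y \<in> span B" for y
  proof -
    have y: "y \<in> ?V" using that sub by auto
    have "a e y = a b y + (-1) * a c y"
      unfolding e_def using lin2[OF y] b cV span_scale[OF cV]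
      by (simp add: linear_functional_on_def del: scaleR_minus_left scaleR_minus1_left)
    then show ?thesis using c(2)[OF that] by simp
  qed
  \<comment> \<open>Chosen to solve the one remaining equation \<open>a x e = l e\<close>. If
    \<open>a e e = 0\<close>, the hypotheses on null vectors make both \<open>a w e\<close> and
    \<open>l e\<close> vanish, and any t would do.\<close>
  define t where "t = (if a e e = 0 then 0 else (l e - a w e) / a e e)"
  define x where "x = w + t *\<^sub>R e"
  have xV: "x \<in> ?V" unfolding x_def using wV eV by (intro span_add span_scale)
  have ax: "a x y = a w y + t * a e y" if "y \<in> ?V" for y
    unfolding x_def using lin2[OF that] wV eV span_scale[OF eV] by (simp add: linear_functional_on_def)
  have xe: "a x e = l e"
    using ax[OF eV] insert.prems(3)[OF eV wV] insert.prems(5)[OF eV] by (auto simp: t_def)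
  have xB: "a x y = l y" if "y \<in> span B" for y
    using ax[of y] that sub w(2) e0 by auto
  have "a x y = l y" if y: "y \<in> ?V" for y
  proof -
    \<comment> \<open>The vector is re-expanded with \<open>e\<close> in place of \<open>b\<close>,
      so that the equations for \<open>span B\<close> and for \<open>e\<close> suffice.\<close>
    obtain k where k: "y - k *\<^sub>R b \<in> span B" using y span_breakdown_eq by blast
    define z where "z = (y - k *\<^sub>R b) + k *\<^sub>R c"
    have z: "z \<in> span B" unfolding z_def using k c(1) by (intro span_add span_scale)
    have zV: "z \<in> ?V" using z sub by auto
    have y_eq: "y = z + k *\<^sub>R e" by (simp add: z_def e_def algebra_simps)
    have *: "h y = h z + k * h e" if "linear_functional_on ?V h" for h
      unfolding y_eq using that zV eV span_scale[OF eV] by (simp add: linear_functional_on_def)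
    show ?thesis using *[OF lin1[OF xV]] *[OF insert.prems(4)] xB[OF z] xe by simp
  qed
  then show ?case using xV by blast
qed

text \<open>For \<open>Vh\<close>, which is cut out of \<open>Xh\<close> by the divergence
  constraint and so comes without a spanning set. A maximal independent subset is finite because
  independent sets in \<open>span B\<close> are no larger than B.\<close>

lemma subspace_of_finite_span:
  fixes V :: "'v::real_vector set"
  assumes "subspace V" "finite B" "V \<subseteq> span B"
  shows "\<exists>B'. finite B' \<and> V = span B'"
proof -
  obtain B' where B': "B' \<subseteq> V" "independent B'" "V \<subseteq> span B'"
    using maximal_independent_subset[of V] by blast
  then have "finite B'"
    using independent_span_bound[OF assms(2) B'(2)] assms(3) by auto
  moreover have "span B' \<subseteq> V" using B'(1) assms(1) by (rule span_minimal)
  ultimately show ?thesis using B'(3) by blast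
qed

lemma AE_linear_on_subset: "AE_linear_on \<Omega> S D \<Longrightarrow> U \<subseteq> S \<Longrightarrow> AE_linear_on \<Omega> U D"
  unfolding AE_linear_on_def by blast

lemma linear_functional_on_L2_inner:
  assumes "AE_linear_on \<Omega> S D" "subspace S" "h \<in> L2 \<Omega>"
  shows "linear_functional_on S (\<lambda>u. L2_inner \<Omega> (D u) h)"
  using assms AE_linear_on_inner_add[OF assms(1)] AE_linear_on_inner_scaleR[OF assms(1)]
  by (simp add: linear_functional_on_def subspace_add subspace_scale)

lemma L2_norm_AE_linear_scaleR:
  assumes D: "AE_linear_on \<Omega> S D" and S: "subspace S" and u: "u \<in> S"
  shows "L2_norm \<Omega> (D (a *\<^sub>R u)) = \<bar>a\<bar> * L2_norm \<Omega> (D u)"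
proof -
  have au: "a *\<^sub>R u \<in> S" using S u by (rule subspace_scale)
  have L: "D u \<in> L2 \<Omega>" "D (a *\<^sub>R u) \<in> L2 \<Omega>" using D u au by (auto simp: AE_linear_on_def)
  have "L2_inner \<Omega> (D (a *\<^sub>R u)) (D (a *\<^sub>R u)) = a * (a * L2_inner \<Omega> (D u) (D u))"
    using AE_linear_on_inner_scaleR[OF D u au L(1)] AE_linear_on_inner_scaleR[OF D u au L(2)]
    by (simp add: L2_inner_commute[of _ "D u" "D (a *\<^sub>R u)"])
  then show ?thesis
    by (simp add: L2_norm_def real_sqrt_mult flip: power2_eq_square mult.assoc)
qed

lemma L2_norm_AE_linear_triangle:
  assumes D: "AE_linear_on \<Omega> S D" and S: "subspace S" and u: "u \<in> S" "v \<in> S"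
  shows "L2_norm \<Omega> (D (u - v)) \<le> L2_norm \<Omega> (D u) + L2_norm \<Omega> (D v)"
proof -
  define w where "w = (-1) *\<^sub>R v"
  have w: "w \<in> S" unfolding w_def using S u(2) by (rule subspace_scale)
  have uw: "u + w \<in> S" using S u(1) w by (rule subspace_add)
  have L: "D u \<in> L2 \<Omega>" "D w \<in> L2 \<Omega>" "D (u + w) \<in> L2 \<Omega>" using D u w uw by (auto simp: AE_linear_on_def)
  have ae: "AE x in lebesgue_on \<Omega>. D (u + w) x = (D u + D w) x"
    using D u w by (auto simp: AE_linear_on_def)
  have "L2_norm \<Omega> (D (u + w)) = L2_norm \<Omega> (D u + D w)"
    using L(3) L2_add[OF L(1,2)] ae by (rule L2_norm_cong_AE)
  also have "\<dots> \<le> L2_norm \<Omega> (D u) + L2_norm \<Omega> (D w)" using L(1,2) by (rule L2_norm_add_le)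
  also have "L2_norm \<Omega> (D w) = L2_norm \<Omega> (D v)"
    unfolding w_def using L2_norm_AE_linear_scaleR[OF D S u(2), of "-1"] by simp
  finally show ?thesis by (simp add: w_def)
qed

text \<open>Scaling v to unit length reduces the estimate to the supremum. Where N vanishes no
  scaling is possible, and the continuity constant of f forces \<open>f v = 0\<close>.\<close>

lemma dual_norm_bound:
  fixes S :: "'v::real_vector set"
  assumes f: "f \<in> dual_space S N" and v: "v \<in> S" "\<And>a. a *\<^sub>R v \<in> S"
    and N: "\<And>a. N (a *\<^sub>R v) = \<bar>a\<bar> * N v" "\<And>w. N w \<ge> 0"
  shows "\<bar>f v\<bar> \<le> dual_norm S N f * N v" and "dual_norm S N f \<ge> 0"
proof -
  obtain C where C: "\<And>v. v \<in> S \<Longrightarrow> \<bar>f v\<bar> \<le> C * N v"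
    using f unfolding dual_space_def by blast
  \<comment> \<open>Shows that the set under \<open>SUP\<close> is bounded, without which a real
    supremum need not dominate its elements.\<close>
  have f_le: "\<bar>f w\<bar> \<le> \<bar>C\<bar>" if "w \<in> S" "N w \<le> 1" for w
  proof -
    have "C * N w \<le> \<bar>C\<bar> * N w" using N(2) by (intro mult_right_mono) auto
    also have "\<dots> \<le> \<bar>C\<bar> * 1" using that(2) by (intro mult_left_mono) auto
    finally show ?thesis using C[OF that(1)] by simp
  qed
  have upper: "\<bar>f w\<bar> \<le> dual_norm S N f" if "w \<in> S" "N w \<le> 1" for w
    unfolding dual_norm_def using that f_le by (intro cSUP_upper bdd_aboveI2[where M = "\<bar>C\<bar>"]) auto
  have hom: "f (a *\<^sub>R v) = a * f v" for a
    using f v(1) by (auto simp: dual_space_def)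
  show "dual_norm S N f \<ge> 0"
    using upper[of "0 *\<^sub>R v"] v(2)[of 0] N(1)[of 0] by simp
  show "\<bar>f v\<bar> \<le> dual_norm S N f * N v"
  proof (cases "N v = 0")
    case True
    then show ?thesis using C[OF v(1)] by simp
  next
    case False
    then have "N v > 0" using N(2)[of v] by simp
    then show ?thesis
      using upper[OF v(2), of "inverse (N v)"] N(1)[of "inverse (N v)"]
      by (simp add: hom abs_mult field_simps)
  qed
qed

text \<open>
  The two equations of the iteration have the same form: a skew-symmetric convection term \<open>c\<close> and a
  diffusion term given by the energy \<open>(Du, Dv)\<close>.
\<close>

locale energy_space =
  fixes \<Omega> :: "(real ^ 'd) set" and V :: "'v::real_vector set" and D :: "'v \<Rightarrow> real ^ 'd \<Rightarrow> 'b::euclidean_space"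
  assumes D: "AE_linear_on \<Omega> V D" and fin: "\<exists>B. finite B \<and> V = span B"
begin

abbreviation N :: "'v \<Rightarrow> real" where "N v \<equiv> L2_norm \<Omega> (D v)"

lemma subspace_V: "subspace V"
  using fin by auto

lemma D_L2: "v \<in> V \<Longrightarrow> D v \<in> L2 \<Omega>"
  using D by (auto simp: AE_linear_on_def)

text \<open>Bounds on the convection forms are assumed from one side only; applying them to -v gives
  the other side.\<close>

lemma abs_le_of_le:
  assumes "linear_functional_on V l" "\<And>v. v \<in> V \<Longrightarrow> l v \<le> L * N v" "v \<in> V"
  shows "\<bar>l v\<bar> \<le> L * N v"
proof -
  have "(-1) *\<^sub>R v \<in> V" using subspace_V assms(3) by (rule subspace_scale)
  moreover have "l ((-1) *\<^sub>R v) = (-1) * l v"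
    using assms(1,3) unfolding linear_functional_on_def by blast
  ultimately show ?thesis
    using assms(2)[of "(-1) *\<^sub>R v"] assms(2)[OF assms(3)]
      L2_norm_AE_linear_scaleR[OF D subspace_V assms(3), of "-1"] by auto
qed

text \<open>Serves equations tested with the solution itself or with a difference of solutions: the
  convection term c drops out and one factor \<open>N e\<close> is cancelled. Both the a priori
  bounds and the contraction estimate come from it. The sign of L settles the case
  \<open>N e = 0\<close>.\<close>

lemma energy_bound:
  assumes \<mu>: "\<mu> > 0" and e: "e \<in> V" and c: "c = 0"
    and eq: "c + \<mu> * L2_inner \<Omega> (D e) (D e) = l" and l: "l \<le> L * N e" and L: "L \<ge> 0"
  shows "\<mu> * N e \<le> L"
proof (cases "N e = 0")
  case False
  then have "N e > 0" using L2_norm_nonneg[of \<Omega> "D e"] by simp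
  moreover have "\<mu> * N e * N e \<le> L * N e"
    using eq c l by (simp add: power2_eq_square mult.assoc flip: L2_norm_square)
  ultimately show ?thesis by simp
qed (use L in simp)

text \<open>Skew symmetry removes \<open>c\<close> from the diagonal, so the null vectors of the
  whole form are those of zero energy. The bounds on \<open>c\<close> and \<open>l\<close> make both
  vanish there, as solvability of a degenerate problem demands.\<close>

lemma exists_solution:
  assumes \<mu>: "\<mu> > 0"
    and c: "\<And>v. v \<in> V \<Longrightarrow> linear_functional_on V (\<lambda>u. c u v)"
      "\<And>u v. u \<in> V \<Longrightarrow> v \<in> V \<Longrightarrow> c u v = - c v u"
      "\<And>u v. u \<in> V \<Longrightarrow> v \<in> V \<Longrightarrow> c u v \<le> m * N u * N v"
    and l: "linear_functional_on V l" "\<And>v. v \<in> V \<Longrightarrow> \<bar>l v\<bar> \<le> L * N v"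
  shows "\<exists>u\<in>V. \<forall>v\<in>V. c u v + \<mu> * L2_inner \<Omega> (D u) (D v) = l v"
proof -
  obtain B where B: "finite B" "V = span B" using fin by blast
  have c_lin: "linear_functional_on V (c u)" if "u \<in> V" for u
  proof -
    have eq: "c u v = (-1) * c v u" if "v \<in> V" for v
      using c(2)[OF \<open>u \<in> V\<close> that] by simp
    have "linear_functional_on V (\<lambda>v. (-1) * c v u)"
      using c(1)[OF that] by (rule linear_functional_on_cmult)
    then show ?thesis
      using eq subspace_add[OF subspace_V] subspace_scale[OF subspace_V]
      by (simp add: linear_functional_on_def)
  qed
  have inner_lin: "linear_functional_on V (\<lambda>u. L2_inner \<Omega> (D u) (D v))" if "v \<in> V" for v
    by (rule linear_functional_on_L2_inner[OF D subspace_V D_L2[OF that]])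
  define a where "a u v = c u v + \<mu> * L2_inner \<Omega> (D u) (D v)" for u v
  have null: "N u = 0" if "u \<in> V" "a u u = 0" for u
    using that c(2)[OF that(1,1)] \<mu> by (simp add: a_def flip: L2_norm_square)
  have "\<exists>u\<in>span B. \<forall>v\<in>span B. a u v = l v"
  proof (rule finite_dim_variational_solution[OF B(1)]; unfold B(2)[symmetric])
    show "linear_functional_on V (a u)" if "u \<in> V" for u
      unfolding a_def using c_lin[OF that] inner_lin[OF that]
      by (intro linear_functional_on_add linear_functional_on_cmult) (simp_all add: L2_inner_commute[of _ "D u"])
    show "linear_functional_on V (\<lambda>u. a u v)" if "v \<in> V" for v
      unfolding a_def using c(1)[OF that] inner_lin[OF that]
      by (intro linear_functional_on_add linear_functional_on_cmult)
    show "a v u = 0" if "u \<in> V" "v \<in> V" "a u u = 0" for u v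
    proof -
      have "\<bar>c v u\<bar> \<le> m * N v * N u"
        using abs_le_of_le[OF c_lin[OF that(2)] c(3)[OF that(2)] that(1)] .
      moreover have "\<bar>L2_inner \<Omega> (D v) (D u)\<bar> \<le> N v * N u"
        using L2_Cauchy_Schwarz D_L2 that by blast
      ultimately show ?thesis using null[OF that(1,3)] by (simp add: a_def)
    qed
    show "l u = 0" if "u \<in> V" "a u u = 0" for u
      using l(2)[OF that(1)] null[OF that] by simp
  qed (rule l(1))
  then show ?thesis by (simp add: a_def B(2))
qed

end

section \<open>The divergence constraint and the buoyancy term\<close>

lemma AE_linear_on_weak_div:
  fixes \<Omega> :: "(real ^ 'd) set"
  assumes "open \<Omega>"
  shows "AE_linear_on \<Omega> (H1_vec \<Omega>) (weak_div \<Omega>)"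
  unfolding AE_linear_on_def
proof (intro conjI ballI allI)
  note lin = AE_linear_on_weak_grad_vec[OF assms, unfolded AE_linear_on_def]
  fix u v :: "'d vector_field" and a assume u: "u \<in> H1_vec \<Omega>" and v: "v \<in> H1_vec \<Omega>"
  have "AE x in lebesgue_on \<Omega>. weak_grad_vec \<Omega> (u + v) x = weak_grad_vec \<Omega> u x + weak_grad_vec \<Omega> v x"
    using lin u v by blast
  then show "AE x in lebesgue_on \<Omega>. weak_div \<Omega> (u + v) x = weak_div \<Omega> u x + weak_div \<Omega> v x"
    by eventually_elim (simp add: weak_div_def sum.distrib)
  have "AE x in lebesgue_on \<Omega>. weak_grad_vec \<Omega> (a *\<^sub>R u) x = a *\<^sub>R weak_grad_vec \<Omega> u x"
    using lin u by blast
  then show "AE x in lebesgue_on \<Omega>. weak_div \<Omega> (a *\<^sub>R u) x = a *\<^sub>R weak_div \<Omega> u x"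
    by eventually_elim (simp add: weak_div_def sum_distrib_left)
  have L: "(\<lambda>x. weak_grad_vec \<Omega> u x $ i $ i) \<in> L2 \<Omega>" for i
    using lin u by (intro L2_nth[of "\<lambda>x. weak_grad_vec \<Omega> u x $ i"] L2_nth) blast
  have "(\<Sum>i\<in>UNIV. (\<lambda>x. weak_grad_vec \<Omega> u x $ i $ i)) \<in> L2 \<Omega>"
    using L by (intro L2_sum) auto
  moreover have "sum h I x = (\<Sum>i\<in>I. h i x)" for h :: "'d \<Rightarrow> 'd scalar_field" and I x
    by (induction I rule: infinite_finite_induct) auto
  then have "(\<Sum>i\<in>UNIV. (\<lambda>x. weak_grad_vec \<Omega> u x $ i $ i)) = weak_div \<Omega> u"
    by (simp add: weak_div_def fun_eq_iff)
  ultimately show "weak_div \<Omega> u \<in> L2 \<Omega>" by simp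
qed

lemma subspace_discretely_div_free:
  fixes \<Omega> :: "(real ^ 'd) set"
  assumes "open \<Omega>" "subspace Xh" "Xh \<subseteq> H1_vec \<Omega>" "Qh \<subseteq> L2 \<Omega>"
  shows "subspace (discretely_div_free \<Omega> Xh Qh)"
proof -
  have div: "AE_linear_on \<Omega> Xh (weak_div \<Omega>)"
    using AE_linear_on_weak_div[OF assms(1)] assms(3) by (rule AE_linear_on_subset)
  have lin: "linear_functional_on Xh (\<lambda>v. L2_inner \<Omega> (weak_div \<Omega> v) q)" if "q \<in> Qh" for q
    using div assms(2,4) that by (intro linear_functional_on_L2_inner) auto
  have "L2_inner \<Omega> (weak_div \<Omega> 0) q = 0" if "q \<in> Qh" for q
    using lin[OF that] subspace_0[OF assms(2)] unfolding linear_functional_on_def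
    by (metis mult_zero_left scaleR_zero_left)
  then show ?thesis
    using lin assms(2) unfolding subspace_def discretely_div_free_def linear_functional_on_def by auto
qed

lemma L2_last_component:
  fixes \<theta> :: "'d::{finite,linorder} scalar_field"
  assumes "\<theta> \<in> L2 \<Omega>"
  shows "last_component \<theta> \<in> L2 \<Omega>"
proof (rule L2_vec)
  fix i :: 'd
  have "(\<lambda>x. last_component \<theta> x $ i) = (if i = Max UNIV then 1 else 0) *\<^sub>R \<theta>"
    by (auto simp: last_component_def axis_def scaleR_fun_def)
  then show "(\<lambda>x. last_component \<theta> x $ i) \<in> L2 \<Omega>" using assms by (simp only: L2_scaleR)
qed

lemma L2_norm_last_component: "L2_norm \<Omega> (last_component \<theta>) = L2_norm \<Omega> \<theta>"
  by (simp add: L2_norm_def L2_inner_def last_component_def inner_axis_axis)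

lemma last_component_add: "last_component (\<theta> + \<theta>') = last_component \<theta> + last_component \<theta>'"
  by (auto simp: last_component_def fun_eq_iff axis_def vec_eq_iff)

subsection \<open>The Picard operator\<close>

text \<open>The arithmetic of the contraction: d, e and \<epsilon> stand for gradient norms of
  differences, and r for the buoyancy constant \<open>Ri * C\<^sub>P\<^sup>2\<close>. The term with
  t only enlarges the right-hand side, completing it to a \<open>B_norm\<close>.\<close>

lemma contraction_estimate:
  fixes \<nu> \<kappa> :: real
  assumes pos: "\<nu> > 0" "\<kappa> > 0" "\<eta> = min \<nu> \<kappa>" "M > 0" and nn: "d \<ge> 0" "e \<ge> 0" "\<epsilon> \<ge> 0"
    and e: "\<nu> * e \<le> r * \<epsilon> + M * d * K\<^sub>1" and \<epsilon>: "\<kappa> * \<epsilon> \<le> M * d * K\<^sub>2" and r: "r \<le> \<eta>"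
    and C: "C = \<nu> powr (-1/2) * \<eta> powr (-1/2) * M * sqrt (2 * K\<^sub>1\<^sup>2 + 3 * K\<^sub>2\<^sup>2)"
  shows "sqrt (\<nu> * e\<^sup>2 + \<kappa> * \<epsilon>\<^sup>2) \<le> C * sqrt (\<nu> * d\<^sup>2 + \<kappa> * t\<^sup>2)"
proof -
  have \<eta>: "\<eta> > 0" "\<eta> \<le> \<nu>" "\<eta> \<le> \<kappa>" using pos by auto
  have root: "x powr (-1/2) = inverse (sqrt x)" if "x > 0" for x :: real
    using that by (simp add: powr_minus powr_half_sqrt minus_divide_left[symmetric] del: minus_divide_left)
  define Q where "Q = 2 * K\<^sub>1\<^sup>2 + 3 * K\<^sub>2\<^sup>2"
  have Q: "Q \<ge> 0" by (simp add: Q_def)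
  have C_nonneg: "C \<ge> 0" using pos Q by (simp add: C Q_def)
  have "C\<^sup>2 = inverse \<nu> * inverse \<eta> * (M\<^sup>2 * Q)"
    unfolding C root[OF pos(1)] root[OF \<eta>(1)] using pos(1) \<eta>(1) Q
    by (simp add: Q_def power_mult_distrib power_inverse)
  then have C2: "\<eta> * \<nu> * C\<^sup>2 = M\<^sup>2 * Q"
    using pos(1) \<eta>(1) by (simp add: field_simps)
  have "r * \<epsilon> \<le> \<kappa> * \<epsilon>" using r \<eta> nn by (intro mult_right_mono) auto
  then have e': "\<nu> * e \<le> M * d * (K\<^sub>1 + K\<^sub>2)" using e \<epsilon> by (simp add: algebra_simps)
  \<comment> \<open>The factor \<eta> \<le> \<nu> makes a full square out of the weighted one, to
    which the linear bound applies.\<close>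
  have "\<eta> * (\<nu> * e\<^sup>2) \<le> \<nu> * (\<nu> * e\<^sup>2)" using \<eta> pos by (intro mult_right_mono) auto
  also have "\<dots> = (\<nu> * e)\<^sup>2" by (simp add: power2_eq_square)
  also have "\<dots> \<le> (M * d * (K\<^sub>1 + K\<^sub>2))\<^sup>2" using e' pos nn by (intro power_mono) auto
  finally have 1: "\<eta> * (\<nu> * e\<^sup>2) \<le> (M * d)\<^sup>2 * (K\<^sub>1 + K\<^sub>2)\<^sup>2" by (simp add: power_mult_distrib)
  have "\<eta> * (\<kappa> * \<epsilon>\<^sup>2) \<le> \<kappa> * (\<kappa> * \<epsilon>\<^sup>2)" using \<eta> pos by (intro mult_right_mono) auto
  also have "\<dots> = (\<kappa> * \<epsilon>)\<^sup>2" by (simp add: power2_eq_square)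
  also have "\<dots> \<le> (M * d * K\<^sub>2)\<^sup>2" using \<epsilon> pos nn by (intro power_mono) auto
  finally have 2: "\<eta> * (\<kappa> * \<epsilon>\<^sup>2) \<le> (M * d)\<^sup>2 * K\<^sub>2\<^sup>2" by (simp add: power_mult_distrib)
  \<comment> \<open>The mixed term is split by \<open>2 * K\<^sub>1 * K\<^sub>2 \<le>
    K\<^sub>1\<^sup>2 + K\<^sub>2\<^sup>2\<close>; this is the origin of the coefficients 2 and
    3.\<close>
  have "(K\<^sub>1 + K\<^sub>2)\<^sup>2 + K\<^sub>2\<^sup>2 \<le> Q"
    using sum_squares_bound[of K\<^sub>1 K\<^sub>2] by (simp add: Q_def power2_sum)
  then have "(M * d)\<^sup>2 * ((K\<^sub>1 + K\<^sub>2)\<^sup>2 + K\<^sub>2\<^sup>2) \<le> (M * d)\<^sup>2 * Q" by (intro mult_left_mono) auto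
  moreover have "(M * d)\<^sup>2 * Q = \<eta> * (C\<^sup>2 * (\<nu> * d\<^sup>2))"
    using C2 by (simp add: power_mult_distrib mult_ac)
  ultimately have "\<eta> * (\<nu> * e\<^sup>2 + \<kappa> * \<epsilon>\<^sup>2) \<le> \<eta> * (C\<^sup>2 * (\<nu> * d\<^sup>2))"
    using 1 2 unfolding distrib_left by linarith
  then have "\<nu> * e\<^sup>2 + \<kappa> * \<epsilon>\<^sup>2 \<le> C\<^sup>2 * (\<nu> * d\<^sup>2)" using \<eta> by simp
  also have "\<dots> \<le> C\<^sup>2 * (\<nu> * d\<^sup>2 + \<kappa> * t\<^sup>2)" using pos by (intro mult_left_mono) auto
  finally have "sqrt (\<nu> * e\<^sup>2 + \<kappa> * \<epsilon>\<^sup>2) \<le> sqrt (C\<^sup>2 * (\<nu> * d\<^sup>2 + \<kappa> * t\<^sup>2))" by (rule real_sqrt_le_mono)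
  then show ?thesis using C_nonneg by (simp add: real_sqrt_mult)
qed

text \<open>The weighted norm is the Euclidean norm of (sqrt \<nu> a, sqrt \<kappa> b). The
  hypotheses are inequalities so that the triangle inequalities of the two gradient norms can be
  inserted.\<close>

lemma weighted_norm_triangle:
  fixes \<nu> \<kappa> :: real
  assumes "\<nu> > 0" "\<kappa> > 0" "0 \<le> x" "0 \<le> y" "x \<le> a + c" "y \<le> b + d"
  shows "sqrt (\<nu> * x\<^sup>2 + \<kappa> * y\<^sup>2) \<le> sqrt (\<nu> * a\<^sup>2 + \<kappa> * b\<^sup>2) + sqrt (\<nu> * c\<^sup>2 + \<kappa> * d\<^sup>2)"
proof -
  have eq: "\<nu> * s\<^sup>2 + \<kappa> * t\<^sup>2 = (sqrt \<nu> * s)\<^sup>2 + (sqrt \<kappa> * t)\<^sup>2" for s t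
    using assms(1,2) by (simp add: power_mult_distrib)
  have "\<nu> * x\<^sup>2 + \<kappa> * y\<^sup>2 \<le> \<nu> * (a + c)\<^sup>2 + \<kappa> * (b + d)\<^sup>2"
    using assms by (intro add_mono mult_left_mono power_mono) auto
  also have "\<dots> = (sqrt \<nu> * a + sqrt \<nu> * c)\<^sup>2 + (sqrt \<kappa> * b + sqrt \<kappa> * d)\<^sup>2"
    by (simp add: eq distrib_left)
  finally have "sqrt (\<nu> * x\<^sup>2 + \<kappa> * y\<^sup>2) \<le> sqrt ((sqrt \<nu> * a + sqrt \<nu> * c)\<^sup>2 + (sqrt \<kappa> * b + sqrt \<kappa> * d)\<^sup>2)"
    by (rule real_sqrt_le_mono)
  also have "\<dots> \<le> sqrt ((sqrt \<nu> * a)\<^sup>2 + (sqrt \<kappa> * b)\<^sup>2) + sqrt ((sqrt \<nu> * c)\<^sup>2 + (sqrt \<kappa> * d)\<^sup>2)"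
    by (rule real_sqrt_sum_squares_triangle_ineq)
  finally show ?thesis by (simp add: eq)
qed

lemma G_op_solves:
  assumes "\<exists>U \<Theta>. solves_Picard \<Omega> \<nu> \<kappa> Ri f \<gamma> Vh Wh u U \<Theta>" "G_op \<Omega> \<nu> \<kappa> Ri f \<gamma> Vh Wh (u, \<theta>) = (U, \<Theta>)"
  shows "solves_Picard \<Omega> \<nu> \<kappa> Ri f \<gamma> Vh Wh u U \<Theta>"
proof -
  have "\<exists>p. case p of (U, \<Theta>) \<Rightarrow> solves_Picard \<Omega> \<nu> \<kappa> Ri f \<gamma> Vh Wh u U \<Theta>" using assms(1) by auto
  from someI_ex[OF this] show ?thesis using assms(2) by (simp add: G_op_def)
qed

theorem lemma3p7:
  fixes \<Omega> :: "(real ^ 'd :: {finite, linorder}) set"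
    and \<nu> \<kappa> Ri C\<^sub>P M \<eta> K\<^sub>1 K\<^sub>2 C\<^sub>G nf n\<gamma> :: real
    and f :: "'d vector_field \<Rightarrow> real"
    and \<gamma> :: "'d scalar_field \<Rightarrow> real"
    and Xh Vh :: "'d vector_field set"
    and Qh Wh :: "'d scalar_field set"
  assumes dim: "CARD('d) = 2 \<or> CARD('d) = 3"
    and domain: "admissible_domain \<Omega>"
    and params: "\<nu> > 0" "\<kappa> > 0" "Ri > 0"
    and eta: "\<eta> = min \<nu> \<kappa>"
    and poincare: "C\<^sub>P > 0"
      "\<And>v. v \<in> H10_vec \<Omega> \<Longrightarrow> L2_norm \<Omega> v \<le> C\<^sub>P * grad_norm_vec \<Omega> v"
      "\<And>w. w \<in> H10 \<Omega> \<Longrightarrow> L2_norm \<Omega> w \<le> C\<^sub>P * grad_norm \<Omega> w"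
    and M_bound: "M > 0"
      "\<And>u v w. u \<in> H10_vec \<Omega> \<Longrightarrow> v \<in> H10_vec \<Omega> \<Longrightarrow> w \<in> H10_vec \<Omega> \<Longrightarrow>
         b_form \<Omega> u v w \<le> M * grad_norm_vec \<Omega> u * grad_norm_vec \<Omega> v * grad_norm_vec \<Omega> w"
      "\<And>v \<phi> \<psi>. v \<in> H10_vec \<Omega> \<Longrightarrow> \<phi> \<in> H10 \<Omega> \<Longrightarrow> \<psi> \<in> H10 \<Omega> \<Longrightarrow>
         b_star \<Omega> v \<phi> \<psi> \<le> M * grad_norm_vec \<Omega> v * grad_norm \<Omega> \<phi> * grad_norm \<Omega> \<psi>"
    and spaces: "finite_dim_subspace Xh (H10_vec \<Omega>)" "finite_dim_subspace Qh (L20 \<Omega>)"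
      "finite_dim_subspace Wh (H10 \<Omega>)"
    and inf_sup: "discrete_inf_sup \<Omega> Xh Qh"
    and Vh: "Vh = discretely_div_free \<Omega> Xh Qh"
    and f: "f \<in> dual_space (H10_vec \<Omega>) (grad_norm_vec \<Omega>)"
    and \<gamma>: "\<gamma> \<in> dual_space (H10 \<Omega>) (grad_norm \<Omega>)"
    and nf: "nf = dual_norm (H10_vec \<Omega>) (grad_norm_vec \<Omega>) f"
    and n\<gamma>: "n\<gamma> = dual_norm (H10 \<Omega>) (grad_norm \<Omega>) \<gamma>"
    and K\<^sub>1: "K\<^sub>1 = Ri * C\<^sub>P\<^sup>2 * inverse \<nu> * inverse \<kappa> * n\<gamma> + inverse \<nu> * nf"
    and K\<^sub>2: "K\<^sub>2 = inverse \<kappa> * n\<gamma>"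
    and C\<^sub>G: "C\<^sub>G = \<nu> powr (-1/2) * \<eta> powr (-1/2) * M * sqrt (2 * K\<^sub>1\<^sup>2 + 3 * K\<^sub>2\<^sup>2)"
    and small_data:
      "inverse (\<eta>\<^sup>2) * M *
         (2 * (Ri * C\<^sub>P\<^sup>2 * inverse \<kappa> * n\<gamma> + nf) + inverse (\<kappa>\<^sup>2) * M * n\<gamma>\<^sup>2) < 1"
      "inverse \<eta> * Ri * C\<^sub>P\<^sup>2 < 1"
    and contractive: "C\<^sub>G < 1"
  shows "\<exists>\<sigma> > 0. \<forall>u \<in> Vh. \<forall>\<theta> \<in> Wh. \<forall>w \<in> Vh. \<forall>z \<in> Wh.
           grad_norm_vec \<Omega> u \<le> K\<^sub>1 \<longrightarrow> grad_norm_vec \<Omega> w \<le> K\<^sub>1 \<longrightarrow>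
           B_norm \<Omega> \<nu> \<kappa> (F_op \<Omega> \<nu> \<kappa> Ri f \<gamma> Vh Wh (u, \<theta>) - F_op \<Omega> \<nu> \<kappa> Ri f \<gamma> Vh Wh (w, z))
             \<ge> \<sigma> * B_norm \<Omega> \<nu> \<kappa> ((u, \<theta>) - (w, z))"
proof -
  have \<Omega>: "open \<Omega>" using domain by (simp add: admissible_domain_def)
  note pos = params eta M_bound(1)
  have Xh: "subspace Xh" "Xh \<subseteq> H10_vec \<Omega>" and Wh: "subspace Wh" "Wh \<subseteq> H10 \<Omega>"
    using spaces by (auto simp: finite_dim_subspace_def)
  have QL: "Qh \<subseteq> L2 \<Omega>"
    using spaces(2) by (auto simp: finite_dim_subspace_def L20_def)
  have VX: "Vh \<subseteq> Xh" by (auto simp: Vh discretely_div_free_def)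
  have VH: "Vh \<subseteq> H10_vec \<Omega>" using VX Xh by blast
  have subV: "subspace Vh"
    unfolding Vh using \<Omega> Xh QL H10_vec_subset_H1_vec by (intro subspace_discretely_div_free) auto
  have finV: "\<exists>B. finite B \<and> Vh = span B"
  proof -
    obtain B where "finite B" "Xh = span B" using spaces(1) by (auto simp: finite_dim_subspace_def)
    then show ?thesis using subspace_of_finite_span[OF subV] VX by auto
  qed
  interpret V: energy_space \<Omega> Vh "weak_grad_vec \<Omega>"
  proof
    show "AE_linear_on \<Omega> Vh (weak_grad_vec \<Omega>)"
      using AE_linear_on_subset[OF AE_linear_on_weak_grad_vec[OF \<Omega>]] VH H10_vec_subset_H1_vec by blast
  qed (rule finV)
  interpret W: energy_space \<Omega> Wh "weak_grad \<Omega>"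
  proof
    show "AE_linear_on \<Omega> Wh (weak_grad \<Omega>)"
      using AE_linear_on_subset[OF AE_linear_on_weak_grad[OF \<Omega>]] Wh(2) by (auto simp: H10_def)
  qed (use spaces(3) in \<open>auto simp: finite_dim_subspace_def\<close>)
  note N_def = grad_norm_vec_def[symmetric] grad_norm_def[symmetric]
  have nonneg: "0 \<le> grad_norm_vec \<Omega> v" "0 \<le> grad_norm \<Omega> \<psi>" for v \<psi>
    by (simp_all add: grad_norm_vec_def grad_norm_def L2_norm_nonneg)
  have V4: "Vh \<subseteq> L4 \<Omega>" and W4: "Wh \<subseteq> L4 \<Omega>"
    using H10_vec_subset_L4[OF dim \<Omega>] VH H10_subset_L4[OF dim \<Omega>] Wh(2) by auto
  have V2: "v \<in> L2 \<Omega>" if "v \<in> Vh" for v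
    using that VH H10_vec_subset_H1_vec H1_vec_L2 by blast
  have W2: "\<psi> \<in> L2 \<Omega>" if "\<psi> \<in> Wh" for \<psi>
    using that Wh(2) by (auto simp: H10_def intro: H1_L2)

  have b_skew: "b_form \<Omega> u v w = - b_form \<Omega> u w v" for u v w
    unfolding b_form_eq by (rule vector_density.skew)
  have b_lin: "linear_functional_on Vh (\<lambda>v. b_form \<Omega> u v w)" if "u \<in> Vh" "w \<in> Vh" for u w
    unfolding b_form_eq linear_functional_on_def
    using that V4 subspace_add[OF subV] subspace_scale[OF subV]
    by (auto intro!: vector_density.skew_form_add_middle[OF V.D V4]
        vector_density.skew_form_scaleR_middle[OF V.D V4])
  have b_first: "b_form \<Omega> (u - u') v w = b_form \<Omega> u v w - b_form \<Omega> u' v w"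
    if "u \<in> Vh" "u' \<in> Vh" "v \<in> Vh" "w \<in> Vh" for u u' v w
  proof -
    have "u - u' \<in> L4 \<Omega>" "u' \<in> L4 \<Omega>" using that V4 subspace_diff[OF subV] by auto
    from vector_density.skew_form_add_first[OF V.D V4 this that(3,4)] show ?thesis
      unfolding b_form_eq by simp
  qed
  \<comment> \<open>Exchanging the last two arguments changes the sign, which turns the one-sided
    hypothesis into a two-sided bound.\<close>
  have b_bound: "\<bar>b_form \<Omega> u v w\<bar> \<le> M * grad_norm_vec \<Omega> u * grad_norm_vec \<Omega> v * grad_norm_vec \<Omega> w"
    if "u \<in> Vh" "v \<in> Vh" "w \<in> Vh" for u v w
  proof -
    have H: "u \<in> H10_vec \<Omega>" "v \<in> H10_vec \<Omega>" "w \<in> H10_vec \<Omega>" using that VH by auto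
    have "b_form \<Omega> u w v \<le> M * grad_norm_vec \<Omega> u * grad_norm_vec \<Omega> v * grad_norm_vec \<Omega> w"
      using M_bound(2)[OF H(1,3,2)] by (simp add: mult_ac)
    then show ?thesis using M_bound(2)[OF H] b_skew[of u v w] by linarith
  qed

  have bs_skew: "b_star \<Omega> u v w = - b_star \<Omega> u w v" for u v w
    unfolding b_star_eq by (rule scalar_density.skew)
  have bs_lin: "linear_functional_on Wh (\<lambda>v. b_star \<Omega> u v w)" if "u \<in> Vh" "w \<in> Wh" for u w
    unfolding b_star_eq linear_functional_on_def
    using that V4 subspace_add[OF Wh(1)] subspace_scale[OF Wh(1)]
    by (auto intro!: scalar_density.skew_form_add_middle[OF W.D W4]
        scalar_density.skew_form_scaleR_middle[OF W.D W4])
  have bs_first: "b_star \<Omega> (u - u') v w = b_star \<Omega> u v w - b_star \<Omega> u' v w"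
    if "u \<in> Vh" "u' \<in> Vh" "v \<in> Wh" "w \<in> Wh" for u u' v w
  proof -
    have "u - u' \<in> L4 \<Omega>" "u' \<in> L4 \<Omega>" using that V4 subspace_diff[OF subV] by auto
    from scalar_density.skew_form_add_first[OF W.D W4 this that(3,4)] show ?thesis
      unfolding b_star_eq by simp
  qed
  have bs_bound: "\<bar>b_star \<Omega> u v w\<bar> \<le> M * grad_norm_vec \<Omega> u * grad_norm \<Omega> v * grad_norm \<Omega> w"
    if "u \<in> Vh" "v \<in> Wh" "w \<in> Wh" for u v w
  proof -
    have H: "u \<in> H10_vec \<Omega>" "v \<in> H10 \<Omega>" "w \<in> H10 \<Omega>" using that VH Wh(2) by auto
    have "b_star \<Omega> u w v \<le> M * grad_norm_vec \<Omega> u * grad_norm \<Omega> v * grad_norm \<Omega> w"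
      using M_bound(3)[OF H(1,3,2)] by (simp add: mult_ac)
    then show ?thesis using M_bound(3)[OF H] bs_skew[of u v w] by linarith
  qed

  have f_lin: "linear_functional_on Vh f" and \<gamma>_lin: "linear_functional_on Wh \<gamma>"
    using f \<gamma> VH Wh(2) unfolding dual_space_def linear_functional_on_def by blast+
  have f_bound: "\<bar>f v\<bar> \<le> nf * grad_norm_vec \<Omega> v" and nf0: "nf \<ge> 0" if "v \<in> Vh" for v
    using dual_norm_bound[OF f, of v] that VH subspace_scale[OF subV that] nonneg
      L2_norm_AE_linear_scaleR[OF V.D subV that]
    by (auto simp: nf N_def)
  have \<gamma>_bound: "\<bar>\<gamma> v\<bar> \<le> n\<gamma> * grad_norm \<Omega> v" and n\<gamma>0: "n\<gamma> \<ge> 0" if "v \<in> Wh" for v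
    using dual_norm_bound[OF \<gamma>, of v] that Wh(2) subspace_scale[OF Wh(1) that] nonneg
      L2_norm_AE_linear_scaleR[OF W.D Wh(1) that]
    by (auto simp: n\<gamma> N_def)
  have nf_nonneg: "nf \<ge> 0" and n\<gamma>_nonneg: "n\<gamma> \<ge> 0"
    using nf0 n\<gamma>0 subspace_0 subV Wh(1) by blast+

  have buoy_lin: "linear_functional_on Vh (\<lambda>v. L2_inner \<Omega> (last_component \<theta>) v)" if "\<theta> \<in> Wh" for \<theta>
    unfolding linear_functional_on_def
    using L2_last_component[OF W2[OF that]] V2 by (auto simp: L2_inner_add_right L2_inner_scaleR_right)
  \<comment> \<open>One Poincare inequality for the temperature and one for the velocity account for
    the square of \<open>C\<^sub>P\<close>.\<close>
  have buoy_bound: "\<bar>L2_inner \<Omega> (last_component \<theta>) v\<bar> \<le> C\<^sub>P\<^sup>2 * grad_norm \<Omega> \<theta> * grad_norm_vec \<Omega> v"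
    if "\<theta> \<in> Wh" "v \<in> Vh" for \<theta> v
  proof -
    have "\<bar>L2_inner \<Omega> (last_component \<theta>) v\<bar> \<le> L2_norm \<Omega> \<theta> * L2_norm \<Omega> v"
      using L2_Cauchy_Schwarz[OF L2_last_component[OF W2[OF that(1)]] V2[OF that(2)]]
      by (simp add: L2_norm_last_component)
    also have "\<dots> \<le> (C\<^sub>P * grad_norm \<Omega> \<theta>) * (C\<^sub>P * grad_norm_vec \<Omega> v)"
      using that VH Wh(2) poincare nonneg by (intro mult_mono) (auto simp: L2_norm_nonneg)
    finally show ?thesis by (simp add: power2_eq_square mult_ac)
  qed
  have buoy_diff: "L2_inner \<Omega> (last_component (\<theta> - \<theta>')) v =
      L2_inner \<Omega> (last_component \<theta>) v - L2_inner \<Omega> (last_component \<theta>') v"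
    if "\<theta> \<in> Wh" "\<theta>' \<in> Wh" "v \<in> Vh" for \<theta> \<theta>' v
  proof -
    have "L2_inner \<Omega> (last_component (\<theta> - \<theta>') + last_component \<theta>') v =
        L2_inner \<Omega> (last_component (\<theta> - \<theta>')) v + L2_inner \<Omega> (last_component \<theta>') v"
      using that subspace_diff[OF Wh(1)] by (intro L2_inner_add_left L2_last_component W2 V2)
    then show ?thesis by (simp flip: last_component_add)
  qed

  \<comment> \<open>The system is triangular: the temperature equation does not contain the unknown
    velocity, and once it is solved the buoyancy force is a fixed functional on
    \<open>Vh\<close>.\<close>
  have solvable: "\<exists>U \<Theta>. solves_Picard \<Omega> \<nu> \<kappa> Ri f \<gamma> Vh Wh u U \<Theta>" if u: "u \<in> Vh" for u
  proof -
    have "\<exists>\<Theta>\<in>Wh. \<forall>\<psi>\<in>Wh. b_star \<Omega> u \<Theta> \<psi> + \<kappa> * L2_inner \<Omega> (weak_grad \<Omega> \<Theta>) (weak_grad \<Omega> \<psi>) = \<gamma> \<psi>"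
    proof (rule W.exists_solution[where c = "b_star \<Omega> u", OF pos(2) bs_lin[OF u] bs_skew _ \<gamma>_lin])
      show "b_star \<Omega> u v w \<le> (M * grad_norm_vec \<Omega> u) * W.N v * W.N w"
        if "v \<in> Wh" "w \<in> Wh" for v w
        using bs_bound[OF u that] unfolding N_def by linarith
      show "\<bar>\<gamma> v\<bar> \<le> n\<gamma> * W.N v" if "v \<in> Wh" for v
        using \<gamma>_bound[OF that] unfolding N_def .
    qed
    then obtain \<Theta> where \<Theta>: "\<Theta> \<in> Wh" "\<forall>\<psi>\<in>Wh. b_star \<Omega> u \<Theta> \<psi> + \<kappa> * L2_inner \<Omega> (weak_grad \<Omega> \<Theta>) (weak_grad \<Omega> \<psi>) = \<gamma> \<psi>"
      by blast
    define l where "l v = Ri * L2_inner \<Omega> (last_component \<Theta>) v + f v" for v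
    have l_lin: "linear_functional_on Vh l"
      unfolding l_def using buoy_lin[OF \<Theta>(1)] f_lin
      by (intro linear_functional_on_add linear_functional_on_cmult)
    have l_bound: "\<bar>l v\<bar> \<le> (Ri * (C\<^sub>P\<^sup>2 * grad_norm \<Omega> \<Theta>) + nf) * grad_norm_vec \<Omega> v" if "v \<in> Vh" for v
    proof -
      have "\<bar>l v\<bar> \<le> Ri * \<bar>L2_inner \<Omega> (last_component \<Theta>) v\<bar> + \<bar>f v\<bar>"
        unfolding l_def using pos by (intro order_trans[OF abs_triangle_ineq]) (simp add: abs_mult)
      also have "\<dots> \<le> Ri * (C\<^sub>P\<^sup>2 * grad_norm \<Omega> \<Theta> * grad_norm_vec \<Omega> v) + nf * grad_norm_vec \<Omega> v"
        using buoy_bound[OF \<Theta>(1) that] f_bound[OF that] pos by (intro add_mono mult_left_mono) auto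
      finally show ?thesis by (simp add: algebra_simps)
    qed
    have "\<exists>U\<in>Vh. \<forall>v\<in>Vh. b_form \<Omega> u U v + \<nu> * L2_inner \<Omega> (weak_grad_vec \<Omega> U) (weak_grad_vec \<Omega> v) = l v"
    proof (rule V.exists_solution[where c = "b_form \<Omega> u", OF pos(1) b_lin[OF u] b_skew _ l_lin])
      show "b_form \<Omega> u v w \<le> (M * grad_norm_vec \<Omega> u) * V.N v * V.N w"
        if "v \<in> Vh" "w \<in> Vh" for v w
        using b_bound[OF u that] unfolding N_def by linarith
      show "\<bar>l v\<bar> \<le> (Ri * (C\<^sub>P\<^sup>2 * grad_norm \<Omega> \<Theta>) + nf) * V.N v" if "v \<in> Vh" for v
        using l_bound[OF that] unfolding N_def .
    qed
    then show ?thesis using \<Theta> unfolding solves_Picard_def l_def by blast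
  qed

  \<comment> \<open>\<open>K\<^sub>2\<close> and \<open>K\<^sub>1\<close> are what testing with the
    solution yields: the temperature bound enters the velocity bound through the buoyancy
    term.\<close>
  have K\<^sub>2_eq: "\<kappa> * K\<^sub>2 = n\<gamma>" using pos by (simp add: K\<^sub>2)
  have K\<^sub>1_eq: "\<nu> * K\<^sub>1 = Ri * C\<^sub>P\<^sup>2 * K\<^sub>2 + nf" using pos by (simp add: K\<^sub>1 K\<^sub>2 field_simps)
  have apriori: "grad_norm \<Omega> \<Theta> \<le> K\<^sub>2" "grad_norm_vec \<Omega> U \<le> K\<^sub>1"
    if u: "u \<in> Vh" and sol: "solves_Picard \<Omega> \<nu> \<kappa> Ri f \<gamma> Vh Wh u U \<Theta>" for u U \<Theta>
  proof -
    have UT: "U \<in> Vh" "\<Theta> \<in> Wh" using sol by (auto simp: solves_Picard_def)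
    have "\<kappa> * W.N \<Theta> \<le> n\<gamma>"
    proof (rule W.energy_bound[OF pos(2) UT(2)])
      show "b_star \<Omega> u \<Theta> \<Theta> = 0" using bs_skew[of u \<Theta> \<Theta>] by simp
      show "b_star \<Omega> u \<Theta> \<Theta> + \<kappa> * L2_inner \<Omega> (weak_grad \<Omega> \<Theta>) (weak_grad \<Omega> \<Theta>) = \<gamma> \<Theta>"
        using sol UT by (simp add: solves_Picard_def)
      show "\<gamma> \<Theta> \<le> n\<gamma> * W.N \<Theta>" using \<gamma>_bound[OF UT(2)] by (simp add: N_def)
    qed (rule n\<gamma>_nonneg)
    then show \<Theta>: "grad_norm \<Omega> \<Theta> \<le> K\<^sub>2"
      using pos by (simp add: N_def flip: K\<^sub>2_eq)
    have "\<nu> * V.N U \<le> Ri * (C\<^sub>P\<^sup>2 * grad_norm \<Omega> \<Theta>) + nf"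
    proof (rule V.energy_bound[OF pos(1) UT(1)])
      show "b_form \<Omega> u U U = 0" using b_skew[of u U U] by simp
      show "b_form \<Omega> u U U + \<nu> * L2_inner \<Omega> (weak_grad_vec \<Omega> U) (weak_grad_vec \<Omega> U) =
          Ri * L2_inner \<Omega> (last_component \<Theta>) U + f U"
        using sol UT by (simp add: solves_Picard_def)
      have "Ri * L2_inner \<Omega> (last_component \<Theta>) U \<le> Ri * (C\<^sub>P\<^sup>2 * grad_norm \<Omega> \<Theta> * grad_norm_vec \<Omega> U)"
        using buoy_bound[OF UT(2,1)] pos by (intro mult_left_mono) auto
      then show "Ri * L2_inner \<Omega> (last_component \<Theta>) U + f U \<le> (Ri * (C\<^sub>P\<^sup>2 * grad_norm \<Omega> \<Theta>) + nf) * V.N U"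
        using f_bound[OF UT(1)] by (simp add: N_def algebra_simps)
      show "0 \<le> Ri * (C\<^sub>P\<^sup>2 * grad_norm \<Omega> \<Theta>) + nf" using pos nonneg nf_nonneg by simp
    qed
    also have "\<dots> \<le> Ri * (C\<^sub>P\<^sup>2 * K\<^sub>2) + nf"
      using \<Theta> pos by (intro add_mono mult_left_mono) auto
    finally have "\<nu> * grad_norm_vec \<Omega> U \<le> \<nu> * K\<^sub>1"
      by (simp add: N_def K\<^sub>1_eq mult.assoc)
    then show "grad_norm_vec \<Omega> U \<le> K\<^sub>1" using pos(1) by simp
  qed

  have diff_V: "linear_functional_on Vh l \<Longrightarrow> x \<in> Vh \<Longrightarrow> y \<in> Vh \<Longrightarrow> l (x - y) = l x - l y" for l x y
    using subspace_diff[OF subV] unfolding linear_functional_on_def by (metis add_diff_cancel_right' diff_add_cancel)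
  have diff_W: "linear_functional_on Wh l \<Longrightarrow> x \<in> Wh \<Longrightarrow> y \<in> Wh \<Longrightarrow> l (x - y) = l x - l y" for l x y
    using subspace_diff[OF Wh(1)] unfolding linear_functional_on_def by (metis add_diff_cancel_right' diff_add_cancel)

  \<comment> \<open>The Picard equations contain only the velocity of the input, so
    \<open>\<theta>\<close> and \<open>\<theta>'\<close> are unrelated to the solutions
    here.\<close>
  have contraction: "B_norm \<Omega> \<nu> \<kappa> (U - U', \<Theta> - \<Theta>') \<le> C\<^sub>G * B_norm \<Omega> \<nu> \<kappa> (u - u', \<theta> - \<theta>')"
    if u: "u \<in> Vh" "u' \<in> Vh" and sol: "solves_Picard \<Omega> \<nu> \<kappa> Ri f \<gamma> Vh Wh u U \<Theta>"
      and sol': "solves_Picard \<Omega> \<nu> \<kappa> Ri f \<gamma> Vh Wh u' U' \<Theta>'" for u u' U U' \<Theta> \<Theta>' \<theta> \<theta>'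
  proof -
    have UT: "U \<in> Vh" "\<Theta> \<in> Wh" "U' \<in> Vh" "\<Theta>' \<in> Wh"
      using sol sol' by (auto simp: solves_Picard_def)
    define e \<epsilon> d where "e = U - U'" and "\<epsilon> = \<Theta> - \<Theta>'" and "d = u - u'"
    have mem: "e \<in> Vh" "\<epsilon> \<in> Wh" "d \<in> Vh"
      unfolding e_def \<epsilon>_def d_def using UT u subspace_diff subV Wh(1) by blast+
    have inner_V: "L2_inner \<Omega> (weak_grad_vec \<Omega> e) (weak_grad_vec \<Omega> e) =
        L2_inner \<Omega> (weak_grad_vec \<Omega> U) (weak_grad_vec \<Omega> e) - L2_inner \<Omega> (weak_grad_vec \<Omega> U') (weak_grad_vec \<Omega> e)"
      using diff_V[OF linear_functional_on_L2_inner[OF V.D subV V.D_L2[OF mem(1)]] UT(1,3)]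
      by (simp add: e_def)
    have inner_W: "L2_inner \<Omega> (weak_grad \<Omega> \<epsilon>) (weak_grad \<Omega> \<epsilon>) =
        L2_inner \<Omega> (weak_grad \<Omega> \<Theta>) (weak_grad \<Omega> \<epsilon>) - L2_inner \<Omega> (weak_grad \<Omega> \<Theta>') (weak_grad \<Omega> \<epsilon>)"
      using diff_W[OF linear_functional_on_L2_inner[OF W.D Wh(1) W.D_L2[OF mem(2)]] UT(2,4)]
      by (simp add: \<epsilon>_def)
    have "\<kappa> * W.N \<epsilon> \<le> M * grad_norm_vec \<Omega> d * K\<^sub>2"
    proof (rule W.energy_bound[OF pos(2) mem(2)])
      show "b_star \<Omega> u \<epsilon> \<epsilon> = 0" using bs_skew[of u \<epsilon> \<epsilon>] by simp
      have "b_star \<Omega> u \<Theta> \<epsilon> + \<kappa> * L2_inner \<Omega> (weak_grad \<Omega> \<Theta>) (weak_grad \<Omega> \<epsilon>) = \<gamma> \<epsilon>"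
        "b_star \<Omega> u' \<Theta>' \<epsilon> + \<kappa> * L2_inner \<Omega> (weak_grad \<Omega> \<Theta>') (weak_grad \<Omega> \<epsilon>) = \<gamma> \<epsilon>"
        using sol sol' mem(2) by (auto simp: solves_Picard_def)
      \<comment> \<open>The difference of the two convection terms is b*(u, \<epsilon>, \<epsilon>)
        + b*(d, \<Theta>', \<epsilon>). The first summand vanishes by skew symmetry; the second is
        linear in d and is bounded with the a priori estimate for \<Theta>'.\<close>
      moreover have "b_star \<Omega> u \<epsilon> \<epsilon> = b_star \<Omega> u \<Theta> \<epsilon> - b_star \<Omega> u \<Theta>' \<epsilon>"
        using diff_W[OF bs_lin[OF u(1) mem(2)] UT(2,4)] by (simp add: \<epsilon>_def)
      moreover have "b_star \<Omega> d \<Theta>' \<epsilon> = b_star \<Omega> u \<Theta>' \<epsilon> - b_star \<Omega> u' \<Theta>' \<epsilon>"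
        unfolding d_def using bs_first u UT(4) mem(2) by blast
      ultimately show "b_star \<Omega> u \<epsilon> \<epsilon> + \<kappa> * L2_inner \<Omega> (weak_grad \<Omega> \<epsilon>) (weak_grad \<Omega> \<epsilon>) = - b_star \<Omega> d \<Theta>' \<epsilon>"
        by (simp add: inner_W algebra_simps)
      have "- b_star \<Omega> d \<Theta>' \<epsilon> \<le> M * grad_norm_vec \<Omega> d * grad_norm \<Omega> \<Theta>' * grad_norm \<Omega> \<epsilon>"
        using bs_bound[OF mem(3) UT(4) mem(2)] by simp
      also have "\<dots> \<le> M * grad_norm_vec \<Omega> d * K\<^sub>2 * grad_norm \<Omega> \<epsilon>"
        using apriori(1)[OF u(2) sol'] pos nonneg by (intro mult_right_mono mult_left_mono) auto
      finally show "- b_star \<Omega> d \<Theta>' \<epsilon> \<le> M * grad_norm_vec \<Omega> d * K\<^sub>2 * W.N \<epsilon>" by (simp add: N_def)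
      have "0 \<le> K\<^sub>2" using apriori(1)[OF u(2) sol'] nonneg(2)[of \<Theta>'] by linarith
      then show "0 \<le> M * grad_norm_vec \<Omega> d * K\<^sub>2" using pos nonneg by simp
    qed
    moreover have "\<nu> * V.N e \<le> Ri * C\<^sub>P\<^sup>2 * grad_norm \<Omega> \<epsilon> + M * grad_norm_vec \<Omega> d * K\<^sub>1"
    proof (rule V.energy_bound[OF pos(1) mem(1)])
      show "b_form \<Omega> u e e = 0" using b_skew[of u e e] by simp
      have "b_form \<Omega> u U e + \<nu> * L2_inner \<Omega> (weak_grad_vec \<Omega> U) (weak_grad_vec \<Omega> e) =
          Ri * L2_inner \<Omega> (last_component \<Theta>) e + f e"
        "b_form \<Omega> u' U' e + \<nu> * L2_inner \<Omega> (weak_grad_vec \<Omega> U') (weak_grad_vec \<Omega> e) =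
          Ri * L2_inner \<Omega> (last_component \<Theta>') e + f e"
        using sol sol' mem(1) by (auto simp: solves_Picard_def)
      moreover have "b_form \<Omega> u e e = b_form \<Omega> u U e - b_form \<Omega> u U' e"
        using diff_V[OF b_lin[OF u(1) mem(1)] UT(1,3)] by (simp add: e_def)
      moreover have "b_form \<Omega> d U' e = b_form \<Omega> u U' e - b_form \<Omega> u' U' e"
        unfolding d_def using b_first u UT(3) mem(1) by blast
      \<comment> \<open>The buoyancy difference is the only coupling to the temperature; it stays on
        the right-hand side.\<close>
      moreover have "Ri * L2_inner \<Omega> (last_component \<epsilon>) e =
          Ri * L2_inner \<Omega> (last_component \<Theta>) e - Ri * L2_inner \<Omega> (last_component \<Theta>') e"
        unfolding \<epsilon>_def using buoy_diff[OF UT(2,4) mem(1)] by (simp add: right_diff_distrib)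
      ultimately show "b_form \<Omega> u e e + \<nu> * L2_inner \<Omega> (weak_grad_vec \<Omega> e) (weak_grad_vec \<Omega> e) =
          Ri * L2_inner \<Omega> (last_component \<epsilon>) e - b_form \<Omega> d U' e"
        unfolding inner_V right_diff_distrib by linarith
      have "- b_form \<Omega> d U' e \<le> M * grad_norm_vec \<Omega> d * grad_norm_vec \<Omega> U' * grad_norm_vec \<Omega> e"
        using b_bound[OF mem(3) UT(3) mem(1)] by simp
      also have "\<dots> \<le> M * grad_norm_vec \<Omega> d * K\<^sub>1 * grad_norm_vec \<Omega> e"
        using apriori(2)[OF u(2) sol'] pos nonneg by (intro mult_right_mono mult_left_mono) auto
      finally have "- b_form \<Omega> d U' e \<le> M * grad_norm_vec \<Omega> d * K\<^sub>1 * grad_norm_vec \<Omega> e" .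
      moreover have "Ri * L2_inner \<Omega> (last_component \<epsilon>) e \<le> Ri * (C\<^sub>P\<^sup>2 * grad_norm \<Omega> \<epsilon> * grad_norm_vec \<Omega> e)"
        using buoy_bound[OF mem(2,1)] pos by (intro mult_left_mono) auto
      ultimately show "Ri * L2_inner \<Omega> (last_component \<epsilon>) e - b_form \<Omega> d U' e \<le>
          (Ri * C\<^sub>P\<^sup>2 * grad_norm \<Omega> \<epsilon> + M * grad_norm_vec \<Omega> d * K\<^sub>1) * V.N e"
        by (simp add: N_def algebra_simps)
      have "0 \<le> K\<^sub>1" using apriori(2)[OF u(2) sol'] nonneg(1)[of U'] by linarith
      then show "0 \<le> Ri * C\<^sub>P\<^sup>2 * grad_norm \<Omega> \<epsilon> + M * grad_norm_vec \<Omega> d * K\<^sub>1" using pos nonneg by simp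
    qed
    \<comment> \<open>By the second small data condition; this is the hypothesis on r with which the
      buoyancy term is absorbed.\<close>
    moreover have "Ri * C\<^sub>P\<^sup>2 \<le> \<eta>"
      using small_data(2) pos by (simp add: field_simps)
    ultimately have "sqrt (\<nu> * (grad_norm_vec \<Omega> e)\<^sup>2 + \<kappa> * (grad_norm \<Omega> \<epsilon>)\<^sup>2) \<le>
        C\<^sub>G * sqrt (\<nu> * (grad_norm_vec \<Omega> d)\<^sup>2 + \<kappa> * (grad_norm \<Omega> (\<theta> - \<theta>'))\<^sup>2)"
      using nonneg by (intro contraction_estimate[OF pos(1,2,4,5) _ _ _ _ _ _ C\<^sub>G]) (auto simp: N_def)
    then show ?thesis by (simp add: B_norm_def e_def \<epsilon>_def d_def)
  qed

  have triangle: "B_norm \<Omega> \<nu> \<kappa> (p - q) \<le> B_norm \<Omega> \<nu> \<kappa> p + B_norm \<Omega> \<nu> \<kappa> q"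
    if "p \<in> Vh \<times> Wh" "q \<in> Vh \<times> Wh" for p q
    using that L2_norm_AE_linear_triangle[OF V.D subV, of "fst p" "fst q"]
      L2_norm_AE_linear_triangle[OF W.D Wh(1), of "snd p" "snd q"] pos nonneg
    unfolding B_norm_def N_def by (auto intro!: weighted_norm_triangle)

  show ?thesis
  proof (intro exI[of _ "1 - C\<^sub>G"] conjI ballI impI)
    show "1 - C\<^sub>G > 0" using contractive by simp
    fix u \<theta> w z assume mem: "u \<in> Vh" "\<theta> \<in> Wh" "w \<in> Vh" "z \<in> Wh"
    let ?G = "G_op \<Omega> \<nu> \<kappa> Ri f \<gamma> Vh Wh" and ?F = "F_op \<Omega> \<nu> \<kappa> Ri f \<gamma> Vh Wh" and ?B = "B_norm \<Omega> \<nu> \<kappa>"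
    obtain U \<Theta> U' \<Theta>' where G: "?G (u, \<theta>) = (U, \<Theta>)" "?G (w, z) = (U', \<Theta>')" by fastforce
    have sol: "solves_Picard \<Omega> \<nu> \<kappa> Ri f \<gamma> Vh Wh u U \<Theta>" "solves_Picard \<Omega> \<nu> \<kappa> Ri f \<gamma> Vh Wh w U' \<Theta>'"
      using G_op_solves[OF solvable[OF mem(1)] G(1)] G_op_solves[OF solvable[OF mem(3)] G(2)] by auto
    have UT: "U \<in> Vh" "\<Theta> \<in> Wh" "U' \<in> Vh" "\<Theta>' \<in> Wh"
      using sol by (auto simp: solves_Picard_def)
    have eq: "(u, \<theta>) - (w, z) = (?G (u, \<theta>) - ?G (w, z)) - (?F (u, \<theta>) - ?F (w, z))"
      by (simp add: F_op_def)
    have "?B ((u, \<theta>) - (w, z)) \<le> ?B (?G (u, \<theta>) - ?G (w, z)) + ?B (?F (u, \<theta>) - ?F (w, z))"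
      unfolding eq using mem UT
      by (intro triangle) (auto simp: F_op_def G subspace_diff subV Wh(1))
    also have "?B (?G (u, \<theta>) - ?G (w, z)) \<le> C\<^sub>G * ?B ((u, \<theta>) - (w, z))"
      using contraction[OF mem(1,3) sol, of \<theta> z] by (simp add: G)
    finally show "(1 - C\<^sub>G) * ?B ((u, \<theta>) - (w, z)) \<le> ?B (?F (u, \<theta>) - ?F (w, z))"
      by (simp add: algebra_simps)
  qed
qed

end
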